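(* Let $X$ be a locally compact, path-connected Hausdorff space and let $K$ be a base of $X$ consisting of relatively compact open subsets, ordered under inclusion. If $\phi:(\mathcal{A}_1,\jmath_1)_K\to(\mathcal{A}_2,\jmath_2)_K$ is a morphism of nets of $\mathrm{C}^*$-algebras over $K$, and $\mathscr{A}_1,\mathscr{A}_2$ are the associated $C_0(X)$-algebras, then there is a $C_0(X)$-morphism $\phi^\tau:\mathscr{A}_1\to\mathscr{A}_2$ (the one induced, through the universal property of $\mathscr{A}_1$, by the heteromorphism $\tau_2\circ\phi$), and the assignments $(\mathcal{A},\jmath)_K\mapsto\mathscr{A}$, $\phi\mapsto\phi^\tau$ define a functor from the category of nets of $\mathrm{C}^*$-algebras over $K$ to the category of $C_0(X)$-algebras with $C_0(X)$-morphisms.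
   Context: Nets. A net of $\mathrm{C}^*$-algebras $(\mathcal{A},\jmath)_K$ over a poset $K$ is a family of unital $\mathrm{C}^*$-algebras $\mathcal{A}_Y$, $Y\in K$, with unital $*$-monomorphisms $\jmath_{Y'Y}:\mathcal{A}_Y\to\mathcal{A}_{Y'}$ for $Y\subseteq Y'$ such that $\jmath_{Y''Y'}\circ\jmath_{Y'Y}=\jmath_{Y''Y}$ for $Y\subseteq Y'\subseteq Y''$. A morphism of nets $\phi:(\mathcal{A},\jmath)_K\to(\mathcal{B},y)_K$ is a family of $*$-morphisms $\phi_Y:\mathcal{A}_Y\to\mathcal{B}_Y$ with $\phi_{Y'}\circ\jmath_{Y'Y}=y_{Y'Y}\circ\phi_Y$ for $Y\subseteq Y'$; it is a morphism into a $\mathrm{C}^*$-algebra $B$ when the target is the constant net with fibre $B$ and identity inclusions. The universal $\mathrm{C}^*$-algebra of a net is the $\mathrm{C}^*$-algebra $\vec A$ endowed with a canonical morphism $\epsilon$ of the net into $\vec A$ such that every morphism of the net into a $\mathrm{C}^*$-algebra $B$ factors through $\epsilon$ by a unique $*$-morphism $\vec A\to B$. $C_0(X)$-algebras. A $C_0(X)$-algebra is a $\mathrm{C}^*$-algebra $\mathscr{B}$ with a nondegenerate $*$-morphism from $C_0(X)$ to the centre of the multiplier algebra $M\mathscr{B}$; a $C_0(X)$-morphism is a $*$-morphism $\eta$ between $C_0(X)$-algebras with $\eta(fT)=f\eta(T)$ for $f\in C_0(X)$. For $U\subset X$ open, $C_0(U)\mathscr{B}$ is the closed ideal generated by the elements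 $fv$, $f\in C_0(U)$, $v\in\mathscr{B}$. For $Y\in K$ put $S_Y\mathscr{B}:=\mathscr{B}/C_0(X-\overline{Y})\mathscr{B}$ with quotient map $r_Y$; for $Y\subseteq Y'$ let $r_{YY'}:S_{Y'}\mathscr{B}\to S_Y\mathscr{B}$ be the $*$-morphism with $r_{YY'}\circ r_{Y'}=r_Y$. A $C_0(X)$-morphism $\psi:\mathscr{B}\to\mathscr{B}'$ induces $*$-morphisms $\psi^{s,Y}:S_Y\mathscr{B}\to S_Y\mathscr{B}'$ by $\psi^{s,Y}\circ r_Y:=r'_Y\circ\psi$; the family is denoted $\psi^s$. Heteromorphisms. A heteromorphism $\phi:(\mathcal{A},\jmath)_K\nrightarrow\mathscr{B}$ is a family of $*$-morphisms $\phi_Y:\mathcal{A}_Y\to S_Y\mathscr{B}$ such that $r_{YY'}\circ\phi_{Y'}\circ\jmath_{Y'Y}=\phi_Y$ for all $Y\subseteq Y'$. The algebra $\mathscr{A}$. For $x\in X$ let $\omega_x:=\{Y\in K: x\in Y\}$ and let $\mathcal{A}_x$ be the universal $\mathrm{C}^*$-algebra of the restricted net $(\mathcal{A},\jmath)_{\omega_x}$, with canonical morphism $\{\epsilon^x_Y:\mathcal{A}_Y\to\mathcal{A}_x\}_{Y\in\omega_x}$. For $Y\in K$, $t\in\mathcal{A}_Y$ define $\widehat{\epsilon}_Y(t)\in\mathcal{A}^X:=\prod_{x\in X}\mathcal{A}_x$ (bounded fields, sup-norm) by $\widehat{\epsilon}_Y(t)_x:=\epsilon^x_Y(t)$ if $x\in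 Y$ and $0$ otherwise. $\mathscr{A}$ is the norm closure of the $*$-subalgebra of $\mathcal{A}^X$ generated by the fields $f\,\widehat{\epsilon}_Y(t)$, $Y\in K$, $f\in C_0(Y)$, $t\in\mathcal{A}_Y$; it is a $C_0(X)$-algebra under pointwise multiplication. The canonical heteromorphism $\tau:(\mathcal{A},\jmath)_K\nrightarrow\mathscr{A}$ is $\tau_Y(t):=r_Y(g\,\widehat{\epsilon}_U(\jmath_{UY}(t)))$, $t\in\mathcal{A}_Y$, where $U\in K$ satisfies $\overline{Y}\subset U$ and $g\in C_0(U)$ satisfies $g=1$ on $Y$; it does not depend on the choice of $U$ and $g$. Universal property: any heteromorphism $\phi:(\mathcal{A},\jmath)_K\nrightarrow\mathscr{B}$ into a $C_0(X)$-algebra induces a unique $C_0(X)$-morphism $\bar\phi:\mathscr{A}\to\mathscr{B}$ with $\phi_Y=\bar\phi^{s,Y}\circ\tau_Y$ for all $Y\in K$. Writing $\tau_k:(\mathcal{A}_k,\jmath_k)_K\nrightarrow\mathscr{A}_k$, $k=1,2$, for the canonical heteromorphisms, $\tau_2\circ\phi$ is the heteromorphism $\{\tau_{2,Y}\circ\phi_Y\}_Y$ and $\phi^\tau:=\overline{\tau_2\circ\phi}$.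
   Formalization: It is assumed that the closure of each Y in K lies in some U in K (otherwise τ_Y is undefined); τ uses one fixed choice of (U,g) for each Y, and τ_2∘φ is shown to be a heteromorphism whenever τ_2 is one, which can fail for some bases K. *)

theory Defs
  imports "HOL-Analysis.Analysis"
begin

section \<open>C*-algebras\<close>

text \<open>C*-algebras are records with an explicit carrier, since the fibres of a net vary with the index
  and closures, quotients and products have to be formed. They need not have a unit.\<close>

record 'a calg =
  carrier :: "'a set"
  czero :: 'a  (\<open>\<zero>\<index>\<close>)
  cadd :: "'a \<Rightarrow> 'a \<Rightarrow> 'a"  (infixl \<open>\<oplus>\<index>\<close> 65)
  cscale :: "complex \<Rightarrow> 'a \<Rightarrow> 'a"  (infixr \<open>\<odot>\<index>\<close> 75)
  cmult :: "'a \<Rightarrow> 'a \<Rightarrow> 'a"  (infixl \<open>\<otimes>\<index>\<close> 70)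
  cstar :: "'a \<Rightarrow> 'a"
  cnorm :: "'a \<Rightarrow> real"

text \<open>The cut-off outside the carrier is needed because the locale \<open>Metric_space\<close> asks for a
  symmetric nonnegative function on the whole type.\<close>

definition cdist :: "'a calg \<Rightarrow> 'a \<Rightarrow> 'a \<Rightarrow> real" where
  "cdist A a b =
     (if a \<in> carrier A \<and> b \<in> carrier A then cnorm A (a \<oplus>\<^bsub>A\<^esub> (-1) \<odot>\<^bsub>A\<^esub> b) else 0)"

definition norm_closure :: "'a calg \<Rightarrow> 'a set \<Rightarrow> 'a set" where
  "norm_closure A S = Metric_space.mtopology (carrier A) (cdist A) closure_of S"

locale cstar_algebra =
  fixes A :: "'a calg" (structure)
  assumes zero_closed: "\<zero> \<in> carrier A"
    and add_closed: "\<lbrakk>a \<in> carrier A; b \<in> carrier A\<rbrakk> \<Longrightarrow> a \<oplus> b \<in> carrier A"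
    and scale_closed: "a \<in> carrier A \<Longrightarrow> c \<odot> a \<in> carrier A"
    and mult_closed: "\<lbrakk>a \<in> carrier A; b \<in> carrier A\<rbrakk> \<Longrightarrow> a \<otimes> b \<in> carrier A"
    and star_closed: "a \<in> carrier A \<Longrightarrow> cstar A a \<in> carrier A"
    and add_assoc: "\<lbrakk>a \<in> carrier A; b \<in> carrier A; d \<in> carrier A\<rbrakk> \<Longrightarrow> (a \<oplus> b) \<oplus> d = a \<oplus> (b \<oplus> d)"
    and add_comm: "\<lbrakk>a \<in> carrier A; b \<in> carrier A\<rbrakk> \<Longrightarrow> a \<oplus> b = b \<oplus> a"
    and add_zero: "a \<in> carrier A \<Longrightarrow> \<zero> \<oplus> a = a"
    and add_inverse: "a \<in> carrier A \<Longrightarrow> \<exists>b\<in>carrier A. a \<oplus> b = \<zero>"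
    and scale_add_right: "\<lbrakk>a \<in> carrier A; b \<in> carrier A\<rbrakk> \<Longrightarrow> c \<odot> (a \<oplus> b) = c \<odot> a \<oplus> c \<odot> b"
    and scale_add_left: "a \<in> carrier A \<Longrightarrow> (c + c') \<odot> a = c \<odot> a \<oplus> c' \<odot> a"
    and scale_scale: "a \<in> carrier A \<Longrightarrow> (c * c') \<odot> a = c \<odot> (c' \<odot> a)"
    and scale_one: "a \<in> carrier A \<Longrightarrow> 1 \<odot> a = a"
    and mult_assoc: "\<lbrakk>a \<in> carrier A; b \<in> carrier A; d \<in> carrier A\<rbrakk> \<Longrightarrow> (a \<otimes> b) \<otimes> d = a \<otimes> (b \<otimes> d)"
    and distrib_left: "\<lbrakk>a \<in> carrier A; b \<in> carrier A; d \<in> carrier A\<rbrakk> \<Longrightarrow> a \<otimes> (b \<oplus> d) = a \<otimes> b \<oplus> a \<otimes> d"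
    and distrib_right: "\<lbrakk>a \<in> carrier A; b \<in> carrier A; d \<in> carrier A\<rbrakk> \<Longrightarrow> (a \<oplus> b) \<otimes> d = a \<otimes> d \<oplus> b \<otimes> d"
    and scale_mult_left: "\<lbrakk>a \<in> carrier A; b \<in> carrier A\<rbrakk> \<Longrightarrow> (c \<odot> a) \<otimes> b = c \<odot> (a \<otimes> b)"
    and scale_mult_right: "\<lbrakk>a \<in> carrier A; b \<in> carrier A\<rbrakk> \<Longrightarrow> a \<otimes> (c \<odot> b) = c \<odot> (a \<otimes> b)"
    and star_star: "a \<in> carrier A \<Longrightarrow> cstar A (cstar A a) = a"
    and star_add: "\<lbrakk>a \<in> carrier A; b \<in> carrier A\<rbrakk> \<Longrightarrow> cstar A (a \<oplus> b) = cstar A a \<oplus> cstar A b"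
    and star_scale: "a \<in> carrier A \<Longrightarrow> cstar A (c \<odot> a) = cnj c \<odot> cstar A a"
    and star_mult: "\<lbrakk>a \<in> carrier A; b \<in> carrier A\<rbrakk> \<Longrightarrow> cstar A (a \<otimes> b) = cstar A b \<otimes> cstar A a"
    and norm_eq_zero: "a \<in> carrier A \<Longrightarrow> cnorm A a = 0 \<longleftrightarrow> a = \<zero>"
    and norm_triangle: "\<lbrakk>a \<in> carrier A; b \<in> carrier A\<rbrakk> \<Longrightarrow> cnorm A (a \<oplus> b) \<le> cnorm A a + cnorm A b"
    and norm_scale: "a \<in> carrier A \<Longrightarrow> cnorm A (c \<odot> a) = cmod c * cnorm A a"
    and norm_mult: "\<lbrakk>a \<in> carrier A; b \<in> carrier A\<rbrakk> \<Longrightarrow> cnorm A (a \<otimes> b) \<le> cnorm A a * cnorm A b"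
    and norm_star_mult: "a \<in> carrier A \<Longrightarrow> cnorm A (cstar A a \<otimes> a) = (cnorm A a)\<^sup>2"
    and complete: "Metric_space.mcomplete (carrier A) (cdist A)"

definition is_unit :: "'a calg \<Rightarrow> 'a \<Rightarrow> bool" where
  "is_unit A e \<longleftrightarrow> e \<in> carrier A \<and> (\<forall>a\<in>carrier A. e \<otimes>\<^bsub>A\<^esub> a = a \<and> a \<otimes>\<^bsub>A\<^esub> e = a)"

text \<open>Maps between carriers are extensional, so that equality of morphisms is equality of functions
  and composition is \<open>compose\<close> from \<open>FuncSet\<close>.\<close>

definition cstar_hom :: "'a calg \<Rightarrow> 'b calg \<Rightarrow> ('a \<Rightarrow> 'b) \<Rightarrow> bool" where
  "cstar_hom A B h \<longleftrightarrow> h \<in> carrier A \<rightarrow>\<^sub>E carrier B \<and>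
     (\<forall>a\<in>carrier A. \<forall>b\<in>carrier A. h (a \<oplus>\<^bsub>A\<^esub> b) = h a \<oplus>\<^bsub>B\<^esub> h b) \<and>
     (\<forall>c. \<forall>a\<in>carrier A. h (c \<odot>\<^bsub>A\<^esub> a) = c \<odot>\<^bsub>B\<^esub> h a) \<and>
     (\<forall>a\<in>carrier A. \<forall>b\<in>carrier A. h (a \<otimes>\<^bsub>A\<^esub> b) = h a \<otimes>\<^bsub>B\<^esub> h b) \<and>
     (\<forall>a\<in>carrier A. h (cstar A a) = cstar B (h a))"

definition id_map :: "'a calg \<Rightarrow> 'a \<Rightarrow> 'a" where
  "id_map A = (\<lambda>a\<in>carrier A. a)"

inductive_set star_span :: "'a calg \<Rightarrow> 'a set \<Rightarrow> 'a set" for A S where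
  zero: "\<zero>\<^bsub>A\<^esub> \<in> star_span A S"
| gen: "a \<in> S \<Longrightarrow> a \<in> star_span A S"
| add: "a \<in> star_span A S \<Longrightarrow> b \<in> star_span A S \<Longrightarrow> a \<oplus>\<^bsub>A\<^esub> b \<in> star_span A S"
| scale: "a \<in> star_span A S \<Longrightarrow> c \<odot>\<^bsub>A\<^esub> a \<in> star_span A S"
| mult: "a \<in> star_span A S \<Longrightarrow> b \<in> star_span A S \<Longrightarrow> a \<otimes>\<^bsub>A\<^esub> b \<in> star_span A S"
| star: "a \<in> star_span A S \<Longrightarrow> cstar A a \<in> star_span A S"

inductive_set lin_span :: "'a calg \<Rightarrow> 'a set \<Rightarrow> 'a set" for A S where
  zero: "\<zero>\<^bsub>A\<^esub> \<in> lin_span A S"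
| gen: "a \<in> S \<Longrightarrow> a \<in> lin_span A S"
| add: "a \<in> lin_span A S \<Longrightarrow> b \<in> lin_span A S \<Longrightarrow> a \<oplus>\<^bsub>A\<^esub> b \<in> lin_span A S"
| scale: "a \<in> lin_span A S \<Longrightarrow> c \<odot>\<^bsub>A\<^esub> a \<in> lin_span A S"

definition closed_ideal :: "'a calg \<Rightarrow> 'a set \<Rightarrow> bool" where
  "closed_ideal A I \<longleftrightarrow> I \<subseteq> carrier A \<and> \<zero>\<^bsub>A\<^esub> \<in> I \<and> norm_closure A I = I \<and>
     (\<forall>a\<in>I. \<forall>b\<in>I. a \<oplus>\<^bsub>A\<^esub> b \<in> I) \<and> (\<forall>c. \<forall>a\<in>I. c \<odot>\<^bsub>A\<^esub> a \<in> I) \<and>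
     (\<forall>a\<in>I. \<forall>b\<in>carrier A. a \<otimes>\<^bsub>A\<^esub> b \<in> I \<and> b \<otimes>\<^bsub>A\<^esub> a \<in> I)"

definition ideal_gen :: "'a calg \<Rightarrow> 'a set \<Rightarrow> 'a set" where
  "ideal_gen A S = \<Inter>{I. closed_ideal A I \<and> S \<subseteq> I}"

definition coset :: "'a calg \<Rightarrow> 'a set \<Rightarrow> 'a \<Rightarrow> 'a set" where
  "coset A I = (\<lambda>a\<in>carrier A. (\<lambda>i. a \<oplus>\<^bsub>A\<^esub> i) ` I)"

definition quotient_calg :: "'a calg \<Rightarrow> 'a set \<Rightarrow> 'a set calg" where
  "quotient_calg A I =
     \<lparr>carrier = coset A I ` carrier A,
      czero = coset A I \<zero>\<^bsub>A\<^esub>,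
      cadd = (\<lambda>C D. \<Union>a\<in>C. \<Union>b\<in>D. coset A I (a \<oplus>\<^bsub>A\<^esub> b)),
      cscale = (\<lambda>c C. \<Union>a\<in>C. coset A I (c \<odot>\<^bsub>A\<^esub> a)),
      cmult = (\<lambda>C D. \<Union>a\<in>C. \<Union>b\<in>D. coset A I (a \<otimes>\<^bsub>A\<^esub> b)),
      cstar = (\<lambda>C. \<Union>a\<in>C. coset A I (cstar A a)),
      cnorm = (\<lambda>C. INF a\<in>C. cnorm A a)\<rparr>"

text \<open>The map \<open>h\<close> on \<open>q ` D\<close> with \<open>h \<circ> q = f\<close> on \<open>D\<close>.\<close>

definition factor_map :: "'a set \<Rightarrow> ('a \<Rightarrow> 'b) \<Rightarrow> ('a \<Rightarrow> 'c) \<Rightarrow> 'b \<Rightarrow> 'c" where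
  "factor_map D q f = (\<lambda>y\<in>q ` D. THE z. \<exists>v\<in>D. q v = y \<and> z = f v)"

text \<open>The \<open>0\<close> inserted in the supremum only matters for the empty product.\<close>

definition product_calg :: "'x set \<Rightarrow> ('x \<Rightarrow> 'b calg) \<Rightarrow> ('x \<Rightarrow> 'b) calg" where
  "product_calg S F =
     \<lparr>carrier = {v \<in> \<Pi>\<^sub>E x\<in>S. carrier (F x). bdd_above ((\<lambda>x. cnorm (F x) (v x)) ` S)},
      czero = (\<lambda>x\<in>S. \<zero>\<^bsub>F x\<^esub>),
      cadd = (\<lambda>v w. \<lambda>x\<in>S. v x \<oplus>\<^bsub>F x\<^esub> w x),
      cscale = (\<lambda>c v. \<lambda>x\<in>S. c \<odot>\<^bsub>F x\<^esub> v x),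
      cmult = (\<lambda>v w. \<lambda>x\<in>S. v x \<otimes>\<^bsub>F x\<^esub> w x),
      cstar = (\<lambda>v. \<lambda>x\<in>S. cstar (F x) (v x)),
      cnorm = (\<lambda>v. Sup (insert 0 ((\<lambda>x. cnorm (F x) (v x)) ` S)))\<rparr>"

section \<open>Multiplier algebras\<close>

definition bounded_lin :: "'a calg \<Rightarrow> ('a \<Rightarrow> 'a) \<Rightarrow> bool" where
  "bounded_lin A L \<longleftrightarrow> L \<in> carrier A \<rightarrow>\<^sub>E carrier A \<and>
     (\<forall>a\<in>carrier A. \<forall>b\<in>carrier A. L (a \<oplus>\<^bsub>A\<^esub> b) = L a \<oplus>\<^bsub>A\<^esub> L b) \<and>
     (\<forall>c. \<forall>a\<in>carrier A. L (c \<odot>\<^bsub>A\<^esub> a) = c \<odot>\<^bsub>A\<^esub> L a) \<and>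
     (\<exists>M. \<forall>a\<in>carrier A. cnorm A (L a) \<le> M * cnorm A a)"

text \<open>The multiplier algebra as the algebra of double centralizers \<open>(L, R)\<close>; the multiplier
  \<open>m\<close> corresponds to \<open>L a = m a\<close>, \<open>R a = a m\<close>.\<close>

definition multiplier_calg :: "'a calg \<Rightarrow> (('a \<Rightarrow> 'a) \<times> ('a \<Rightarrow> 'a)) calg" where
  "multiplier_calg A =
     \<lparr>carrier = {(L, R). bounded_lin A L \<and> bounded_lin A R \<and>
        (\<forall>a\<in>carrier A. \<forall>b\<in>carrier A.
           L (a \<otimes>\<^bsub>A\<^esub> b) = L a \<otimes>\<^bsub>A\<^esub> b \<and> R (a \<otimes>\<^bsub>A\<^esub> b) = a \<otimes>\<^bsub>A\<^esub> R b \<and> R a \<otimes>\<^bsub>A\<^esub> b = a \<otimes>\<^bsub>A\<^esub> L b)},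
      czero = (\<lambda>a\<in>carrier A. \<zero>\<^bsub>A\<^esub>, \<lambda>a\<in>carrier A. \<zero>\<^bsub>A\<^esub>),
      cadd = (\<lambda>(L, R) (L', R'). (\<lambda>a\<in>carrier A. L a \<oplus>\<^bsub>A\<^esub> L' a, \<lambda>a\<in>carrier A. R a \<oplus>\<^bsub>A\<^esub> R' a)),
      cscale = (\<lambda>c (L, R). (\<lambda>a\<in>carrier A. c \<odot>\<^bsub>A\<^esub> L a, \<lambda>a\<in>carrier A. c \<odot>\<^bsub>A\<^esub> R a)),
      cmult = (\<lambda>(L, R) (L', R'). (compose (carrier A) L L', compose (carrier A) R' R)),
      cstar = (\<lambda>(L, R). (\<lambda>a\<in>carrier A. cstar A (R (cstar A a)), \<lambda>a\<in>carrier A. cstar A (L (cstar A a)))),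
      cnorm = (\<lambda>(L, R). SUP a\<in>{a \<in> carrier A. cnorm A a \<le> 1}. cnorm A (L a))\<rparr>"

definition center :: "'a calg \<Rightarrow> 'a set" where
  "center A = {z \<in> carrier A. \<forall>a\<in>carrier A. z \<otimes>\<^bsub>A\<^esub> a = a \<otimes>\<^bsub>A\<^esub> z}"

section \<open>C0(X)-algebras\<close>

text \<open>\<open>C0 X U\<close> is \<open>C\<^sub>0(U)\<close> for open \<open>U\<close>, each function being extended by \<open>0\<close> to the whole type;
  in this way \<open>C\<^sub>0(U)\<close> is a subset of \<open>C\<^sub>0(X)\<close>.\<close>

definition C0 :: "'x topology \<Rightarrow> 'x set \<Rightarrow> ('x \<Rightarrow> complex) set" where
  "C0 X U = {f. continuous_map (subtopology X U) euclidean f \<and> (\<forall>x. x \<notin> U \<longrightarrow> f x = 0) \<and>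
     (\<forall>e>0. compactin (subtopology X U) {x \<in> U. e \<le> cmod (f x)})}"

definition C0_calg :: "'x topology \<Rightarrow> ('x \<Rightarrow> complex) calg" where
  "C0_calg X =
     \<lparr>carrier = C0 X (topspace X),
      czero = (\<lambda>x. 0),
      cadd = (\<lambda>f g x. f x + g x),
      cscale = (\<lambda>c f x. c * f x),
      cmult = (\<lambda>f g x. f x * g x),
      cstar = (\<lambda>f x. cnj (f x)),
      cnorm = (\<lambda>f. SUP x. cmod (f x))\<rparr>"

record ('x, 'b) c0alg =
  alg :: "'b calg"
  struct :: "('x \<Rightarrow> complex) \<Rightarrow> ('b \<Rightarrow> 'b) \<times> ('b \<Rightarrow> 'b)"

definition act :: "('x, 'b) c0alg \<Rightarrow> ('x \<Rightarrow> complex) \<Rightarrow> 'b \<Rightarrow> 'b" where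
  "act \<B> f v = fst (struct \<B> f) v"

definition c0_algebra :: "'x topology \<Rightarrow> ('x, 'b) c0alg \<Rightarrow> bool" where
  "c0_algebra X \<B> \<longleftrightarrow> cstar_algebra (alg \<B>) \<and>
     cstar_hom (C0_calg X) (multiplier_calg (alg \<B>)) (struct \<B>) \<and>
     struct \<B> ` carrier (C0_calg X) \<subseteq> center (multiplier_calg (alg \<B>)) \<and>
     norm_closure (alg \<B>)
       (lin_span (alg \<B>) {act \<B> f v | f v. f \<in> carrier (C0_calg X) \<and> v \<in> carrier (alg \<B>)})
       = carrier (alg \<B>)"

definition c0_morphism ::
    "'x topology \<Rightarrow> ('x, 'b) c0alg \<Rightarrow> ('x, 'c) c0alg \<Rightarrow> ('b \<Rightarrow> 'c) \<Rightarrow> bool" where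
  "c0_morphism X \<B> \<C> \<eta> \<longleftrightarrow> cstar_hom (alg \<B>) (alg \<C>) \<eta> \<and>
     (\<forall>f\<in>carrier (C0_calg X). \<forall>v\<in>carrier (alg \<B>). \<eta> (act \<B> f v) = act \<C> f (\<eta> v))"

definition c0_ideal :: "'x topology \<Rightarrow> 'x set \<Rightarrow> ('x, 'b) c0alg \<Rightarrow> 'b set" where
  "c0_ideal X U \<B> = ideal_gen (alg \<B>) {act \<B> f v | f v. f \<in> C0 X U \<and> v \<in> carrier (alg \<B>)}"

text \<open>\<open>stalk_calg X Y \<B>\<close> is \<open>S\<^sub>Y \<B>\<close>, \<open>stalk_proj X Y \<B>\<close> is \<open>r\<^sub>Y\<close>, \<open>stalk_restrict X Y Y' \<B>\<close> is
  \<open>r\<^sub>Y\<^sub>Y\<^sub>'\<close> and \<open>stalk_map X Y \<B> \<C> \<psi>\<close> is the induced map of \<open>\<psi>\<close> between the \<open>S\<^sub>Y\<close>.\<close>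

definition stalk_calg :: "'x topology \<Rightarrow> 'x set \<Rightarrow> ('x, 'b) c0alg \<Rightarrow> 'b set calg" where
  "stalk_calg X Y \<B> = quotient_calg (alg \<B>) (c0_ideal X (topspace X - X closure_of Y) \<B>)"

definition stalk_proj :: "'x topology \<Rightarrow> 'x set \<Rightarrow> ('x, 'b) c0alg \<Rightarrow> 'b \<Rightarrow> 'b set" where
  "stalk_proj X Y \<B> = coset (alg \<B>) (c0_ideal X (topspace X - X closure_of Y) \<B>)"

definition stalk_restrict ::
    "'x topology \<Rightarrow> 'x set \<Rightarrow> 'x set \<Rightarrow> ('x, 'b) c0alg \<Rightarrow> 'b set \<Rightarrow> 'b set" where
  "stalk_restrict X Y Y' \<B> = factor_map (carrier (alg \<B>)) (stalk_proj X Y' \<B>) (stalk_proj X Y \<B>)"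

definition stalk_map ::
    "'x topology \<Rightarrow> 'x set \<Rightarrow> ('x, 'b) c0alg \<Rightarrow> ('x, 'c) c0alg \<Rightarrow> ('b \<Rightarrow> 'c) \<Rightarrow> 'b set \<Rightarrow> 'c set" where
  "stalk_map X Y \<B> \<C> \<psi> =
     factor_map (carrier (alg \<B>)) (stalk_proj X Y \<B>) (\<lambda>v. stalk_proj X Y \<C> (\<psi> v))"

section \<open>Nets and their universal C*-algebras\<close>

text \<open>\<open>incl \<A> Y' Y\<close> is the inclusion of the fibre over \<open>Y\<close> into the fibre over \<open>Y'\<close>. Only the values
  on indices in the poset matter.\<close>

record ('x, 'a) net =
  fib :: "'x set \<Rightarrow> 'a calg"
  incl :: "'x set \<Rightarrow> 'x set \<Rightarrow> 'a \<Rightarrow> 'a"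

definition is_net :: "'x set set \<Rightarrow> ('x, 'a) net \<Rightarrow> bool" where
  "is_net K \<A> \<longleftrightarrow>
     (\<forall>Y\<in>K. cstar_algebra (fib \<A> Y) \<and> (\<exists>e. is_unit (fib \<A> Y) e)) \<and>
     (\<forall>Y\<in>K. \<forall>Y'\<in>K. Y \<subseteq> Y' \<longrightarrow>
        cstar_hom (fib \<A> Y) (fib \<A> Y') (incl \<A> Y' Y) \<and>
        inj_on (incl \<A> Y' Y) (carrier (fib \<A> Y)) \<and>
        (\<forall>e. is_unit (fib \<A> Y) e \<longrightarrow> is_unit (fib \<A> Y') (incl \<A> Y' Y e))) \<and>
     (\<forall>Y\<in>K. \<forall>Y'\<in>K. \<forall>Y''\<in>K. Y \<subseteq> Y' \<and> Y' \<subseteq> Y'' \<longrightarrow>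
        compose (carrier (fib \<A> Y)) (incl \<A> Y'' Y') (incl \<A> Y' Y) = incl \<A> Y'' Y)"

definition net_morphism ::
    "'x set set \<Rightarrow> ('x, 'a) net \<Rightarrow> ('x, 'b) net \<Rightarrow> ('x set \<Rightarrow> 'a \<Rightarrow> 'b) \<Rightarrow> bool" where
  "net_morphism K \<A> \<B> \<phi> \<longleftrightarrow> \<phi> \<in> extensional K \<and>
     (\<forall>Y\<in>K. cstar_hom (fib \<A> Y) (fib \<B> Y) (\<phi> Y)) \<and>
     (\<forall>Y\<in>K. \<forall>Y'\<in>K. Y \<subseteq> Y' \<longrightarrow>
        compose (carrier (fib \<A> Y)) (\<phi> Y') (incl \<A> Y' Y) =
        compose (carrier (fib \<A> Y)) (incl \<B> Y' Y) (\<phi> Y))"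

definition net_id :: "'x set set \<Rightarrow> ('x, 'a) net \<Rightarrow> 'x set \<Rightarrow> 'a \<Rightarrow> 'a" where
  "net_id K \<A> = (\<lambda>Y\<in>K. id_map (fib \<A> Y))"

definition family_comp ::
    "'x set set \<Rightarrow> ('x, 'a) net \<Rightarrow> ('x set \<Rightarrow> 'b \<Rightarrow> 'c) \<Rightarrow> ('x set \<Rightarrow> 'a \<Rightarrow> 'b) \<Rightarrow> 'x set \<Rightarrow> 'a \<Rightarrow> 'c" where
  "family_comp K \<A> \<psi> \<phi> = (\<lambda>Y\<in>K. compose (carrier (fib \<A> Y)) (\<psi> Y) (\<phi> Y))"

definition const_net :: "'b calg \<Rightarrow> ('x, 'b) net" where
  "const_net B = \<lparr>fib = (\<lambda>Y. B), incl = (\<lambda>Y' Y. id_map B)\<rparr>"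

definition is_universal ::
    "'x set set \<Rightarrow> ('x, 'a) net \<Rightarrow> 'u calg \<Rightarrow> ('x set \<Rightarrow> 'a \<Rightarrow> 'u) \<Rightarrow> bool" where
  "is_universal K \<A> U \<epsilon> \<longleftrightarrow> cstar_algebra U \<and> net_morphism K \<A> (const_net U) \<epsilon> \<and>
     (\<forall>(B :: 'u calg) \<pi>. cstar_algebra B \<and> net_morphism K \<A> (const_net B) \<pi> \<longrightarrow>
        (\<exists>!h. cstar_hom U B h \<and> family_comp K \<A> (\<lambda>Y. h) \<epsilon> = \<pi>))"

text \<open>HOL cannot quantify over types inside a definition, so the universal property has to be tested
  on the C*-algebras living on one type \<open>'u\<close>. We take a type that is large enough for this to be no
  restriction. If \<open>\<pi>\<close> is a morphism of the net into a C*-algebra on any type, each element of the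
  C*-subalgebra generated by the image of \<open>\<pi>\<close> is the limit of a sequence of *-polynomials in the
  elements \<open>\<pi>\<^sub>Y(t)\<close>. Choosing such a sequence for each element embeds this C*-subalgebra
  into \<open>nat \<Rightarrow> ('x, 'a) star_term\<close>, with \<open>Gen Y t\<close> standing for \<open>\<pi>\<^sub>Y(t)\<close>. In particular a universal
  C*-algebra exists on this type, and it is universal among all C*-algebras.\<close>

datatype ('x, 'a) star_term =
    Gen "'x set" 'a
  | Zero
  | Plus "('x, 'a) star_term" "('x, 'a) star_term"
  | Scale complex "('x, 'a) star_term"
  | Times "('x, 'a) star_term" "('x, 'a) star_term"
  | Star "('x, 'a) star_term"

type_synonym ('x, 'a) univ = "nat \<Rightarrow> ('x, 'a) star_term"

definition universal ::
    "'x set set \<Rightarrow> ('x, 'a) net \<Rightarrow> ('x, 'a) univ calg \<times> ('x set \<Rightarrow> 'a \<Rightarrow> ('x, 'a) univ)" where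
  "universal K \<A> = (SOME (U, \<epsilon>). is_universal K \<A> U \<epsilon>)"

section \<open>The C0(X)-algebra of a net\<close>

text \<open>\<open>point_calg K \<A> x\<close> is \<open>\<A>\<^sub>x\<close> and \<open>point_eps K \<A> x\<close> is \<open>\<epsilon>\<^sup>x\<close>.\<close>

definition point_calg :: "'x set set \<Rightarrow> ('x, 'a) net \<Rightarrow> 'x \<Rightarrow> ('x, 'a) univ calg" where
  "point_calg K \<A> x = fst (universal {Y \<in> K. x \<in> Y} \<A>)"

definition point_eps :: "'x set set \<Rightarrow> ('x, 'a) net \<Rightarrow> 'x \<Rightarrow> 'x set \<Rightarrow> 'a \<Rightarrow> ('x, 'a) univ" where
  "point_eps K \<A> x = snd (universal {Y \<in> K. x \<in> Y} \<A>)"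

definition field_calg ::
    "'x topology \<Rightarrow> 'x set set \<Rightarrow> ('x, 'a) net \<Rightarrow> ('x \<Rightarrow> ('x, 'a) univ) calg" where
  "field_calg X K \<A> = product_calg (topspace X) (point_calg K \<A>)"

definition eps_hat ::
    "'x topology \<Rightarrow> 'x set set \<Rightarrow> ('x, 'a) net \<Rightarrow> 'x set \<Rightarrow> 'a \<Rightarrow> 'x \<Rightarrow> ('x, 'a) univ" where
  "eps_hat X K \<A> Y t =
     (\<lambda>x\<in>topspace X. if x \<in> Y then point_eps K \<A> x Y t else \<zero>\<^bsub>point_calg K \<A> x\<^esub>)"

definition field_act ::
    "'x topology \<Rightarrow> 'x set set \<Rightarrow> ('x, 'a) net \<Rightarrow> ('x \<Rightarrow> complex) \<Rightarrow> ('x \<Rightarrow> ('x, 'a) univ) \<Rightarrow> 'x \<Rightarrow> ('x, 'a) univ" where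
  "field_act X K \<A> f v = (\<lambda>x\<in>topspace X. f x \<odot>\<^bsub>point_calg K \<A> x\<^esub> v x)"

definition net_calg ::
    "'x topology \<Rightarrow> 'x set set \<Rightarrow> ('x, 'a) net \<Rightarrow> ('x \<Rightarrow> ('x, 'a) univ) calg" where
  "net_calg X K \<A> = (field_calg X K \<A>)
     \<lparr>carrier := norm_closure (field_calg X K \<A>) (star_span (field_calg X K \<A>)
        {field_act X K \<A> f (eps_hat X K \<A> Y t) | f Y t. Y \<in> K \<and> f \<in> C0 X Y \<and> t \<in> carrier (fib \<A> Y)})\<rparr>"

definition net_c0alg ::
    "'x topology \<Rightarrow> 'x set set \<Rightarrow> ('x, 'a) net \<Rightarrow> ('x, 'x \<Rightarrow> ('x, 'a) univ) c0alg" where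
  "net_c0alg X K \<A> =
     \<lparr>alg = net_calg X K \<A>,
      struct = (\<lambda>f\<in>carrier (C0_calg X).
        let L = (\<lambda>v\<in>carrier (net_calg X K \<A>). field_act X K \<A> f v) in (L, L))\<rparr>"

section \<open>Heteromorphisms and induced morphisms\<close>

definition heteromorphism ::
    "'x topology \<Rightarrow> 'x set set \<Rightarrow> ('x, 'a) net \<Rightarrow> ('x, 'b) c0alg \<Rightarrow> ('x set \<Rightarrow> 'a \<Rightarrow> 'b set) \<Rightarrow> bool" where
  "heteromorphism X K \<A> \<B> \<phi> \<longleftrightarrow> \<phi> \<in> extensional K \<and>
     (\<forall>Y\<in>K. cstar_hom (fib \<A> Y) (stalk_calg X Y \<B>) (\<phi> Y)) \<and>
     (\<forall>Y\<in>K. \<forall>Y'\<in>K. Y \<subseteq> Y' \<longrightarrow>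
        (\<forall>t\<in>carrier (fib \<A> Y). stalk_restrict X Y Y' \<B> (\<phi> Y' (incl \<A> Y' Y t)) = \<phi> Y t))"

text \<open>The auxiliary pair \<open>(U, g)\<close> is chosen once for each \<open>Y\<close>, and does not depend on the net.
  The definition is meaningful only if the closure of \<open>Y\<close> is contained in some member of \<open>K\<close>.\<close>

definition tau_choice :: "'x topology \<Rightarrow> 'x set set \<Rightarrow> 'x set \<Rightarrow> 'x set \<times> ('x \<Rightarrow> complex)" where
  "tau_choice X K Y =
     (SOME (U, g). U \<in> K \<and> X closure_of Y \<subseteq> U \<and> g \<in> C0 X U \<and> (\<forall>x\<in>Y. g x = 1))"

definition tau ::
    "'x topology \<Rightarrow> 'x set set \<Rightarrow> ('x, 'a) net \<Rightarrow> 'x set \<Rightarrow> 'a \<Rightarrow> ('x \<Rightarrow> ('x, 'a) univ) set" where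
  "tau X K \<A> = (\<lambda>Y\<in>K. \<lambda>t\<in>carrier (fib \<A> Y). case tau_choice X K Y of (U, g) \<Rightarrow>
     stalk_proj X Y (net_c0alg X K \<A>) (field_act X K \<A> g (eps_hat X K \<A> U (incl \<A> U Y t))))"

definition induces ::
    "'x topology \<Rightarrow> 'x set set \<Rightarrow> ('x, 'a) net \<Rightarrow> ('x, 'b) c0alg \<Rightarrow>
     ('x set \<Rightarrow> 'a \<Rightarrow> 'b set) \<Rightarrow> (('x \<Rightarrow> ('x, 'a) univ) \<Rightarrow> 'b) \<Rightarrow> bool" where
  "induces X K \<A> \<B> \<phi> \<psi> \<longleftrightarrow> c0_morphism X (net_c0alg X K \<A>) \<B> \<psi> \<and>
     (\<forall>Y\<in>K. \<forall>t\<in>carrier (fib \<A> Y).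
        \<phi> Y t = stalk_map X Y (net_c0alg X K \<A>) \<B> \<psi> (tau X K \<A> Y t))"

definition induced ::
    "'x topology \<Rightarrow> 'x set set \<Rightarrow> ('x, 'a) net \<Rightarrow> ('x, 'b) c0alg \<Rightarrow>
     ('x set \<Rightarrow> 'a \<Rightarrow> 'b set) \<Rightarrow> ('x \<Rightarrow> ('x, 'a) univ) \<Rightarrow> 'b" where
  "induced X K \<A> \<B> \<phi> = (THE \<psi>. induces X K \<A> \<B> \<phi> \<psi>)"

definition phi_tau ::
    "'x topology \<Rightarrow> 'x set set \<Rightarrow> ('x, 'a) net \<Rightarrow> ('x, 'b) net \<Rightarrow> ('x set \<Rightarrow> 'a \<Rightarrow> 'b) \<Rightarrow>
     ('x \<Rightarrow> ('x, 'a) univ) \<Rightarrow> ('x \<Rightarrow> ('x, 'b) univ)" where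
  "phi_tau X K \<A> \<B> \<phi> = induced X K \<A> (net_c0alg X K \<B>) (family_comp K \<A> (tau X K \<B>) \<phi>)"

section \<open>Categories and functors\<close>

text \<open>\<open>Comp C a b c g f\<close> is \<open>g \<circ> f\<close> for \<open>f : a \<rightarrow> b\<close> and \<open>g : b \<rightarrow> c\<close>.\<close>

record ('o, 'm) cat =
  Obj :: "'o set"
  Hom :: "'o \<Rightarrow> 'o \<Rightarrow> 'm set"
  Ident :: "'o \<Rightarrow> 'm"
  Comp :: "'o \<Rightarrow> 'o \<Rightarrow> 'o \<Rightarrow> 'm \<Rightarrow> 'm \<Rightarrow> 'm"

definition is_category :: "('o, 'm) cat \<Rightarrow> bool" where
  "is_category C \<longleftrightarrow>
     (\<forall>a\<in>Obj C. Ident C a \<in> Hom C a a) \<and>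
     (\<forall>a\<in>Obj C. \<forall>b\<in>Obj C. \<forall>c\<in>Obj C. \<forall>f\<in>Hom C a b. \<forall>g\<in>Hom C b c. Comp C a b c g f \<in> Hom C a c) \<and>
     (\<forall>a\<in>Obj C. \<forall>b\<in>Obj C. \<forall>f\<in>Hom C a b.
        Comp C a a b f (Ident C a) = f \<and> Comp C a b b (Ident C b) f = f) \<and>
     (\<forall>a\<in>Obj C. \<forall>b\<in>Obj C. \<forall>c\<in>Obj C. \<forall>d\<in>Obj C. \<forall>f\<in>Hom C a b. \<forall>g\<in>Hom C b c. \<forall>h\<in>Hom C c d.
        Comp C a c d h (Comp C a b c g f) = Comp C a b d (Comp C b c d h g) f)"

definition is_functor ::
    "('o, 'm) cat \<Rightarrow> ('p, 'n) cat \<Rightarrow> ('o \<Rightarrow> 'p) \<Rightarrow> ('o \<Rightarrow> 'o \<Rightarrow> 'm \<Rightarrow> 'n) \<Rightarrow> bool" where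
  "is_functor C D F G \<longleftrightarrow> is_category C \<and> is_category D \<and>
     (\<forall>a\<in>Obj C. F a \<in> Obj D) \<and>
     (\<forall>a\<in>Obj C. \<forall>b\<in>Obj C. \<forall>f\<in>Hom C a b. G a b f \<in> Hom D (F a) (F b)) \<and>
     (\<forall>a\<in>Obj C. G a a (Ident C a) = Ident D (F a)) \<and>
     (\<forall>a\<in>Obj C. \<forall>b\<in>Obj C. \<forall>c\<in>Obj C. \<forall>f\<in>Hom C a b. \<forall>g\<in>Hom C b c.
        G a c (Comp C a b c g f) = Comp D (F a) (F b) (F c) (G b c g) (G a b f))"

definition net_cat :: "'x set set \<Rightarrow> (('x, 'a) net, 'x set \<Rightarrow> 'a \<Rightarrow> 'a) cat" where
  "net_cat K =
     \<lparr>Obj = {\<A>. is_net K \<A>},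
      Hom = (\<lambda>\<A> \<B>. {\<phi>. net_morphism K \<A> \<B> \<phi>}),
      Ident = net_id K,
      Comp = (\<lambda>\<A> \<B> \<C> \<psi> \<phi>. family_comp K \<A> \<psi> \<phi>)\<rparr>"

definition c0_cat :: "'x topology \<Rightarrow> (('x, 'b) c0alg, 'b \<Rightarrow> 'b) cat" where
  "c0_cat X =
     \<lparr>Obj = {\<B>. c0_algebra X \<B>},
      Hom = (\<lambda>\<B> \<C>. {\<eta>. c0_morphism X \<B> \<C> \<eta>}),
      Ident = (\<lambda>\<B>. id_map (alg \<B>)),
      Comp = (\<lambda>\<B> \<C> \<D> \<zeta> \<eta>. compose (carrier (alg \<B>)) \<zeta> \<eta>)\<rparr>"

definition rel_compact_base :: "'x topology \<Rightarrow> 'x set set \<Rightarrow> bool" where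
  "rel_compact_base X K \<longleftrightarrow> openin X = arbitrary union_of (\<lambda>Y. Y \<in> K) \<and>
     (\<forall>Y\<in>K. compactin X (X closure_of Y))"

end

theory Submission
  imports Defs
begin

text \<open>A morphism \<open>\<phi>\<close> of nets induces a *-morphism of the fibre over each point \<open>x\<close> by the universal
  property; these are contractive, so they act on bounded fields, and they send
  \<open>f \<epsilon>\<^sub>Y(t)\<close> to \<open>f \<epsilon>\<^sub>Y(\<phi>\<^sub>Y t)\<close>. A \<open>C\<^sub>0(X)\<close>-morphism has these values on the generators if and only if
  it is induced by the heteromorphism \<open>\<tau> \<circ> \<phi>\<close>, which gives existence and uniqueness, and functoriality
  may be tested on generators. The universal C*-algebra of a net is realised as the C*-subalgebra
  generated by the net in the product of all its representations; the product consists of bounded families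
  because *-morphisms are contractive. The latter is proved without spectral theory: a self-adjoint
  element of norm at most \<open>1/2\<close> is the real part of a unitary of the unitization.\<close>

section \<open>Elementary properties of C*-algebras\<close>

text \<open>The values of \<open>tau\<close> are classes modulo an ideal known only through its
  generators. The way around this is a one-sided fact: every member of that ideal vanishes on
  \<open>Y\<close>. Equality of classes thus gives equality of fields on \<open>Y\<close>, and a
  factor vanishing off \<open>Y\<close> makes it an equality everywhere. When the target is itself
  the algebra of a net, the induced map can then be written down fibre by fibre, without
  constructing morphisms into arbitrary \<open>C_0(X)\<close>-algebras. A second obstacle is one of
  types: the product of all representations does not live on the type on which universality is
  tested, so the subalgebra generated in it is moved there along an injection. Contractivity also
  makes morphisms continuous, so equalities on generators reach the norm closure. The unitarity
  equation behind it can be written without a unit and is preserved by every *-morphism; it bounds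
  the norm of any solution by 2, and scaling turns this into a bound whose constant does not depend
  on the morphism.\<close>

abbreviation cminus :: "'a calg \<Rightarrow> 'a \<Rightarrow> 'a \<Rightarrow> 'a"  (infixl \<open>\<ominus>\<index>\<close> 65) where
  "cminus A a b \<equiv> cadd A a (cscale A (-1) b)"

section \<open>Arithmetic and norm of a C*-algebra\<close>

context cstar_algebra
begin

lemmas closed = zero_closed add_closed scale_closed mult_closed star_closed

lemma add_left_comm:
  assumes "a \<in> carrier A" "b \<in> carrier A" "d \<in> carrier A"
  shows "a \<oplus> (b \<oplus> d) = b \<oplus> (a \<oplus> d)"
  using assms by (metis add_assoc add_comm)

lemmas add_ac = add_assoc add_comm add_left_comm

lemma add_zero_right: "a \<in> carrier A \<Longrightarrow> a \<oplus> \<zero> = a"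
  using add_zero add_comm zero_closed by metis

lemma add_left_cancel:
  assumes "a \<in> carrier A" "b \<in> carrier A" "d \<in> carrier A"
  shows "a \<oplus> b = a \<oplus> d \<longleftrightarrow> b = d"
proof
  assume eq: "a \<oplus> b = a \<oplus> d"
  obtain n where n: "n \<in> carrier A" "a \<oplus> n = \<zero>"
    using add_inverse assms by blast
  have "b = n \<oplus> (a \<oplus> b)" "d = n \<oplus> (a \<oplus> d)"
    using n assms by (metis add_assoc add_comm add_zero)+
  then show "b = d" using eq by simp
qed simp

lemma zero_scale:
  assumes "a \<in> carrier A"
  shows "0 \<odot> a = \<zero>"
proof -
  have "a \<oplus> 0 \<odot> a = (1 + 0) \<odot> a"
    using assms by (simp only: scale_add_left scale_one)
  also have "\<dots> = a \<oplus> \<zero>" using assms by (simp add: scale_one add_zero_right)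
  finally show ?thesis using assms by (simp add: add_left_cancel closed)
qed

lemma scale_zero: "c \<odot> \<zero> = \<zero>"
  by (metis mult_zero_right scale_scale zero_closed zero_scale)

lemma minus_self:
  assumes "a \<in> carrier A"
  shows "a \<ominus> a = \<zero>"
  using assms zero_scale scale_add_left[of a 1 "-1"] scale_one by simp

lemma minus_add_self: "a \<in> carrier A \<Longrightarrow> (-1) \<odot> a \<oplus> a = \<zero>"
  using minus_self add_comm closed by metis

lemma mult_zero: "a \<in> carrier A \<Longrightarrow> a \<otimes> \<zero> = \<zero>"
  by (metis scale_mult_right zero_closed zero_scale mult_closed)

lemma zero_mult: "a \<in> carrier A \<Longrightarrow> \<zero> \<otimes> a = \<zero>"
  by (metis scale_mult_left zero_closed zero_scale mult_closed)

lemma star_zero: "cstar A \<zero> = \<zero>"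
  by (metis star_scale zero_closed zero_scale star_closed complex_cnj_zero)

lemma minus_eq_zero_iff:
  assumes "a \<in> carrier A" "b \<in> carrier A"
  shows "a \<ominus> b = \<zero> \<longleftrightarrow> a = b"
proof
  assume "a \<ominus> b = \<zero>"
  then have "(-1) \<odot> b \<oplus> a = (-1) \<odot> b \<oplus> b"
    using assms by (metis minus_add_self add_comm scale_closed)
  then show "a = b" using assms by (simp add: add_left_cancel closed)
qed (simp add: minus_self assms)

lemma minus_trans:
  assumes "a \<in> carrier A" "b \<in> carrier A" "d \<in> carrier A"
  shows "a \<ominus> d = (a \<ominus> b) \<oplus> (b \<ominus> d)"
proof -
  have "(a \<ominus> b) \<oplus> (b \<ominus> d) = a \<oplus> (((-1) \<odot> b \<oplus> b) \<oplus> (-1) \<odot> d)"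
    using assms by (simp add: add_assoc closed)
  also have "\<dots> = a \<ominus> d"
    using assms by (simp add: minus_add_self add_zero closed)
  finally show ?thesis by simp
qed

lemma minus_swap:
  assumes "a \<in> carrier A" "b \<in> carrier A"
  shows "b \<ominus> a = (-1) \<odot> (a \<ominus> b)"
  using assms by (simp add: scale_add_right scale_scale[symmetric] scale_one closed add_comm)

lemma minus_add_cancel:
  assumes "a \<in> carrier A" "b \<in> carrier A"
  shows "b \<oplus> (a \<ominus> b) = a"
  using assms by (metis add_comm add_left_comm add_zero_right minus_self scale_closed)

lemma add_minus_add:
  assumes "a \<in> carrier A" "b \<in> carrier A" "a' \<in> carrier A" "b' \<in> carrier A"
  shows "(a \<oplus> b) \<ominus> (a' \<oplus> b') = (a \<ominus> a') \<oplus> (b \<ominus> b')"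
  using assms by (simp add: scale_add_right add_ac closed)

lemma scale_minus:
  assumes "a \<in> carrier A" "b \<in> carrier A"
  shows "c \<odot> (a \<ominus> b) = c \<odot> a \<ominus> c \<odot> b"
  using assms by (simp add: scale_add_right closed scale_scale[symmetric] mult.commute)

lemma star_minus:
  assumes "a \<in> carrier A" "b \<in> carrier A"
  shows "cstar A (a \<ominus> b) = cstar A a \<ominus> cstar A b"
  using assms by (simp add: star_add star_scale closed)

lemma mult_minus:
  assumes "a \<in> carrier A" "b \<in> carrier A" "d \<in> carrier A"
  shows "a \<otimes> (b \<ominus> d) = a \<otimes> b \<ominus> a \<otimes> d"
  using assms by (simp add: distrib_left scale_mult_right closed)

lemma minus_mult:
  assumes "a \<in> carrier A" "b \<in> carrier A" "d \<in> carrier A"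
  shows "(a \<ominus> b) \<otimes> d = a \<otimes> d \<ominus> b \<otimes> d"
  using assms by (simp add: distrib_right scale_mult_left closed)

text \<open>Telescopes through \<open>a \<otimes> b'\<close> and keeps the order of the factors; for
  two squares it yields the Lipschitz estimate of the square-root iteration.\<close>

lemma mult_minus_mult:
  assumes "a \<in> carrier A" "b \<in> carrier A" "a' \<in> carrier A" "b' \<in> carrier A"
  shows "a \<otimes> b \<ominus> a' \<otimes> b' = a \<otimes> (b \<ominus> b') \<oplus> (a \<ominus> a') \<otimes> b'"
  using minus_trans[of "a \<otimes> b" "a \<otimes> b'" "a' \<otimes> b'"] assms by (simp only: mult_minus minus_mult closed)

lemma norm_zero: "cnorm A \<zero> = 0"
  using norm_eq_zero zero_closed by blast

text \<open>Positivity is not an axiom. It follows from the triangle inequality for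
  \<open>a \<ominus> a\<close>, whose right-hand side is twice the norm of \<open>a\<close>.\<close>

lemma norm_nonneg:
  assumes "a \<in> carrier A"
  shows "0 \<le> cnorm A a"
proof -
  have "cnorm A (a \<ominus> a) \<le> cnorm A a + cnorm A ((-1) \<odot> a)"
    by (intro norm_triangle closed assms)
  then show ?thesis using assms by (simp add: minus_self norm_zero norm_scale)
qed

lemma norm_minus_commute:
  assumes "a \<in> carrier A" "b \<in> carrier A"
  shows "cnorm A (a \<ominus> b) = cnorm A (b \<ominus> a)"
  using assms by (simp add: minus_swap[of a b] norm_scale closed)

lemma norm_minus_triangle:
  assumes "a \<in> carrier A" "b \<in> carrier A" "d \<in> carrier A"
  shows "cnorm A (a \<ominus> d) \<le> cnorm A (a \<ominus> b) + cnorm A (b \<ominus> d)"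
  using assms minus_trans[of a b d] norm_triangle closed by metis

lemma norm_le_minus:
  assumes "a \<in> carrier A" "b \<in> carrier A"
  shows "cnorm A a \<le> cnorm A b + cnorm A (a \<ominus> b)"
  using assms minus_add_cancel[of a b] norm_triangle closed by metis

text \<open>The C*-identity and submultiplicativity bound the square of the norm of \<open>a\<close>
  by the product of the norms of \<open>a*\<close> and \<open>a\<close>. Cancelling one factor gives
  an inequality, and the same inequality for \<open>a*\<close> is its converse.\<close>

lemma norm_star:
  assumes "a \<in> carrier A"
  shows "cnorm A (cstar A a) = cnorm A a"
proof -
  have le: "cnorm A a \<le> cnorm A (cstar A a)" if a: "a \<in> carrier A" for a
  proof (cases "cnorm A a = 0")
    case False
    then have "0 < cnorm A a" using norm_nonneg[OF a] by simp
    moreover have "cnorm A a * cnorm A a \<le> cnorm A (cstar A a) * cnorm A a"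
      using norm_star_mult[OF a] norm_mult[OF star_closed[OF a] a] by (simp add: power2_eq_square)
    ultimately show ?thesis by simp
  qed (use norm_nonneg star_closed a in auto)
  show ?thesis using le[OF assms] le[OF star_closed[OF assms]] assms by (simp add: star_star)
qed

text \<open>Testing with \<open>d\<close> equal to the adjoint of \<open>a \<ominus> b\<close>, the
  C*-identity forces the difference to be zero. Such cancellation replaces a unit.\<close>

lemma eq_if_mult_eq:
  assumes "a \<in> carrier A" "b \<in> carrier A" "\<And>d. d \<in> carrier A \<Longrightarrow> d \<otimes> a = d \<otimes> b"
  shows "a = b"
proof -
  let ?x = "a \<ominus> b"
  have x: "?x \<in> carrier A" using assms by (simp add: closed)
  have "cstar A ?x \<otimes> ?x = \<zero>"
    using assms x by (simp only: mult_minus star_closed minus_self mult_closed)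
  then have "(cnorm A ?x)\<^sup>2 = 0" using norm_star_mult[OF x] norm_zero by simp
  then show ?thesis using assms x by (simp add: norm_eq_zero minus_eq_zero_iff)
qed

text \<open>The involution exchanges left and right factors, which reduces this to the preceding
  cancellation.\<close>

lemma eq_if_eq_mult:
  assumes "a \<in> carrier A" "b \<in> carrier A" "\<And>d. d \<in> carrier A \<Longrightarrow> a \<otimes> d = b \<otimes> d"
  shows "a = b"
proof -
  have "cstar A a = cstar A b"
  proof (rule eq_if_mult_eq)
    show "d \<otimes> cstar A a = d \<otimes> cstar A b" if d: "d \<in> carrier A" for d
      using assms d star_mult[of _ "cstar A d"] by (metis star_closed star_star)
  qed (use assms in \<open>auto simp: closed\<close>)
  then show ?thesis using assms star_star by metis
qed

section \<open>The norm metric, closures and sequences\<close>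

lemma Metric_space_cdist: "Metric_space (carrier A) (cdist A)"
proof
  fix a b d
  show "0 \<le> cdist A a b" by (simp add: cdist_def norm_nonneg closed)
  show "cdist A a b = cdist A b a" by (simp add: cdist_def norm_minus_commute)
  show "a \<in> carrier A \<Longrightarrow> b \<in> carrier A \<Longrightarrow> cdist A a b = 0 \<longleftrightarrow> a = b"
    by (simp add: cdist_def norm_eq_zero minus_eq_zero_iff closed)
  show "a \<in> carrier A \<Longrightarrow> b \<in> carrier A \<Longrightarrow> d \<in> carrier A \<Longrightarrow> cdist A a d \<le> cdist A a b + cdist A b d"
    by (simp add: cdist_def norm_minus_triangle)
qed

sublocale metric: Metric_space "carrier A" "cdist A"
  by (rule Metric_space_cdist)

text \<open>\<open>S\<close> is not assumed to lie in the carrier; the closure sees only its points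
  there, hence the conjunct \<open>s \<in> carrier A\<close>.\<close>

lemma in_norm_closure:
  "a \<in> norm_closure A S \<longleftrightarrow>
     a \<in> carrier A \<and> (\<forall>e>0. \<exists>s\<in>S. s \<in> carrier A \<and> cnorm A (a \<ominus> s) < e)"
  by (auto simp: norm_closure_def metric.metric_closure_of cdist_def)

lemma norm_closure_sub: "norm_closure A S \<subseteq> carrier A"
  by (auto simp: in_norm_closure)

lemma sub_norm_closure: "S \<subseteq> carrier A \<Longrightarrow> S \<subseteq> norm_closure A S"
  by (force simp: in_norm_closure minus_self norm_zero)

lemma norm_closure_mono: "S \<subseteq> T \<Longrightarrow> norm_closure A S \<subseteq> norm_closure A T"
  unfolding norm_closure_def by (rule closure_of_mono)

lemma norm_closure_idem: "norm_closure A (norm_closure A S) = norm_closure A S"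
  by (simp add: norm_closure_def)

lemma norm_closure_eqI:
  assumes "S \<subseteq> carrier A"
    and "\<And>a. a \<in> carrier A \<Longrightarrow> (\<And>e. e > 0 \<Longrightarrow> \<exists>s\<in>S. cnorm A (a \<ominus> s) < e) \<Longrightarrow> a \<in> S"
  shows "norm_closure A S = S"
proof
  show "norm_closure A S \<subseteq> S" using assms(2) unfolding in_norm_closure subset_iff by blast
qed (rule sub_norm_closure[OF assms(1)])

lemma eq_if_norm_small:
  assumes "a \<in> carrier A" "b \<in> carrier A" "\<And>e. e > 0 \<Longrightarrow> cnorm A (a \<ominus> b) < e"
  shows "a = b"
proof -
  have "cnorm A (a \<ominus> b) = 0"
    using assms norm_nonneg[of "a \<ominus> b"] by (metis add_closed less_irrefl order_le_less scale_closed)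
  then show ?thesis using assms by (simp add: norm_eq_zero minus_eq_zero_iff closed)
qed

text \<open>Convergence is phrased through the norm with all terms in the carrier, so that the
  cut-off built into \<open>cdist\<close> stays out of the estimates.\<close>

definition converges :: "(nat \<Rightarrow> 'a) \<Rightarrow> 'a \<Rightarrow> bool" where
  "converges s a \<longleftrightarrow> a \<in> carrier A \<and> (\<forall>n. s n \<in> carrier A) \<and> (\<lambda>n. cnorm A (s n \<ominus> a)) \<longlonglongrightarrow> 0"

lemma convergesD:
  assumes "converges s a" "e > 0"
  shows "\<exists>N. \<forall>n\<ge>N. cnorm A (s n \<ominus> a) < e"
  using assms LIMSEQ_D[of "\<lambda>n. cnorm A (s n \<ominus> a)" 0 e] unfolding converges_def
  by (auto simp: norm_nonneg closed)

lemma converges_if_Cauchy: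
  assumes "\<And>n. s n \<in> carrier A"
    and "\<And>e. e > 0 \<Longrightarrow> \<exists>N. \<forall>m\<ge>N. \<forall>n\<ge>N. cnorm A (s m \<ominus> s n) < e"
  shows "\<exists>a. converges s a"
proof -
  have "metric.MCauchy s"
    unfolding metric.MCauchy_def using assms by (force simp: cdist_def)
  then obtain a where "limitin metric.mtopology s a sequentially"
    using complete unfolding metric.mcomplete_def by blast
  then have "a \<in> carrier A" "(\<lambda>n. cdist A (s n) a) \<longlonglongrightarrow> 0"
    unfolding metric.limitin_metric_dist_null by auto
  then show ?thesis using assms(1) by (auto simp: converges_def cdist_def)
qed

lemma converges_unique:
  assumes "converges s a" "converges s b"
  shows "a = b"
proof (rule eq_if_norm_small)
  show ab: "a \<in> carrier A" "b \<in> carrier A" using assms by (auto simp: converges_def)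
  fix e :: real
  assume "e > 0"
  then obtain M N where M: "\<forall>n\<ge>M. cnorm A (s n \<ominus> a) < e / 2" and N: "\<forall>n\<ge>N. cnorm A (s n \<ominus> b) < e / 2"
    using assms convergesD half_gt_zero by meson
  define n where "n = max M N"
  have "s n \<in> carrier A" using assms by (auto simp: converges_def)
  then have "cnorm A (a \<ominus> b) \<le> cnorm A (s n \<ominus> a) + cnorm A (s n \<ominus> b)"
    using norm_minus_triangle[of a "s n" b] norm_minus_commute[of a "s n"] ab by simp
  then show "cnorm A (a \<ominus> b) < e"
    using M N by (smt (verit) field_sum_of_halves max.cobounded1 max.cobounded2 n_def)
qed

text \<open>Approximation by a sequence is what later allows an element of a generated algebra to be
  coded by countably many *-terms.\<close>

lemma norm_closure_sequence:
  assumes "a \<in> norm_closure A S"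
  shows "\<exists>s. (\<forall>n. s n \<in> S) \<and> converges s a"
proof -
  have "\<forall>n. \<exists>s\<in>S. s \<in> carrier A \<and> cnorm A (a \<ominus> s) < inverse (real (Suc n))"
    using assms unfolding in_norm_closure by (metis inverse_positive_iff_positive of_nat_0_less_iff zero_less_Suc)
  then obtain s where s: "\<forall>n. s n \<in> S \<and> s n \<in> carrier A \<and> cnorm A (a \<ominus> s n) < inverse (real (Suc n))"
    by metis
  have a: "a \<in> carrier A" using assms by (simp add: in_norm_closure)
  have "(\<lambda>n. cnorm A (s n \<ominus> a)) \<longlonglongrightarrow> 0"
  proof (rule tendsto_sandwich[OF _ _ tendsto_const LIMSEQ_inverse_real_of_nat])
    show "\<forall>\<^sub>F n in sequentially. 0 \<le> cnorm A (s n \<ominus> a)"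
      using s a by (simp add: norm_nonneg closed)
    show "\<forall>\<^sub>F n in sequentially. cnorm A (s n \<ominus> a) \<le> inverse (real (Suc n))"
      using s a norm_minus_commute by (metis (no_types, lifting) always_eventually less_imp_le)
  qed
  then show ?thesis using s a by (auto simp: converges_def)
qed

lemma converges_in_norm_closure:
  assumes "converges s a" "\<And>n. s n \<in> S"
  shows "a \<in> norm_closure A S"
  unfolding in_norm_closure
proof (intro conjI allI impI)
  show a: "a \<in> carrier A" using assms by (auto simp: converges_def)
  fix e :: real
  assume "e > 0"
  then obtain N where "cnorm A (s N \<ominus> a) < e" using convergesD assms(1) by blast
  then show "\<exists>s\<in>S. s \<in> carrier A \<and> cnorm A (a \<ominus> s) < e"
    using assms a norm_minus_commute unfolding converges_def by metis
qed

text \<open>The common pattern of the closure properties: \<open>b\<close> plays the part of the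
  value at \<open>a\<close> of a map \<open>f\<close> that is Lipschitz at \<open>a\<close>, so
  approximants of \<open>a\<close> are carried to approximants of \<open>b\<close>.\<close>

lemma norm_closureI:
  assumes "a \<in> norm_closure A T" "b \<in> carrier A" "0 \<le> M"
    and "\<And>s. s \<in> T \<Longrightarrow> s \<in> carrier A \<Longrightarrow> f s \<in> S \<and> f s \<in> carrier A"
    and "\<And>s. s \<in> T \<Longrightarrow> s \<in> carrier A \<Longrightarrow> cnorm A (b \<ominus> f s) \<le> M * cnorm A (a \<ominus> s)"
  shows "b \<in> norm_closure A S"
  unfolding in_norm_closure
proof (intro conjI allI impI)
  fix e :: real
  assume "e > 0"
  \<comment> \<open>The denominator is \<open>M + 1\<close> because \<open>M\<close> may be
    zero.\<close>
  then obtain s where s: "s \<in> T" "s \<in> carrier A" "cnorm A (a \<ominus> s) < e / (M + 1)"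
    using assms(1,3) unfolding in_norm_closure
    by (metis add_nonneg_pos divide_pos_pos zero_less_one)
  have "cnorm A (b \<ominus> f s) \<le> M * cnorm A (a \<ominus> s)" using assms(5) s by blast
  also have "\<dots> \<le> M * (e / (M + 1))" using s(3) assms(3) by (intro mult_left_mono) auto
  also have "\<dots> < e" using \<open>e > 0\<close> assms(3) by (simp add: field_simps)
  finally show "\<exists>s\<in>S. s \<in> carrier A \<and> cnorm A (b \<ominus> s) < e" using assms(4) s by blast
qed (rule assms(2))

lemma norm_closure_scale:
  assumes "\<And>c s. s \<in> S \<Longrightarrow> c \<odot> s \<in> S" and "a \<in> norm_closure A S"
  shows "c \<odot> a \<in> norm_closure A S"
proof (rule norm_closureI[OF assms(2), where M = "cmod c" and f = "\<lambda>s. c \<odot> s"])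
  have a: "a \<in> carrier A" using assms(2) in_norm_closure by blast
  then show "c \<odot> a \<in> carrier A" by (rule closed)
  show "cnorm A (c \<odot> a \<ominus> c \<odot> s) \<le> cmod c * cnorm A (a \<ominus> s)" if "s \<in> carrier A" for s
    using a that by (simp add: scale_minus[symmetric] norm_scale closed)
qed (use assms(1) in \<open>auto simp: closed\<close>)

lemma norm_closure_star:
  assumes "\<And>s. s \<in> S \<Longrightarrow> cstar A s \<in> S" and "a \<in> norm_closure A S"
  shows "cstar A a \<in> norm_closure A S"
proof (rule norm_closureI[OF assms(2), where M = 1 and f = "cstar A"])
  have a: "a \<in> carrier A" using assms(2) in_norm_closure by blast
  then show "cstar A a \<in> carrier A" by (rule closed)
  show "cnorm A (cstar A a \<ominus> cstar A s) \<le> 1 * cnorm A (a \<ominus> s)" if "s \<in> carrier A" for s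
    using a that by (simp add: star_minus[symmetric] norm_star closed)
qed (use assms(1) in \<open>auto simp: closed\<close>)

text \<open>The target set \<open>T\<close> is kept separate from \<open>S\<close> so that it can be
  instantiated with a norm closure.\<close>

lemma norm_closure_add_left:
  assumes "\<And>s. s \<in> S \<Longrightarrow> s \<in> carrier A \<Longrightarrow> s \<oplus> b \<in> T" and "a \<in> norm_closure A S" and b: "b \<in> carrier A"
  shows "a \<oplus> b \<in> norm_closure A T"
proof (rule norm_closureI[OF assms(2), where M = 1 and f = "\<lambda>s. s \<oplus> b"])
  have a: "a \<in> carrier A" using assms(2) in_norm_closure by blast
  then show "a \<oplus> b \<in> carrier A" using b by (simp add: closed)
  show "cnorm A ((a \<oplus> b) \<ominus> (s \<oplus> b)) \<le> 1 * cnorm A (a \<ominus> s)" if "s \<in> carrier A" for s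
    using a b that by (simp add: add_minus_add minus_self add_zero_right closed)
qed (use assms(1) b in \<open>auto simp: closed\<close>)

text \<open>The summands are approximated one at a time. With one of them in \<open>S\<close> the
  sum lies in the closure; letting it vary lands in the closure of the closure, which is the
  closure.\<close>

lemma norm_closure_add:
  assumes "\<And>s t. s \<in> S \<Longrightarrow> t \<in> S \<Longrightarrow> s \<oplus> t \<in> S"
    and a: "a \<in> norm_closure A S" and b: "b \<in> norm_closure A S"
  shows "a \<oplus> b \<in> norm_closure A S"
proof -
  have ab: "a \<in> carrier A" "b \<in> carrier A" using a b in_norm_closure by blast+
  have "s \<oplus> b \<in> norm_closure A S" if s: "s \<in> S" "s \<in> carrier A" for s
    using norm_closure_add_left[where S = S and T = S and a = b and b = s] assms(1) s b ab add_comm by metis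
  then have "a \<oplus> b \<in> norm_closure A (norm_closure A S)"
    using norm_closure_add_left[where S = S and a = a and b = b] a ab by blast
  then show ?thesis by (simp add: norm_closure_idem)
qed

lemma norm_closure_mult_left:
  assumes "\<And>s. s \<in> S \<Longrightarrow> s \<in> carrier A \<Longrightarrow> s \<otimes> b \<in> T" and "a \<in> norm_closure A S" and b: "b \<in> carrier A"
  shows "a \<otimes> b \<in> norm_closure A T"
proof (rule norm_closureI[OF assms(2), where M = "cnorm A b" and f = "\<lambda>s. s \<otimes> b"])
  have a: "a \<in> carrier A" using assms(2) in_norm_closure by blast
  then show "a \<otimes> b \<in> carrier A" using b by (simp add: closed)
  show "cnorm A ((a \<otimes> b) \<ominus> (s \<otimes> b)) \<le> cnorm A b * cnorm A (a \<ominus> s)" if "s \<in> carrier A" for s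
    using a b that norm_mult[of "a \<ominus> s" b] by (simp add: minus_mult mult.commute closed)
qed (use assms(1) b in \<open>auto simp: closed norm_nonneg\<close>)

lemma norm_closure_mult_right:
  assumes "\<And>s. s \<in> S \<Longrightarrow> s \<in> carrier A \<Longrightarrow> b \<otimes> s \<in> T" and "a \<in> norm_closure A S" and b: "b \<in> carrier A"
  shows "b \<otimes> a \<in> norm_closure A T"
proof (rule norm_closureI[OF assms(2), where M = "cnorm A b" and f = "\<lambda>s. b \<otimes> s"])
  have a: "a \<in> carrier A" using assms(2) in_norm_closure by blast
  then show "b \<otimes> a \<in> carrier A" using b by (simp add: closed)
  show "cnorm A ((b \<otimes> a) \<ominus> (b \<otimes> s)) \<le> cnorm A b * cnorm A (a \<ominus> s)" if "s \<in> carrier A" for s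
    using a b that norm_mult[of b "a \<ominus> s"] by (simp add: mult_minus closed)
qed (use assms(1) b in \<open>auto simp: closed norm_nonneg\<close>)

lemma norm_closure_mult:
  assumes "\<And>s t. s \<in> S \<Longrightarrow> t \<in> S \<Longrightarrow> s \<otimes> t \<in> S"
    and a: "a \<in> norm_closure A S" and b: "b \<in> norm_closure A S"
  shows "a \<otimes> b \<in> norm_closure A S"
proof -
  have ab: "a \<in> carrier A" "b \<in> carrier A" using a b in_norm_closure by blast+
  have "s \<otimes> b \<in> norm_closure A S" if s: "s \<in> S" "s \<in> carrier A" for s
    using norm_closure_mult_right[where S = S and T = S and a = b and b = s] assms(1) s b by blast
  then have "a \<otimes> b \<in> norm_closure A (norm_closure A S)"
    using norm_closure_mult_left[where S = S and a = a and b = b] a ab by blast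
  then show ?thesis by (simp add: norm_closure_idem)
qed

end

section \<open>Homomorphisms of C*-algebras are contractive\<close>

lemma cstar_homD:
  assumes "cstar_hom A B h"
  shows "\<And>a. a \<in> carrier A \<Longrightarrow> h a \<in> carrier B"
    and "\<And>a b. a \<in> carrier A \<Longrightarrow> b \<in> carrier A \<Longrightarrow> h (a \<oplus>\<^bsub>A\<^esub> b) = h a \<oplus>\<^bsub>B\<^esub> h b"
    and "\<And>c a. a \<in> carrier A \<Longrightarrow> h (c \<odot>\<^bsub>A\<^esub> a) = c \<odot>\<^bsub>B\<^esub> h a"
    and "\<And>a b. a \<in> carrier A \<Longrightarrow> b \<in> carrier A \<Longrightarrow> h (a \<otimes>\<^bsub>A\<^esub> b) = h a \<otimes>\<^bsub>B\<^esub> h b"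
    and "\<And>a. a \<in> carrier A \<Longrightarrow> h (cstar A a) = cstar B (h a)"
    and "h \<in> extensional (carrier A)"
  using assms by (auto simp: cstar_hom_def PiE_iff)

lemma cstar_homI:
  assumes "\<And>a. a \<in> carrier A \<Longrightarrow> h a \<in> carrier B"
    and "\<And>a b. a \<in> carrier A \<Longrightarrow> b \<in> carrier A \<Longrightarrow> h (a \<oplus>\<^bsub>A\<^esub> b) = h a \<oplus>\<^bsub>B\<^esub> h b"
    and "\<And>c a. a \<in> carrier A \<Longrightarrow> h (c \<odot>\<^bsub>A\<^esub> a) = c \<odot>\<^bsub>B\<^esub> h a"
    and "\<And>a b. a \<in> carrier A \<Longrightarrow> b \<in> carrier A \<Longrightarrow> h (a \<otimes>\<^bsub>A\<^esub> b) = h a \<otimes>\<^bsub>B\<^esub> h b"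
    and "\<And>a. a \<in> carrier A \<Longrightarrow> h (cstar A a) = cstar B (h a)"
    and "h \<in> extensional (carrier A)"
  shows "cstar_hom A B h"
  using assms by (auto simp: cstar_hom_def PiE_iff)

section \<open>A square root by iteration, and self-adjoint elements as real parts\<close>

context cstar_algebra
begin

lemma converges_if_geometric:
  assumes s: "\<And>n. s n \<in> carrier A" and step: "\<And>n. cnorm A (s (Suc n) \<ominus> s n) \<le> (1/2) ^ n"
  shows "\<exists>a. converges s a"
proof (rule converges_if_Cauchy[OF s])
  \<comment> \<open>The right-hand side is the exact value of the geometric sum from
    \<open>n\<close> to \<open>n + k - 1\<close>, which is why the induction on \<open>k\<close>
    closes with an equality.\<close>
  have tail: "cnorm A (s (n + k) \<ominus> s n) \<le> 2 * (1/2) ^ n - 2 * (1/2) ^ (n + k)" for n k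
  proof (induction k)
    case (Suc k)
    have "cnorm A (s (n + Suc k) \<ominus> s n)
        \<le> cnorm A (s (Suc (n + k)) \<ominus> s (n + k)) + cnorm A (s (n + k) \<ominus> s n)"
      using norm_minus_triangle[of "s (n + Suc k)" "s (n + k)" "s n"] s by simp
    also have "\<dots> \<le> (1/2) ^ (n + k) + (2 * (1/2) ^ n - 2 * (1/2) ^ (n + k))"
      using step Suc.IH by (intro add_mono)
    also have "\<dots> = 2 * (1/2) ^ n - 2 * (1/2) ^ (n + Suc k)" by simp
    finally show ?case .
  qed (simp add: minus_self norm_zero s)
  have le: "cnorm A (s m \<ominus> s n) \<le> 2 * (1/2) ^ N" if "N \<le> n" "n \<le> m" for N m n
  proof -
    have "cnorm A (s m \<ominus> s n) \<le> 2 * (1/2) ^ n - 2 * (1/2) ^ m"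
      using tail[of n "m - n"] that by simp
    also have "\<dots> \<le> 2 * (1/2) ^ n" by simp
    also have "\<dots> \<le> 2 * (1/2) ^ N" using that by (intro mult_left_mono power_decreasing) auto
    finally show ?thesis .
  qed
  fix e :: real
  assume "e > 0"
  then obtain N where N: "(1/2) ^ N < e / 2" using real_arch_pow_inv[of "e/2" "1/2"] by auto
  have "cnorm A (s m \<ominus> s n) < e" if "m \<ge> N" "n \<ge> N" for m n
  proof -
    have "cnorm A (s m \<ominus> s n) \<le> 2 * (1/2) ^ N"
      using le[of N n m] le[of N m n] that norm_minus_commute[OF s s, of m n] by (cases "n \<le> m") auto
    also have "\<dots> < e" using N by simp
    finally show ?thesis .
  qed
  then show "\<exists>N. \<forall>m\<ge>N. \<forall>n\<ge>N. cnorm A (s m \<ominus> s n) < e" by blast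
qed

text \<open>The common Lipschitz constant makes the sequence \<open>f (s n)\<close> converge both to
  \<open>f a\<close> and to \<open>g a\<close>, and limits are unique.\<close>

lemma eq_at_limit:
  assumes f: "\<And>s. s \<in> carrier A \<Longrightarrow> f s \<in> carrier A" and g: "\<And>s. s \<in> carrier A \<Longrightarrow> g s \<in> carrier A"
    and M: "0 \<le> M"
    and fM: "\<And>s t. s \<in> carrier A \<Longrightarrow> t \<in> carrier A \<Longrightarrow> cnorm A (f s \<ominus> f t) \<le> M * cnorm A (s \<ominus> t)"
    and gM: "\<And>s t. s \<in> carrier A \<Longrightarrow> t \<in> carrier A \<Longrightarrow> cnorm A (g s \<ominus> g t) \<le> M * cnorm A (s \<ominus> t)"
    and s: "converges s a" and eq: "\<And>n. f (s n) = g (s n)"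
  shows "f a = g a"
proof (rule converges_unique[of "\<lambda>n. f (s n)"])
  have sa: "a \<in> carrier A" "s n \<in> carrier A" for n using s by (auto simp: converges_def)
  have lim: "(\<lambda>n. M * cnorm A (s n \<ominus> a)) \<longlonglongrightarrow> 0"
    using s tendsto_mult_right_zero unfolding converges_def by blast
  have "(\<lambda>n. cnorm A (f (s n) \<ominus> f a)) \<longlonglongrightarrow> 0"
    by (rule tendsto_sandwich[OF _ _ tendsto_const lim])
       (auto intro!: always_eventually norm_nonneg closed f fM sa)
  then show "converges (\<lambda>n. f (s n)) (f a)" using f sa by (auto simp: converges_def)
  have "(\<lambda>n. cnorm A (g (s n) \<ominus> g a)) \<longlonglongrightarrow> 0"
    by (rule tendsto_sandwich[OF _ _ tendsto_const lim])
       (auto intro!: always_eventually norm_nonneg closed g gM sa)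
  then show "converges (\<lambda>n. f (s n)) (g a)" using g sa eq by (auto simp: converges_def)
qed

text \<open>\<open>s = 1 - sqrt (1 - b\<^sup>2)\<close>, obtained by iterating \<open>s \<mapsto> (b\<^sup>2 + s\<^sup>2) / 2\<close>, which contracts
  the ball of radius \<open>1/2\<close>.\<close>

lemma sqrt_complement_exists:
  assumes b: "b \<in> carrier A" "cstar A b = b" "cnorm A b \<le> 1/2"
  shows "\<exists>s\<in>carrier A. cstar A s = s \<and> s \<otimes> b = b \<otimes> s \<and> s = (1/2) \<odot> (b \<otimes> b \<oplus> s \<otimes> s)"
proof -
  define T where "T s = (1/2) \<odot> (b \<otimes> b \<oplus> s \<otimes> s)" for s
  define s where "s n = (T ^^ n) \<zero>" for n
  have sSuc: "s (Suc n) = T (s n)" for n by (simp add: s_def)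
  have Tc: "x \<in> carrier A \<Longrightarrow> T x \<in> carrier A" for x by (simp add: T_def closed b)
  have s: "s n \<in> carrier A" for n by (induction n) (auto simp: s_def Tc closed)
  \<comment> \<open>The induction step even gives 1/4. The radius 1/2 is chosen because the
    Lipschitz constant of \<open>T\<close> at two points is half the sum of their norms, hence at
    most 1/2 on this ball.\<close>
  have norm: "cnorm A (s n) \<le> 1/2" for n
  proof (induction n)
    case (Suc n)
    have "cnorm A (s (Suc n)) = 1/2 * cnorm A (b \<otimes> b \<oplus> s n \<otimes> s n)"
      unfolding sSuc T_def by (simp add: norm_scale closed b s)
    also have "\<dots> \<le> 1/2 * (cnorm A (b \<otimes> b) + cnorm A (s n \<otimes> s n))"
      by (intro mult_left_mono norm_triangle closed b s) auto
    also have "\<dots> \<le> 1/2 * (cnorm A b * cnorm A b + cnorm A (s n) * cnorm A (s n))"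
      by (intro mult_left_mono add_mono norm_mult b s) auto
    also have "\<dots> \<le> 1/2 * (1/2 * (1/2) + 1/2 * (1/2))"
      by (intro mult_left_mono add_mono mult_mono b Suc.IH norm_nonneg s) auto
    finally show ?case by simp
  qed (simp add: s_def norm_zero)
  have Tdiff: "T x \<ominus> T y = (1/2) \<odot> (x \<otimes> (x \<ominus> y) \<oplus> (x \<ominus> y) \<otimes> y)"
    if "x \<in> carrier A" "y \<in> carrier A" for x y
  proof -
    have "T x \<ominus> T y = (1/2) \<odot> ((b \<otimes> b \<oplus> x \<otimes> x) \<ominus> (b \<otimes> b \<oplus> y \<otimes> y))"
      unfolding T_def by (rule scale_minus[symmetric]) (simp_all add: closed b that)
    also have "(b \<otimes> b \<oplus> x \<otimes> x) \<ominus> (b \<otimes> b \<oplus> y \<otimes> y) = x \<otimes> x \<ominus> y \<otimes> y"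
      by (simp add: add_minus_add closed b that minus_self add_zero)
    finally show ?thesis using that by (simp only: mult_minus_mult)
  qed
  have Tnorm: "cnorm A (T x \<ominus> T y) \<le> 1/2 * ((cnorm A x + cnorm A y) * cnorm A (x \<ominus> y))"
    if xy: "x \<in> carrier A" "y \<in> carrier A" for x y
  proof -
    have "cnorm A (T x \<ominus> T y) = 1/2 * cnorm A (x \<otimes> (x \<ominus> y) \<oplus> (x \<ominus> y) \<otimes> y)"
      unfolding Tdiff[OF xy] by (simp add: norm_scale closed xy)
    also have "\<dots> \<le> 1/2 * (cnorm A x * cnorm A (x \<ominus> y) + cnorm A (x \<ominus> y) * cnorm A y)"
      by (intro mult_left_mono order_trans[OF norm_triangle] add_mono norm_mult closed xy) auto
    finally show ?thesis by (simp add: algebra_simps)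
  qed
  have "cnorm A (s (Suc n) \<ominus> s n) \<le> (1/2) ^ n" for n
  proof (induction n)
    case 0
    have "s 0 = \<zero>" by (simp add: s_def)
    then show ?case using norm[of 1] s[of 1] by (simp add: scale_zero add_zero_right)
  next
    case (Suc n)
    have "cnorm A (s (Suc (Suc n)) \<ominus> s (Suc n))
        \<le> 1/2 * ((cnorm A (s (Suc n)) + cnorm A (s n)) * cnorm A (s (Suc n) \<ominus> s n))"
      using Tnorm[OF s s, of "Suc n" n] by (simp only: sSuc)
    also have "\<dots> \<le> 1/2 * ((1/2 + 1/2) * (1/2) ^ n)"
      by (intro mult_left_mono mult_mono add_mono norm Suc.IH norm_nonneg add_nonneg_nonneg closed s) auto
    finally show ?case by simp
  qed
  then obtain a where lim: "converges s a" using converges_if_geometric[of s] s by blast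
  have a: "a \<in> carrier A" using lim by (simp add: converges_def)
  \<comment> \<open>Self-adjointness and commutation with \<open>b\<close> hold at the zero starting
    point and are preserved by \<open>T\<close>; both are closed conditions and so pass to the
    limit.\<close>
  have star: "cstar A (s n) = s n" for n
  proof (induction n)
    case (Suc n)
    show ?case unfolding sSuc T_def by (simp add: star_scale star_add star_mult closed b s Suc.IH)
  qed (simp add: s_def star_zero)
  have comm: "s n \<otimes> b = b \<otimes> s n" for n
  proof (induction n)
    case (Suc n)
    have "(s n \<otimes> s n) \<otimes> b = b \<otimes> (s n \<otimes> s n)"
      by (metis Suc.IH b(1) mult_assoc s)
    then show ?case unfolding sSuc T_def
      by (simp add: scale_mult_left scale_mult_right distrib_left distrib_right mult_assoc closed b s)
  qed (simp add: s_def zero_mult mult_zero b)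
  have "cstar A a = a"
    by (rule eq_at_limit[where f = "cstar A" and g = "\<lambda>x. x" and M = 1, OF _ _ _ _ _ lim star])
       (simp_all add: closed star_minus[symmetric] norm_star)
  moreover have "a \<otimes> b = b \<otimes> a"
  proof (rule eq_at_limit[where f = "\<lambda>x. x \<otimes> b" and g = "\<lambda>x. b \<otimes> x" and M = "cnorm A b",
        OF _ _ _ _ _ lim comm])
    fix x y assume xy: "x \<in> carrier A" "y \<in> carrier A"
    show "cnorm A (x \<otimes> b \<ominus> y \<otimes> b) \<le> cnorm A b * cnorm A (x \<ominus> y)"
      using norm_mult[of "x \<ominus> y" b] xy b by (simp add: minus_mult closed mult.commute)
    show "cnorm A (b \<otimes> x \<ominus> b \<otimes> y) \<le> cnorm A b * cnorm A (x \<ominus> y)"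
      using norm_mult[of b "x \<ominus> y"] xy b by (simp add: mult_minus closed)
  qed (auto simp: closed b norm_nonneg)
  \<comment> \<open>\<open>T\<close> is quadratic and has no global Lipschitz constant, so
    \<open>eq_at_limit\<close> does not apply. The estimate uses the uniform bound 1/2 for the
    iterates in one argument and the fixed norm of \<open>a\<close> in the other.\<close>
  moreover have "T a = a"
  proof (rule converges_unique)
    have "(\<lambda>n. cnorm A (s (Suc n) \<ominus> T a)) \<longlonglongrightarrow> 0"
    proof (rule tendsto_sandwich[OF _ _ tendsto_const])
      have "(\<lambda>n. 1/2 * ((1/2 + cnorm A a) * cnorm A (s n \<ominus> a))) \<longlonglongrightarrow> 1/2 * ((1/2 + cnorm A a) * 0)"
        using lim unfolding converges_def by (intro tendsto_intros) auto
      then show "(\<lambda>n. 1/2 * ((1/2 + cnorm A a) * cnorm A (s n \<ominus> a))) \<longlonglongrightarrow> 0" by simp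
      have "cnorm A (s (Suc n) \<ominus> T a) \<le> 1/2 * ((1/2 + cnorm A a) * cnorm A (s n \<ominus> a))" for n
        unfolding sSuc using Tnorm[OF s a, of n]
        by (rule order_trans) (intro mult_left_mono mult_right_mono add_mono norm norm_nonneg closed s a, auto)
      then show "\<forall>\<^sub>F n in sequentially. cnorm A (s (Suc n) \<ominus> T a)
          \<le> 1/2 * ((1/2 + cnorm A a) * cnorm A (s n \<ominus> a))" by simp
    qed (auto intro!: always_eventually norm_nonneg closed s Tc a)
    then show "converges (\<lambda>n. s (Suc n)) (T a)" by (simp add: converges_def Tc s a)
    show "converges (\<lambda>n. s (Suc n)) a"
      using lim LIMSEQ_Suc unfolding converges_def by blast
  qed
  ultimately show ?thesis using a unfolding T_def by metis
qed

text \<open>With \<open>s = 1 - sqrt (1 - b\<^sup>2)\<close> and \<open>w = b - i s\<close> the element \<open>w + i\<close> of the unitization is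
  unitary; the equation below says this without mentioning the unit.\<close>

lemma self_adjoint_real_part:
  assumes b: "b \<in> carrier A" "cstar A b = b" "cnorm A b \<le> 1/2"
  shows "\<exists>w\<in>carrier A. cstar A w \<otimes> w = \<i> \<odot> w \<oplus> (- \<i>) \<odot> cstar A w \<and> b = (1/2) \<odot> (w \<oplus> cstar A w)"
proof -
  obtain s where s: "s \<in> carrier A" "cstar A s = s" "s \<otimes> b = b \<otimes> s"
    and s_eq: "s = (1/2) \<odot> (b \<otimes> b \<oplus> s \<otimes> s)"
    using sqrt_complement_exists[OF b] by blast
  define w where "w = b \<oplus> (- \<i>) \<odot> s"
  have w: "w \<in> carrier A" by (simp add: w_def closed b s)
  have ws: "cstar A w = b \<oplus> \<i> \<odot> s"
    by (simp add: w_def star_add star_scale closed b s)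
  have half: "(1/2) \<odot> a \<oplus> (1/2) \<odot> a = a" if "a \<in> carrier A" for a
    using scale_add_left[of a "1/2" "1/2"] that by (simp add: scale_one)
  have "s \<oplus> s = (1/2) \<odot> (b \<otimes> b \<oplus> s \<otimes> s) \<oplus> (1/2) \<odot> (b \<otimes> b \<oplus> s \<otimes> s)"
    by (simp only: s_eq[symmetric])
  also have "\<dots> = b \<otimes> b \<oplus> s \<otimes> s" by (rule half) (simp add: closed b s)
  finally have ss: "s \<oplus> s = b \<otimes> b \<oplus> s \<otimes> s" .
  \<comment> \<open>Used from right to left as well, to insert a pair of opposite imaginary
    terms.\<close>
  have cancel: "c \<odot> a \<oplus> ((- c) \<odot> a \<oplus> d) = d" if "a \<in> carrier A" "d \<in> carrier A" for a c d
    using that by (simp add: add_assoc[symmetric] scale_add_left[symmetric] zero_scale add_zero closed)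
  \<comment> \<open>Since \<open>s\<close> commutes with \<open>b\<close>, the product
    \<open>(b + \<i> s)(b - \<i> s)\<close> is \<open>b^2 + s^2\<close>. The fixed-point equation
    makes this \<open>2 s\<close>, which is also the value of the right-hand side of the
    claim.\<close>
  have "cstar A w \<otimes> w = b \<otimes> b \<oplus> (\<i> \<odot> (b \<otimes> s) \<oplus> ((- \<i>) \<odot> (b \<otimes> s) \<oplus> s \<otimes> s))"
    unfolding ws unfolding w_def
    by (simp add: distrib_left distrib_right scale_mult_left scale_mult_right scale_add_right
        scale_scale[symmetric] scale_one closed b s add_ac)
  also have "\<dots> = b \<otimes> b \<oplus> s \<otimes> s" by (simp add: cancel closed b s)
  also have "\<dots> = s \<oplus> s" by (rule ss[symmetric])
  also have "\<dots> = \<i> \<odot> b \<oplus> ((- \<i>) \<odot> b \<oplus> (s \<oplus> s))"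
    by (simp add: cancel closed b s)
  also have "\<dots> = \<i> \<odot> w \<oplus> (- \<i>) \<odot> cstar A w"
    unfolding ws unfolding w_def
    by (simp add: scale_add_right scale_scale[symmetric] scale_one closed b s add_ac)
  finally have 1: "cstar A w \<otimes> w = \<i> \<odot> w \<oplus> (- \<i>) \<odot> cstar A w" .
  have "w \<oplus> cstar A w = \<i> \<odot> s \<oplus> ((- \<i>) \<odot> s \<oplus> (b \<oplus> b))"
    unfolding ws unfolding w_def by (simp add: closed b s add_ac)
  also have "\<dots> = b \<oplus> b" by (simp add: cancel closed b s)
  finally have "b = (1/2) \<odot> (w \<oplus> cstar A w)"
    using half[OF b(1)] by (simp add: scale_add_right b)
  with 1 w show ?thesis by blast
qed

text \<open>This is \<open>b\<close> raised to the power \<open>2 ^ n\<close>. Repeated squaring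
  starts from \<open>b\<close> itself and thus avoids a zeroth power, and squares are what the
  C*-identity controls.\<close>

fun sq_power :: "'a \<Rightarrow> nat \<Rightarrow> 'a" where
  "sq_power b 0 = b"
| "sq_power b (Suc n) = sq_power b n \<otimes> sq_power b n"

lemma sq_power_closed: "b \<in> carrier A \<Longrightarrow> sq_power b n \<in> carrier A"
  by (induction n) (auto simp: closed)

lemma star_sq_power: "b \<in> carrier A \<Longrightarrow> cstar A b = b \<Longrightarrow> cstar A (sq_power b n) = sq_power b n"
  by (induction n) (auto simp: star_mult sq_power_closed)

text \<open>For self-adjoint elements the C*-identity reads as multiplicativity of the norm on
  squares, and squaring preserves self-adjointness.\<close>

lemma norm_sq_power:
  assumes "b \<in> carrier A" "cstar A b = b"
  shows "cnorm A (sq_power b n) = cnorm A b ^ (2 ^ n)"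
proof (induction n)
  case (Suc n)
  have "cnorm A (sq_power b (Suc n)) = (cnorm A (sq_power b n))\<^sup>2"
    using norm_star_mult[OF sq_power_closed[OF assms(1)], of n] by (simp add: star_sq_power assms)
  then show ?case by (simp add: Suc.IH power_mult[symmetric] mult.commute)
qed simp

end

text \<open>If \<open>y < x\<close> with \<open>y\<close> positive, the powers of
  \<open>x / y\<close> exceed \<open>C\<close>. The case \<open>y = 0\<close> is excluded already by
  the exponent 1.\<close>

lemma power_le_imp_le_base_bounded:
  fixes x y C :: real
  assumes le: "\<And>n::nat. x ^ (2 ^ n) \<le> C * y ^ (2 ^ n)" and "0 \<le> x" "0 \<le> y"
  shows "x \<le> y"
proof (rule ccontr)
  assume "\<not> x \<le> y"
  then have xy: "y < x" by simp
  show False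
  proof (cases "y = 0")
    case True
    then show False using le[of 0] xy by simp
  next
    case False
    then have y: "0 < y" using assms by simp
    then have "1 < x / y" using xy by simp
    then obtain n where n: "C < (x / y) ^ n" using real_arch_pow by blast
    also have "\<dots> \<le> (x / y) ^ (2 ^ n)"
      using \<open>1 < x / y\<close> by (intro power_increasing) (auto intro: less_imp_le[OF less_exp])
    also have "\<dots> \<le> C" using le[of n] y by (simp add: power_divide divide_le_eq)
    finally show False by simp
  qed
qed

text \<open>The image \<open>v\<close> of \<open>w\<close> still satisfies the unitarity equation,
  so the square of its norm is at most twice its norm and the norm is at most 2. Hence the real part
  \<open>h d\<close> has norm at most 2 whenever \<open>d\<close> has norm at most 1/2, and
  rescaling \<open>b\<close> to norm 1/2 produces the constant 4.\<close>

lemma cstar_hom_bounded_self_adjoint: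
  assumes A: "cstar_algebra A" and B: "cstar_algebra B" and h: "cstar_hom A B h"
    and b: "b \<in> carrier A" "cstar A b = b"
  shows "cnorm B (h b) \<le> 4 * cnorm A b"
proof -
  interpret A: cstar_algebra A by fact
  interpret B: cstar_algebra B by fact
  note h = cstar_homD[OF h]
  have small: "cnorm B (h d) \<le> 2" if d: "d \<in> carrier A" "cstar A d = d" "cnorm A d \<le> 1/2" for d
  proof -
    obtain w where w: "w \<in> carrier A" "cstar A w \<otimes>\<^bsub>A\<^esub> w = \<i> \<odot>\<^bsub>A\<^esub> w \<oplus>\<^bsub>A\<^esub> (- \<i>) \<odot>\<^bsub>A\<^esub> cstar A w"
      "d = (1/2) \<odot>\<^bsub>A\<^esub> (w \<oplus>\<^bsub>A\<^esub> cstar A w)"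
      using A.self_adjoint_real_part[OF d] by blast
    define v where "v = h w"
    have v: "v \<in> carrier B" using w h by (simp add: v_def)
    have "h (cstar A w \<otimes>\<^bsub>A\<^esub> w) = h (\<i> \<odot>\<^bsub>A\<^esub> w \<oplus>\<^bsub>A\<^esub> (- \<i>) \<odot>\<^bsub>A\<^esub> cstar A w)"
      by (simp only: w(2))
    then have "cstar B v \<otimes>\<^bsub>B\<^esub> v = \<i> \<odot>\<^bsub>B\<^esub> v \<oplus>\<^bsub>B\<^esub> (- \<i>) \<odot>\<^bsub>B\<^esub> cstar B v"
      unfolding v_def using w(1) by (simp only: h A.closed)
    then have "(cnorm B v)\<^sup>2 = cnorm B (\<i> \<odot>\<^bsub>B\<^esub> v \<oplus>\<^bsub>B\<^esub> (- \<i>) \<odot>\<^bsub>B\<^esub> cstar B v)"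
      using B.norm_star_mult[OF v] by simp
    also have "\<dots> \<le> cnorm B (\<i> \<odot>\<^bsub>B\<^esub> v) + cnorm B ((- \<i>) \<odot>\<^bsub>B\<^esub> cstar B v)"
      by (intro B.norm_triangle B.closed v)
    also have "\<dots> = 2 * cnorm B v" using v by (simp add: B.norm_scale B.norm_star B.closed)
    finally have "cnorm B v * cnorm B v \<le> 2 * cnorm B v" by (simp add: power2_eq_square)
    then have v2: "cnorm B v \<le> 2"
      using B.norm_nonneg[OF v] by (cases "cnorm B v = 0") auto
    have "h d = (1/2) \<odot>\<^bsub>B\<^esub> (v \<oplus>\<^bsub>B\<^esub> cstar B v)"
      unfolding w(3) v_def using w(1) by (simp add: h A.closed)
    then have "cnorm B (h d) = 1/2 * cnorm B (v \<oplus>\<^bsub>B\<^esub> cstar B v)"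
      using v by (simp add: B.norm_scale B.closed)
    also have "\<dots> \<le> 1/2 * (cnorm B v + cnorm B (cstar B v))"
      by (intro mult_left_mono B.norm_triangle B.closed v) auto
    finally show ?thesis using v2 v by (simp add: B.norm_star)
  qed
  show ?thesis
  proof (cases "cnorm A b = 0")
    case True
    then have "b = \<zero>\<^bsub>A\<^esub>" using A.norm_eq_zero b by blast
    then have "b = 0 \<odot>\<^bsub>A\<^esub> b" using A.zero_scale b by simp
    then have "h b = 0 \<odot>\<^bsub>B\<^esub> h b" using h(3)[OF b(1), of 0] by simp
    then have "h b = \<zero>\<^bsub>B\<^esub>" using B.zero_scale h(1) b by simp
    then show ?thesis by (simp add: B.norm_zero True)
  next
    case False
    define r where "r = 1 / (2 * cnorm A b)"
    have r: "r > 0" using False A.norm_nonneg[OF b(1)] by (simp add: r_def)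
    have "cnorm B (h (complex_of_real r \<odot>\<^bsub>A\<^esub> b)) \<le> 2"
    proof (rule small)
      show "cnorm A (complex_of_real r \<odot>\<^bsub>A\<^esub> b) \<le> 1/2"
        using b False r by (simp add: A.norm_scale del: of_real_divide) (simp add: r_def)
    qed (use b in \<open>auto simp: A.closed A.star_scale\<close>)
    then have "r * cnorm B (h b) \<le> 2" using b r h by (simp add: B.norm_scale)
    then show ?thesis using r False A.norm_nonneg[OF b(1)] by (simp add: r_def field_simps)
  qed
qed

text \<open>A bound with any constant improves to the constant \<open>1\<close> because
  \<open>\<parallel>b\<^sup>n\<parallel> = \<parallel>b\<parallel>\<^sup>n\<close> for self-adjoint \<open>b\<close> and \<open>n\<close> a power of \<open>2\<close>.\<close>

theorem cstar_hom_contractive: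
  assumes A: "cstar_algebra A" and B: "cstar_algebra B" and h: "cstar_hom A B h"
    and a: "a \<in> carrier A"
  shows "cnorm B (h a) \<le> cnorm A a"
proof -
  interpret A: cstar_algebra A by fact
  interpret B: cstar_algebra B by fact
  note hs = cstar_homD[OF h]
  have pow: "h (A.sq_power b n) = B.sq_power (h b) n" if "b \<in> carrier A" for b n
    by (induction n) (auto simp: hs A.sq_power_closed that)
  have self: "cnorm B (h b) \<le> cnorm A b" if b: "b \<in> carrier A" "cstar A b = b" for b
  proof (rule power_le_imp_le_base_bounded[where C = 4])
    have hb: "h b \<in> carrier B" "cstar B (h b) = h b" using b hs(1) hs(5)[of b] by simp_all
    show "cnorm B (h b) ^ (2 ^ n) \<le> 4 * cnorm A b ^ (2 ^ n)" for n
      using cstar_hom_bounded_self_adjoint[OF A B h, of "A.sq_power b n"] b hb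
      by (simp add: A.sq_power_closed A.star_sq_power A.norm_sq_power pow B.norm_sq_power)
    show "0 \<le> cnorm B (h b)" "0 \<le> cnorm A b" using b hs by (auto intro: A.norm_nonneg B.norm_nonneg)
  qed
  \<comment> \<open>The C*-identity on both sides reduces an arbitrary element to the self-adjoint
    one \<open>cstar A a \<otimes> a\<close>.\<close>
  have "(cnorm B (h a))\<^sup>2 = cnorm B (h (cstar A a \<otimes>\<^bsub>A\<^esub> a))"
    using a by (simp add: hs A.closed B.norm_star_mult)
  also have "\<dots> \<le> cnorm A (cstar A a \<otimes>\<^bsub>A\<^esub> a)"
    using a by (intro self) (auto simp: A.closed A.star_mult A.star_star)
  also have "\<dots> = (cnorm A a)\<^sup>2" by (rule A.norm_star_mult[OF a])
  finally show ?thesis using A.norm_nonneg[OF a] by (rule power2_le_imp_le)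
qed

section \<open>Products, generated subalgebras and transport of structure\<close>

lemma cstar_hom_compose:
  assumes "cstar_hom A B g" "cstar_hom B C h" and A: "cstar_algebra A"
  shows "cstar_hom A C (compose (carrier A) h g)"
  by (intro cstar_homI)
    (simp_all add: compose_def cstar_homD[OF assms(1)] cstar_homD[OF assms(2)] cstar_algebra.closed[OF A])

lemma compose_id_map:
  assumes "h \<in> carrier A \<rightarrow>\<^sub>E carrier B"
  shows "compose (carrier A) h (id_map A) = h" and "compose (carrier A) (id_map B) h = h"
  using assms by (auto simp: compose_def id_map_def PiE_iff intro!: extensionalityI[of _ "carrier A"])

lemma (in cstar_algebra) cstar_hom_id: "cstar_hom A A (id_map A)"
  by (auto simp: cstar_hom_def id_map_def closed)

lemma (in cstar_algebra) cstar_hom_minus: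
  assumes "cstar_hom A B h" "a \<in> carrier A" "b \<in> carrier A"
  shows "h (a \<ominus> b) = h a \<ominus>\<^bsub>B\<^esub> h b"
  using assms by (simp add: cstar_homD[OF assms(1)] closed)

lemma cstar_hom_zero:
  assumes "cstar_algebra A" "cstar_algebra B" "cstar_hom A B h"
  shows "h \<zero>\<^bsub>A\<^esub> = \<zero>\<^bsub>B\<^esub>"
proof -
  interpret A: cstar_algebra A by fact
  interpret B: cstar_algebra B by fact
  have "h \<zero>\<^bsub>A\<^esub> = h (0 \<odot>\<^bsub>A\<^esub> \<zero>\<^bsub>A\<^esub>)" by (simp add: A.scale_zero)
  also have "\<dots> = 0 \<odot>\<^bsub>B\<^esub> h \<zero>\<^bsub>A\<^esub>" by (simp only: cstar_homD[OF assms(3)] A.closed)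
  also have "\<dots> = \<zero>\<^bsub>B\<^esub>" by (simp add: B.zero_scale cstar_homD(1)[OF assms(3)] A.closed)
  finally show ?thesis .
qed

text \<open>The metric properties are premises because completeness is itself an axiom of
  \<open>cstar_algebra\<close>: the metric has to be available before the record is known to be a
  C*-algebra.\<close>

lemma mcomplete_cdistI:
  assumes nonneg: "\<And>a b. a \<in> carrier A \<Longrightarrow> b \<in> carrier A \<Longrightarrow> 0 \<le> cnorm A (a \<ominus>\<^bsub>A\<^esub> b)"
    and comm: "\<And>a b. a \<in> carrier A \<Longrightarrow> b \<in> carrier A \<Longrightarrow> cnorm A (a \<ominus>\<^bsub>A\<^esub> b) = cnorm A (b \<ominus>\<^bsub>A\<^esub> a)"
    and zero: "\<And>a b. a \<in> carrier A \<Longrightarrow> b \<in> carrier A \<Longrightarrow> cnorm A (a \<ominus>\<^bsub>A\<^esub> b) = 0 \<longleftrightarrow> a = b"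
    and tri: "\<And>a b d. a \<in> carrier A \<Longrightarrow> b \<in> carrier A \<Longrightarrow> d \<in> carrier A \<Longrightarrow>
        cnorm A (a \<ominus>\<^bsub>A\<^esub> d) \<le> cnorm A (a \<ominus>\<^bsub>A\<^esub> b) + cnorm A (b \<ominus>\<^bsub>A\<^esub> d)"
    and lim: "\<And>s. (\<And>n. s n \<in> carrier A) \<Longrightarrow>
        (\<And>e. e > 0 \<Longrightarrow> \<exists>N. \<forall>m\<ge>N. \<forall>n\<ge>N. cnorm A (s m \<ominus>\<^bsub>A\<^esub> s n) < e) \<Longrightarrow>
        \<exists>a\<in>carrier A. (\<lambda>n. cnorm A (s n \<ominus>\<^bsub>A\<^esub> a)) \<longlonglongrightarrow> 0"
  shows "Metric_space.mcomplete (carrier A) (cdist A)"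
proof -
  interpret Metric_space "carrier A" "cdist A"
    using assms(1-4) by unfold_locales (auto simp: cdist_def)
  show ?thesis
    unfolding mcomplete_def
  proof (intro allI impI)
    fix s assume "MCauchy s"
    then have s: "\<And>n. s n \<in> carrier A"
      and C: "\<And>e. e > 0 \<Longrightarrow> \<exists>N. \<forall>m n. N \<le> m \<longrightarrow> N \<le> n \<longrightarrow> cdist A (s m) (s n) < e"
      by (auto simp: MCauchy_def)
    have "\<exists>N. \<forall>m\<ge>N. \<forall>n\<ge>N. cnorm A (s m \<ominus>\<^bsub>A\<^esub> s n) < e" if "e > 0" for e
      using C[OF that] s by (fastforce simp: cdist_def)
    then obtain a where "a \<in> carrier A" "(\<lambda>n. cnorm A (s n \<ominus>\<^bsub>A\<^esub> a)) \<longlonglongrightarrow> 0"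
      using lim s by blast
    then have "limitin mtopology s a sequentially"
      unfolding limitin_metric_dist_null using s by (simp add: cdist_def)
    then show "\<exists>x. limitin mtopology s x sequentially" by blast
  qed
qed

section \<open>Bounded products\<close>

locale cstar_family =
  fixes S :: "'x set" and F :: "'x \<Rightarrow> 'b calg"
  assumes fam: "x \<in> S \<Longrightarrow> cstar_algebra (F x)"
begin

abbreviation "P \<equiv> product_calg S F"

lemma product_memI:
  assumes "v \<in> extensional S" "\<And>x. x \<in> S \<Longrightarrow> v x \<in> carrier (F x)"
    and "\<And>x. x \<in> S \<Longrightarrow> cnorm (F x) (v x) \<le> M"
  shows "v \<in> carrier P"
  using assms by (auto simp: product_calg_def PiE_iff bdd_above_def)

lemma product_memD:
  assumes "v \<in> carrier P"
  shows "v \<in> extensional S" "\<And>x. x \<in> S \<Longrightarrow> v x \<in> carrier (F x)"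
  using assms by (auto simp: product_calg_def PiE_iff)

lemma product_apply:
  assumes "x \<in> S"
  shows "czero P x = \<zero>\<^bsub>F x\<^esub>" "cadd P v w x = v x \<oplus>\<^bsub>F x\<^esub> w x" "cscale P c v x = c \<odot>\<^bsub>F x\<^esub> v x"
    "cmult P v w x = v x \<otimes>\<^bsub>F x\<^esub> w x" "cstar P v x = cstar (F x) (v x)"
  using assms by (auto simp: product_calg_def)

lemma product_ext:
  "czero P \<in> extensional S" "cadd P v w \<in> extensional S" "cscale P c v \<in> extensional S"
  "cmult P v w \<in> extensional S" "cstar P v \<in> extensional S"
  by (auto simp: product_calg_def)

lemma norm_le_product:
  assumes "v \<in> carrier P" "x \<in> S"
  shows "cnorm (F x) (v x) \<le> cnorm P v"
proof -
  have "bdd_above (insert 0 ((\<lambda>x. cnorm (F x) (v x)) ` S))"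
    using assms by (auto simp: product_calg_def)
  then have "cnorm (F x) (v x) \<le> Sup (insert 0 ((\<lambda>x. cnorm (F x) (v x)) ` S))"
    using assms by (intro cSup_upper) auto
  then show ?thesis by (simp add: product_calg_def)
qed

lemma product_norm_nonneg:
  assumes "v \<in> carrier P"
  shows "0 \<le> cnorm P v"
proof -
  have "bdd_above (insert 0 ((\<lambda>x. cnorm (F x) (v x)) ` S))"
    using assms by (auto simp: product_calg_def)
  then have "0 \<le> Sup (insert 0 ((\<lambda>x. cnorm (F x) (v x)) ` S))"
    by (intro cSup_upper) auto
  then show ?thesis by (simp add: product_calg_def)
qed

lemma product_norm_le:
  assumes "0 \<le> M" "\<And>x. x \<in> S \<Longrightarrow> cnorm (F x) (v x) \<le> M"
  shows "cnorm P v \<le> M"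
proof -
  have "Sup (insert 0 ((\<lambda>x. cnorm (F x) (v x)) ` S)) \<le> M"
    using assms by (intro cSup_least) auto
  then show ?thesis by (simp add: product_calg_def)
qed

lemma product_eqI:
  assumes "v \<in> extensional S" "w \<in> extensional S" "\<And>x. x \<in> S \<Longrightarrow> v x = w x"
  shows "v = w"
  using assms by (rule extensionalityI)

lemma product_closed:
  shows "czero P \<in> carrier P"
    and "v \<in> carrier P \<Longrightarrow> w \<in> carrier P \<Longrightarrow> cadd P v w \<in> carrier P"
    and "v \<in> carrier P \<Longrightarrow> cscale P c v \<in> carrier P"
    and "v \<in> carrier P \<Longrightarrow> w \<in> carrier P \<Longrightarrow> cmult P v w \<in> carrier P"
    and "v \<in> carrier P \<Longrightarrow> cstar P v \<in> carrier P"
proof -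
  show "czero P \<in> carrier P"
    by (rule product_memI[where M = 0])
       (auto simp: product_apply product_ext cstar_algebra.norm_zero[OF fam] cstar_algebra.closed[OF fam])
  show "cadd P v w \<in> carrier P" if "v \<in> carrier P" "w \<in> carrier P"
  proof (rule product_memI[where M = "cnorm P v + cnorm P w"])
    show "cnorm (F x) (cadd P v w x) \<le> cnorm P v + cnorm P w" if "x \<in> S" for x
      using \<open>v \<in> carrier P\<close> \<open>w \<in> carrier P\<close> that
        cstar_algebra.norm_triangle[OF fam, of x "v x" "w x"] norm_le_product[of v x] norm_le_product[of w x]
      by (simp add: product_apply product_memD)
  qed (use that in \<open>auto simp: product_apply product_ext product_memD cstar_algebra.closed[OF fam]\<close>)
  show "cscale P c v \<in> carrier P" if "v \<in> carrier P"
  proof (rule product_memI[where M = "cmod c * cnorm P v"])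
    show "cnorm (F x) (cscale P c v x) \<le> cmod c * cnorm P v" if "x \<in> S" for x
      using \<open>v \<in> carrier P\<close> that norm_le_product[of v x]
      by (simp add: product_apply product_memD cstar_algebra.norm_scale[OF fam] mult_left_mono)
  qed (use that in \<open>auto simp: product_apply product_ext product_memD cstar_algebra.closed[OF fam]\<close>)
  show "cmult P v w \<in> carrier P" if "v \<in> carrier P" "w \<in> carrier P"
  proof (rule product_memI[where M = "cnorm P v * cnorm P w"])
    show "cnorm (F x) (cmult P v w x) \<le> cnorm P v * cnorm P w" if "x \<in> S" for x
      unfolding product_apply(4)[OF that]
      using \<open>v \<in> carrier P\<close> \<open>w \<in> carrier P\<close> that
      by (intro order_trans[OF cstar_algebra.norm_mult[OF fam]] mult_mono norm_le_product product_norm_nonneg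
          cstar_algebra.norm_nonneg[OF fam] product_memD)
  qed (use that in \<open>auto simp: product_apply product_ext product_memD cstar_algebra.closed[OF fam]\<close>)
  show "cstar P v \<in> carrier P" if "v \<in> carrier P"
  proof (rule product_memI[where M = "cnorm P v"])
    show "cnorm (F x) (cstar P v x) \<le> cnorm P v" if "x \<in> S" for x
      using \<open>v \<in> carrier P\<close> that norm_le_product[of v x]
      by (simp add: product_apply product_memD cstar_algebra.norm_star[OF fam])
  qed (use that in \<open>auto simp: product_apply product_ext product_memD cstar_algebra.closed[OF fam]\<close>)
qed

lemma product_norm_eq_zero:
  assumes "v \<in> carrier P"
  shows "cnorm P v = 0 \<longleftrightarrow> v = czero P"
proof
  assume z: "cnorm P v = 0"
  show "v = czero P"
  proof (rule product_eqI)
    show "v x = czero P x" if "x \<in> S" for x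
      using norm_le_product[OF assms that] z cstar_algebra.norm_nonneg[OF fam, of x "v x"]
        cstar_algebra.norm_eq_zero[OF fam, of x "v x"] that assms
      by (simp add: product_apply product_memD)
  qed (auto simp: product_ext product_memD(1)[OF assms])
next
  assume "v = czero P"
  then show "cnorm P v = 0"
    using product_norm_le[of 0 v] product_norm_nonneg[OF assms]
    by (simp add: product_apply cstar_algebra.norm_zero[OF fam])
qed

lemma product_norm_triangle:
  assumes "v \<in> carrier P" "w \<in> carrier P"
  shows "cnorm P (cadd P v w) \<le> cnorm P v + cnorm P w"
proof (rule product_norm_le)
  show "cnorm (F x) (cadd P v w x) \<le> cnorm P v + cnorm P w" if "x \<in> S" for x
    using assms that cstar_algebra.norm_triangle[OF fam, of x "v x" "w x"]
      norm_le_product[of v x] norm_le_product[of w x]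
    by (simp add: product_apply product_memD)
qed (use assms product_norm_nonneg in force)

lemma product_norm_scale:
  assumes v: "v \<in> carrier P"
  shows "cnorm P (cscale P c v) = cmod c * cnorm P v"
proof (rule antisym)
  show "cnorm P (cscale P c v) \<le> cmod c * cnorm P v"
    using v by (intro product_norm_le)
      (auto simp: product_apply product_memD cstar_algebra.norm_scale[OF fam] norm_le_product
        product_norm_nonneg intro!: mult_left_mono)
  have cv: "cscale P c v \<in> carrier P" using v by (rule product_closed)
  show "cmod c * cnorm P v \<le> cnorm P (cscale P c v)"
  proof (cases "c = 0")
    case False
    have "cnorm P v \<le> cnorm P (cscale P c v) / cmod c"
    proof (rule product_norm_le)
      show "cnorm (F x) (v x) \<le> cnorm P (cscale P c v) / cmod c" if "x \<in> S" for x
        using norm_le_product[OF cv that] False v that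
        by (simp add: product_apply product_memD cstar_algebra.norm_scale[OF fam] field_simps)
    qed (use cv product_norm_nonneg in auto)
    then show ?thesis using False by (simp add: field_simps)
  qed (use cv product_norm_nonneg in auto)
qed

lemma product_norm_star_mult:
  assumes v: "v \<in> carrier P"
  shows "cnorm P (cmult P (cstar P v) v) = (cnorm P v)\<^sup>2"
proof (rule antisym)
  have vv: "cmult P (cstar P v) v \<in> carrier P" using v by (intro product_closed)
  have eq: "cnorm (F x) (cmult P (cstar P v) v x) = (cnorm (F x) (v x))\<^sup>2" if "x \<in> S" for x
    using that v by (simp add: product_apply product_memD cstar_algebra.norm_star_mult[OF fam])
  show "cnorm P (cmult P (cstar P v) v) \<le> (cnorm P v)\<^sup>2"
    using v by (intro product_norm_le)
      (auto simp: eq intro!: power_mono norm_le_product cstar_algebra.norm_nonneg[OF fam] product_memD)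
  \<comment> \<open>Passing to the root turns the fibrewise C*-identity into a bound on each norm,
    and so on their supremum.\<close>
  have "cnorm P v \<le> sqrt (cnorm P (cmult P (cstar P v) v))"
    using norm_le_product[OF vv] product_norm_nonneg[OF vv]
    by (intro product_norm_le) (auto simp: eq intro!: real_le_rsqrt)
  then show "(cnorm P v)\<^sup>2 \<le> cnorm P (cmult P (cstar P v) v)"
    using product_norm_nonneg[OF v] product_norm_nonneg[OF vv]
    by (metis power_mono real_sqrt_pow2)
qed

text \<open>Limits are taken in each fibre. The Cauchy estimate holds uniformly over the fibres, and
  letting one index tend to infinity in it shows that the convergence is uniform and the limit
  bounded.\<close>

lemma product_complete: "Metric_space.mcomplete (carrier P) (cdist P)"
proof (rule mcomplete_cdistI)
  fix a b assume ab: "a \<in> carrier P" "b \<in> carrier P"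
  have mc: "cadd P a (cscale P (-1) b) \<in> carrier P" "cadd P b (cscale P (-1) a) \<in> carrier P"
    using ab by (simp_all add: product_closed)
  show "0 \<le> cnorm P (cadd P a (cscale P (-1) b))" by (rule product_norm_nonneg[OF mc(1)])
  have "cadd P a (cscale P (-1) b) = cscale P (-1) (cadd P b (cscale P (-1) a))"
    by (intro product_eqI product_ext)
      (simp only: product_apply, intro cstar_algebra.minus_swap[OF fam] product_memD ab)
  then show "cnorm P (cadd P a (cscale P (-1) b)) = cnorm P (cadd P b (cscale P (-1) a))"
    using mc by (simp add: product_norm_scale)
  show "cnorm P (cadd P a (cscale P (-1) b)) = 0 \<longleftrightarrow> a = b"
  proof
    assume "cnorm P (cadd P a (cscale P (-1) b)) = 0"
    then have z: "cadd P a (cscale P (-1) b) = czero P" using mc product_norm_eq_zero by blast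
    show "a = b"
    proof (rule product_eqI)
      show "a x = b x" if "x \<in> S" for x
        using fun_cong[OF z, of x] that ab
        by (simp add: product_apply product_memD cstar_algebra.minus_eq_zero_iff[OF fam])
    qed (use ab product_memD in auto)
  next
    assume "a = b"
    then have "cadd P a (cscale P (-1) b) = czero P"
      using ab by (intro product_eqI product_ext)
        (simp add: product_apply product_memD cstar_algebra.minus_self[OF fam])
    then show "cnorm P (cadd P a (cscale P (-1) b)) = 0"
      using mc product_norm_eq_zero by blast
  qed
  fix d assume d: "d \<in> carrier P"
  have "cadd P a (cscale P (-1) d) = cadd P (cadd P a (cscale P (-1) b)) (cadd P b (cscale P (-1) d))"
  proof (intro product_eqI product_ext)
    fix x assume x: "x \<in> S"
    show "cadd P a (cscale P (-1) d) x
        = cadd P (cadd P a (cscale P (-1) b)) (cadd P b (cscale P (-1) d)) x"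
      unfolding product_apply[OF x]
      by (intro cstar_algebra.minus_trans[OF fam] product_memD ab d x)
  qed
  then show "cnorm P (cadd P a (cscale P (-1) d))
      \<le> cnorm P (cadd P a (cscale P (-1) b)) + cnorm P (cadd P b (cscale P (-1) d))"
    using ab d by (simp add: product_norm_triangle product_closed)
next
  fix s :: "nat \<Rightarrow> 'x \<Rightarrow> 'b"
  assume s: "\<And>n. s n \<in> carrier P"
    and C: "\<And>e. e > 0 \<Longrightarrow> \<exists>N. \<forall>m\<ge>N. \<forall>n\<ge>N. cnorm P (cadd P (s m) (cscale P (-1) (s n))) < e"
  have mc: "cadd P (s m) (cscale P (-1) (s n)) \<in> carrier P" for m n
    using s by (simp add: product_closed)
  have le: "cnorm (F x) (s m x \<ominus>\<^bsub>F x\<^esub> s n x) \<le> cnorm P (cadd P (s m) (cscale P (-1) (s n)))"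
    if "x \<in> S" for m n x
    using norm_le_product[OF mc that] that by (simp add: product_apply)
  have "\<exists>a. cstar_algebra.converges (F x) (\<lambda>n. s n x) a" if x: "x \<in> S" for x
  proof (rule cstar_algebra.converges_if_Cauchy[OF fam[OF x]])
    show "s n x \<in> carrier (F x)" for n using s x by (rule product_memD)
    show "\<exists>N. \<forall>m\<ge>N. \<forall>n\<ge>N. cnorm (F x) (s m x \<ominus>\<^bsub>F x\<^esub> s n x) < e" if "e > 0" for e
      using C[OF that] le[OF x] by (meson le_less_trans)
  qed
  then obtain l where l: "\<And>x. x \<in> S \<Longrightarrow> cstar_algebra.converges (F x) (\<lambda>n. s n x) (l x)"
    by metis
  define a where "a = restrict l S"
  have ac: "a x \<in> carrier (F x)" if "x \<in> S" for x
    using l[OF that] that fam by (simp add: a_def cstar_algebra.converges_def)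
  have ext: "a \<in> extensional S" by (simp add: a_def)
  have unif: "\<exists>N. \<forall>n\<ge>N. \<forall>x\<in>S. cnorm (F x) (s n x \<ominus>\<^bsub>F x\<^esub> a x) \<le> e" if e: "e > 0" for e
  proof -
    obtain N where N: "\<forall>m\<ge>N. \<forall>n\<ge>N. cnorm P (cadd P (s m) (cscale P (-1) (s n))) < e"
      using C[OF e] by blast
    have "cnorm (F x) (s n x \<ominus>\<^bsub>F x\<^esub> a x) \<le> e" if n: "n \<ge> N" and x: "x \<in> S" for n x
    proof (rule field_le_epsilon)
      interpret cstar_algebra "F x" using fam x .
      fix d :: real assume "d > 0"
      then obtain M where M: "\<forall>m\<ge>M. cnorm (F x) (s m x \<ominus>\<^bsub>F x\<^esub> a x) < d"
        using convergesD[OF l[OF x]] x by (auto simp: a_def)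
      \<comment> \<open>\<open>M\<close> depends on the point \<open>x\<close> and on
        \<open>d\<close>, whereas \<open>N\<close> does not; the index \<open>m\<close> drops out of
        the final estimate, so uniformity in \<open>x\<close> is kept.\<close>
      define m where "m = max M N"
      have "cnorm (F x) (s n x \<ominus>\<^bsub>F x\<^esub> a x)
          \<le> cnorm (F x) (s n x \<ominus>\<^bsub>F x\<^esub> s m x) + cnorm (F x) (s m x \<ominus>\<^bsub>F x\<^esub> a x)"
        by (intro norm_minus_triangle ac x product_memD(2)[OF s])
      also have "\<dots> \<le> e + d"
      proof (rule add_mono)
        have "N \<le> m" "M \<le> m" by (auto simp: m_def)
        show "cnorm (F x) (s n x \<ominus>\<^bsub>F x\<^esub> s m x) \<le> e"
          using le[OF x, of n m] N n \<open>N \<le> m\<close> by (meson less_imp_le order_trans)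
        show "cnorm (F x) (s m x \<ominus>\<^bsub>F x\<^esub> a x) \<le> d"
          using M \<open>M \<le> m\<close> by (simp add: less_imp_le)
      qed
      finally show "cnorm (F x) (s n x \<ominus>\<^bsub>F x\<^esub> a x) \<le> e + d" .
    qed
    then show ?thesis by blast
  qed
  obtain N where N: "\<forall>n\<ge>N. \<forall>x\<in>S. cnorm (F x) (s n x \<ominus>\<^bsub>F x\<^esub> a x) \<le> 1"
    using unif[of 1] by auto
  have a: "a \<in> carrier P"
  proof (rule product_memI[where M = "cnorm P (s N) + 1"])
    show "cnorm (F x) (a x) \<le> cnorm P (s N) + 1" if x: "x \<in> S" for x
    proof -
      interpret cstar_algebra "F x" using fam x .
      have "cnorm (F x) (a x) \<le> cnorm (F x) (s N x) + cnorm (F x) (a x \<ominus>\<^bsub>F x\<^esub> s N x)"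
        by (intro norm_le_minus ac x product_memD(2)[OF s])
      also have "cnorm (F x) (a x \<ominus>\<^bsub>F x\<^esub> s N x) = cnorm (F x) (s N x \<ominus>\<^bsub>F x\<^esub> a x)"
        by (intro norm_minus_commute ac x product_memD(2)[OF s])
      finally show ?thesis using N x norm_le_product[OF s x, of N] by fastforce
    qed
  qed (simp_all add: ext ac)
  have "(\<lambda>n. cnorm P (cadd P (s n) (cscale P (-1) a))) \<longlonglongrightarrow> 0"
  proof (rule LIMSEQ_I)
    fix e :: real assume "e > 0"
    then obtain N where N: "\<forall>n\<ge>N. \<forall>x\<in>S. cnorm (F x) (s n x \<ominus>\<^bsub>F x\<^esub> a x) \<le> e / 2"
      using unif[of "e / 2"] by auto
    have "cnorm P (cadd P (s n) (cscale P (-1) a)) \<le> e / 2" if "n \<ge> N" for n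
      using N that \<open>e > 0\<close> by (intro product_norm_le) (auto simp: product_apply)
    then show "\<exists>N. \<forall>n\<ge>N. norm (cnorm P (cadd P (s n) (cscale P (-1) a)) - 0) < e"
      using \<open>e > 0\<close> s a product_norm_nonneg[of "cadd P (s _) (cscale P (-1) a)"]
      by (intro exI[of _ N] allI impI) (fastforce simp: product_closed)
  qed
  then show "\<exists>a\<in>carrier P. (\<lambda>n. cnorm P (cadd P (s n) (cscale P (-1) a))) \<longlonglongrightarrow> 0"
    using a by blast
qed

theorem cstar_product: "cstar_algebra P"
proof
  fix a assume a: "a \<in> carrier P"
  show "\<exists>b\<in>carrier P. cadd P a b = czero P"
    using a by (intro bexI[of _ "cscale P (-1) a"] product_eqI product_ext)
      (auto simp: product_apply product_memD cstar_algebra.minus_self[OF fam] product_closed)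
next
  fix a b assume "a \<in> carrier P" "b \<in> carrier P"
  then show "cnorm P (cmult P a b) \<le> cnorm P a * cnorm P b"
  proof (intro product_norm_le)
    fix x assume ab: "a \<in> carrier P" "b \<in> carrier P" and x: "x \<in> S"
    show "cnorm (F x) (cmult P a b x) \<le> cnorm P a * cnorm P b"
      unfolding product_apply(4)[OF x]
      using ab x by (intro order_trans[OF cstar_algebra.norm_mult[OF fam]] mult_mono norm_le_product
          product_norm_nonneg cstar_algebra.norm_nonneg[OF fam] product_memD)
  qed (simp add: product_norm_nonneg)
next
  fix a b d
  assume a: "a \<in> carrier P"
    and b: "b \<in> carrier P"
    and d: "d \<in> carrier P"
  show "cadd P (cadd P a b) d = cadd P a (cadd P b d)"
    by (intro product_eqI product_ext)
      (simp only: product_apply, intro cstar_algebra.add_assoc[OF fam] product_memD a b d)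
  show "cmult P (cmult P a b) d = cmult P a (cmult P b d)"
    by (intro product_eqI product_ext)
      (simp only: product_apply, intro cstar_algebra.mult_assoc[OF fam] product_memD a b d)
  show "cmult P a (cadd P b d) = cadd P (cmult P a b) (cmult P a d)"
    by (intro product_eqI product_ext)
      (simp only: product_apply, intro cstar_algebra.distrib_left[OF fam] product_memD a b d)
  show "cmult P (cadd P a b) d = cadd P (cmult P a d) (cmult P b d)"
    by (intro product_eqI product_ext)
      (simp only: product_apply, intro cstar_algebra.distrib_right[OF fam] product_memD a b d)
next
  fix a b
  assume a: "a \<in> carrier P"
    and b: "b \<in> carrier P"
  show "cadd P a b = cadd P b a"
    by (intro product_eqI product_ext)
      (simp only: product_apply, intro cstar_algebra.add_comm[OF fam] product_memD a b)
  show "cstar P (cadd P a b) = cadd P (cstar P a) (cstar P b)"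
    by (intro product_eqI product_ext)
      (simp only: product_apply, intro cstar_algebra.star_add[OF fam] product_memD a b)
  show "cstar P (cmult P a b) = cmult P (cstar P b) (cstar P a)"
    by (intro product_eqI product_ext)
      (simp only: product_apply, intro cstar_algebra.star_mult[OF fam] product_memD a b)
next
  fix a b and c :: complex
  assume a: "a \<in> carrier P"
    and b: "b \<in> carrier P"
  show "cscale P c (cadd P a b) = cadd P (cscale P c a) (cscale P c b)"
    by (intro product_eqI product_ext)
      (simp only: product_apply, intro cstar_algebra.scale_add_right[OF fam] product_memD a b)
  show "cmult P (cscale P c a) b = cscale P c (cmult P a b)"
    by (intro product_eqI product_ext)
      (simp only: product_apply, intro cstar_algebra.scale_mult_left[OF fam] product_memD a b)
  show "cmult P a (cscale P c b) = cscale P c (cmult P a b)"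
    by (intro product_eqI product_ext)
      (simp only: product_apply, intro cstar_algebra.scale_mult_right[OF fam] product_memD a b)
next
  fix a and c c' :: complex
  assume a: "a \<in> carrier P"
  show "cscale P (c + c') a = cadd P (cscale P c a) (cscale P c' a)"
    by (intro product_eqI product_ext)
      (simp only: product_apply, intro cstar_algebra.scale_add_left[OF fam] product_memD a)
  show "cscale P (c * c') a = cscale P c (cscale P c' a)"
    by (intro product_eqI product_ext)
      (simp only: product_apply, intro cstar_algebra.scale_scale[OF fam] product_memD a)
next
  fix a and c :: complex
  assume a: "a \<in> carrier P"
  show "cstar P (cscale P c a) = cscale P (cnj c) (cstar P a)"
    by (intro product_eqI product_ext)
      (simp only: product_apply, intro cstar_algebra.star_scale[OF fam] product_memD a)
next
  fix a
  assume a: "a \<in> carrier P"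
  show "cadd P (czero P) a = a"
    by (intro product_eqI product_ext product_memD(1)[OF a])
      (simp only: product_apply, intro cstar_algebra.add_zero[OF fam] product_memD a)
  show "cscale P 1 a = a"
    by (intro product_eqI product_ext product_memD(1)[OF a])
      (simp only: product_apply, intro cstar_algebra.scale_one[OF fam] product_memD a)
  show "cstar P (cstar P a) = a"
    by (intro product_eqI product_ext product_memD(1)[OF a])
      (simp only: product_apply, intro cstar_algebra.star_star[OF fam] product_memD a)
qed (simp_all add: product_closed product_norm_eq_zero product_norm_triangle product_norm_scale
      product_norm_star_mult product_complete)

lemma product_proj:
  assumes "x \<in> S"
  shows "cstar_hom P (F x) (\<lambda>v\<in>carrier P. v x)"
  using assms by (intro cstar_homI) (auto simp: product_apply product_memD product_closed)

end

section \<open>Generated C*-subalgebras and their morphisms\<close>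

context cstar_algebra
begin

lemma cstar_subalgebra:
  assumes sub: "S \<subseteq> carrier A" and zero: "\<zero> \<in> S"
    and add: "\<And>a b. a \<in> S \<Longrightarrow> b \<in> S \<Longrightarrow> a \<oplus> b \<in> S"
    and scale: "\<And>c a. a \<in> S \<Longrightarrow> c \<odot> a \<in> S"
    and mult: "\<And>a b. a \<in> S \<Longrightarrow> b \<in> S \<Longrightarrow> a \<otimes> b \<in> S"
    and star: "\<And>a. a \<in> S \<Longrightarrow> cstar A a \<in> S"
    and closure: "norm_closure A S \<subseteq> S"
  shows "cstar_algebra (A\<lparr>carrier := S\<rparr>)"
proof -
  have [simp]: "a \<in> S \<Longrightarrow> a \<in> carrier A" for a using sub by blast
  have inverse: "\<exists>b\<in>S. a \<oplus> b = \<zero>" if "a \<in> S" for a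
    using that scale by (intro bexI[of _ "(-1) \<odot> a"]) (simp_all add: minus_self)
  have "Metric_space.mcomplete (carrier (A\<lparr>carrier := S\<rparr>)) (cdist (A\<lparr>carrier := S\<rparr>))"
  proof (rule mcomplete_cdistI)
    fix s :: "nat \<Rightarrow> 'a"
    assume s: "\<And>n. s n \<in> carrier (A\<lparr>carrier := S\<rparr>)"
      and C: "\<And>e. e > 0 \<Longrightarrow> \<exists>N. \<forall>m\<ge>N. \<forall>n\<ge>N.
        cnorm (A\<lparr>carrier := S\<rparr>) (s m \<ominus>\<^bsub>A\<lparr>carrier := S\<rparr>\<^esub> s n) < e"
    have sS: "\<And>n. s n \<in> S" using s by simp
    then obtain a where a: "converges s a" using converges_if_Cauchy[of s] C by auto
    then have "a \<in> S" using converges_in_norm_closure[OF a sS] closure by blast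
    then show "\<exists>a\<in>carrier (A\<lparr>carrier := S\<rparr>).
        (\<lambda>n. cnorm (A\<lparr>carrier := S\<rparr>) (s n \<ominus>\<^bsub>A\<lparr>carrier := S\<rparr>\<^esub> a)) \<longlonglongrightarrow> 0"
      using a by (auto simp: converges_def)
  qed (simp_all add: norm_nonneg closed norm_minus_commute norm_eq_zero minus_eq_zero_iff norm_minus_triangle)
  then show ?thesis
    by unfold_locales
      (auto simp: zero add scale mult star add_assoc add_zero scale_add_right scale_add_left scale_scale scale_one
        mult_assoc distrib_left distrib_right scale_mult_left scale_mult_right star_star star_add star_scale
        star_mult norm_eq_zero norm_triangle norm_scale norm_mult norm_star_mult inverse intro: add_comm)
qed

lemma star_span_sub: "S \<subseteq> carrier A \<Longrightarrow> star_span A S \<subseteq> carrier A"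
proof
  fix a assume "S \<subseteq> carrier A" and "a \<in> star_span A S"
  from this(2,1) show "a \<in> carrier A" by induction (auto simp: closed)
qed

end

text \<open>One construction for two purposes: it yields the universal algebra of a net as well as
  the algebra of fields attached to the net, so both share the same arguments from
  generators.\<close>

definition gen_calg :: "'a calg \<Rightarrow> 'a set \<Rightarrow> 'a calg" where
  "gen_calg A S = A\<lparr>carrier := norm_closure A (star_span A S)\<rparr>"

lemma gen_calg_simps [simp]:
  "carrier (gen_calg A S) = norm_closure A (star_span A S)"
  "czero (gen_calg A S) = czero A" "cadd (gen_calg A S) = cadd A" "cscale (gen_calg A S) = cscale A"
  "cmult (gen_calg A S) = cmult A" "cstar (gen_calg A S) = cstar A" "cnorm (gen_calg A S) = cnorm A"
  by (auto simp: gen_calg_def)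

context cstar_algebra
begin

lemma gen_calg_cstar:
  assumes "S \<subseteq> carrier A"
  shows "cstar_algebra (gen_calg A S)"
  unfolding gen_calg_def
proof (rule cstar_subalgebra)
  show "\<zero> \<in> norm_closure A (star_span A S)"
    using sub_norm_closure[OF star_span_sub[OF assms]] star_span.zero[of A S] by blast
qed (auto simp: norm_closure_sub norm_closure_idem star_span.intros
    intro: norm_closure_add norm_closure_scale norm_closure_mult norm_closure_star)

lemma gen_calg_sub: "norm_closure A (star_span A S) \<subseteq> carrier A"
  by (rule norm_closure_sub)

lemma gen_sub_gen_calg: "S \<subseteq> carrier A \<Longrightarrow> S \<subseteq> norm_closure A (star_span A S)"
  using sub_norm_closure[OF star_span_sub[of S]] star_span.gen[of _ S A] by blast

text \<open>Serves as the induction principle for generated algebras: \<open>Q\<close> is taken to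
  be the set of elements with the property to be proved.\<close>

lemma gen_calg_least:
  assumes "S \<subseteq> Q" and "\<zero> \<in> Q"
    and "\<And>a b. a \<in> Q \<Longrightarrow> b \<in> Q \<Longrightarrow> a \<oplus> b \<in> Q"
    and "\<And>c a. a \<in> Q \<Longrightarrow> c \<odot> a \<in> Q"
    and "\<And>a b. a \<in> Q \<Longrightarrow> b \<in> Q \<Longrightarrow> a \<otimes> b \<in> Q"
    and "\<And>a. a \<in> Q \<Longrightarrow> cstar A a \<in> Q"
    and "norm_closure A Q \<subseteq> Q"
  shows "norm_closure A (star_span A S) \<subseteq> Q"
proof -
  have "a \<in> Q" if "a \<in> star_span A S" for a
    using that assms(1) by induction (auto simp: assms(2-6))
  then show ?thesis using norm_closure_mono[of "star_span A S" Q] assms(7) by blast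
qed

end

lemma cstar_hom_norm_diff:
  assumes "cstar_algebra A" "cstar_algebra B" "cstar_hom A B h" "a \<in> carrier A" "b \<in> carrier A"
  shows "cnorm B (h a \<ominus>\<^bsub>B\<^esub> h b) \<le> cnorm A (a \<ominus>\<^bsub>A\<^esub> b)"
  using cstar_hom_contractive[OF assms(1-3), of "a \<ominus>\<^bsub>A\<^esub> b"] assms
  by (simp add: cstar_algebra.cstar_hom_minus cstar_algebra.closed)

lemma cstar_hom_in_norm_closure:
  assumes A: "cstar_algebra A" and B: "cstar_algebra B" and h: "cstar_hom A B h"
    and "\<And>s. s \<in> S \<Longrightarrow> s \<in> carrier A \<Longrightarrow> h s \<in> T" and a: "a \<in> norm_closure A S"
  shows "h a \<in> norm_closure B T"
proof -
  interpret A: cstar_algebra A by fact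
  interpret B: cstar_algebra B by fact
  have ac: "a \<in> carrier A" using a A.in_norm_closure by blast
  show ?thesis
    unfolding B.in_norm_closure
  proof (intro conjI allI impI)
    show "h a \<in> carrier B" using ac cstar_homD(1)[OF h] by blast
    fix e :: real assume "e > 0"
    then obtain s where "s \<in> S" "s \<in> carrier A" "cnorm A (a \<ominus>\<^bsub>A\<^esub> s) < e"
      using a A.in_norm_closure by blast
    then show "\<exists>s\<in>T. s \<in> carrier B \<and> cnorm B (h a \<ominus>\<^bsub>B\<^esub> s) < e"
      using cstar_hom_norm_diff[OF A B h ac] assms(4) cstar_homD(1)[OF h] by (meson le_less_trans)
  qed
qed

text \<open>The elements on which \<open>h\<close> and \<open>k\<close> agree form a *-subalgebra,
  and contractivity makes it closed; it contains the generators.\<close>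

lemma gen_calg_hom_eqI:
  assumes A: "cstar_algebra A" and B: "cstar_algebra B" and S: "S \<subseteq> carrier A"
    and h: "cstar_hom (gen_calg A S) B h" and k: "cstar_hom (gen_calg A S) B k"
    and eq: "\<And>s. s \<in> S \<Longrightarrow> h s = k s"
  shows "h = k"
proof -
  interpret A: cstar_algebra A by fact
  interpret B: cstar_algebra B by fact
  interpret G: cstar_algebra "gen_calg A S" using S by (rule A.gen_calg_cstar)
  define Q where "Q = {a \<in> carrier (gen_calg A S). h a = k a}"
  have "norm_closure A (star_span A S) \<subseteq> Q"
  proof (rule A.gen_calg_least)
    show "S \<subseteq> Q" using A.gen_sub_gen_calg[OF S] eq by (auto simp: Q_def)
    show "norm_closure A Q \<subseteq> Q"
    proof
      fix a assume a: "a \<in> norm_closure A Q"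
      \<comment> \<open>The closure is formed in the ambient algebra, while \<open>h\<close> and
        \<open>k\<close> are controlled only on the generated one; so \<open>a\<close> must first be
        placed there.\<close>
      have "norm_closure A Q \<subseteq> norm_closure A (carrier (gen_calg A S))"
        by (rule A.norm_closure_mono) (auto simp: Q_def)
      then have aG: "a \<in> carrier (gen_calg A S)" using a by (auto simp: A.norm_closure_idem)
      have "h a = k a"
      proof (rule B.eq_if_norm_small)
        show hk: "h a \<in> carrier B" "k a \<in> carrier B" using aG h k by (auto dest: cstar_homD(1))
        fix e :: real assume "e > 0"
        then obtain s where s: "s \<in> Q" "cnorm A (a \<ominus>\<^bsub>A\<^esub> s) < e / 2"
          using a unfolding A.in_norm_closure by (meson half_gt_zero)
        have sG: "s \<in> carrier (gen_calg A S)" and hks: "h s = k s" using s by (auto simp: Q_def)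
        then have hs: "h s \<in> carrier B" using h by (auto dest: cstar_homD(1))
        have "cnorm B (h a \<ominus>\<^bsub>B\<^esub> k a) \<le> cnorm B (h a \<ominus>\<^bsub>B\<^esub> h s) + cnorm B (h s \<ominus>\<^bsub>B\<^esub> k a)"
          by (intro B.norm_minus_triangle hk hs)
        also have "\<dots> = cnorm B (h a \<ominus>\<^bsub>B\<^esub> h s) + cnorm B (k a \<ominus>\<^bsub>B\<^esub> k s)"
          using hk hs hks B.norm_minus_commute by simp
        also have "\<dots> \<le> cnorm A (a \<ominus>\<^bsub>A\<^esub> s) + cnorm A (a \<ominus>\<^bsub>A\<^esub> s)"
          using cstar_hom_norm_diff[OF G.cstar_algebra_axioms B h aG sG]
            cstar_hom_norm_diff[OF G.cstar_algebra_axioms B k aG sG] by simp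
        finally show "cnorm B (h a \<ominus>\<^bsub>B\<^esub> k a) < e" using s by simp
      qed
      then show "a \<in> Q" using aG by (simp add: Q_def)
    qed
    have "h \<zero>\<^bsub>A\<^esub> = k \<zero>\<^bsub>A\<^esub>"
      using cstar_hom_zero[OF G.cstar_algebra_axioms B h] cstar_hom_zero[OF G.cstar_algebra_axioms B k] by simp
    then show "\<zero>\<^bsub>A\<^esub> \<in> Q" using G.zero_closed by (simp add: Q_def)
  qed (use G.closed cstar_homD[OF h] cstar_homD[OF k] in \<open>auto simp: Q_def\<close>)
  then show ?thesis
    using cstar_homD(6)[OF h] cstar_homD(6)[OF k]
    by (intro extensionalityI[of h "carrier (gen_calg A S)"]) (auto simp: Q_def)
qed

lemma star_span_hom:
  assumes h: "cstar_hom A B h" and A: "cstar_algebra A" and B: "cstar_algebra B"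
    and S: "S \<subseteq> carrier A" and T: "\<And>s. s \<in> S \<Longrightarrow> h s \<in> T" and a: "a \<in> star_span A S"
  shows "h a \<in> star_span B T"
proof -
  have sub: "a \<in> star_span A S \<Longrightarrow> a \<in> carrier A" for a
    using cstar_algebra.star_span_sub[OF A S] by blast
  show ?thesis using a
    by induction (auto simp: cstar_hom_zero[OF A B h] cstar_homD[OF h] sub T intro: star_span.intros)
qed

lemma gen_calg_hom_restrict:
  assumes A: "cstar_algebra A" and B: "cstar_algebra B" and h: "cstar_hom A B h"
    and S: "S \<subseteq> carrier A" and T: "\<And>s. s \<in> S \<Longrightarrow> h s \<in> T"
  shows "cstar_hom (gen_calg A S) (gen_calg B T) (restrict h (carrier (gen_calg A S)))"
proof -
  have maps: "h a \<in> norm_closure B (star_span B T)" if "a \<in> norm_closure A (star_span A S)" for a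
    using star_span_hom[OF h A B S T] by (rule cstar_hom_in_norm_closure[OF A B h _ that])
  have sub: "a \<in> norm_closure A (star_span A S) \<Longrightarrow> a \<in> carrier A" for a
    using cstar_algebra.gen_calg_sub[OF A] by blast
  show ?thesis
    using cstar_algebra.closed[OF cstar_algebra.gen_calg_cstar[OF A S]]
    by (intro cstar_homI) (auto simp: maps cstar_homD[OF h] sub)
qed

section \<open>Transport of structure along an injection\<close>

definition transport_calg :: "('a \<Rightarrow> 'b) \<Rightarrow> 'a calg \<Rightarrow> 'b calg" where
  "transport_calg \<iota> A = (let \<kappa> = inv_into (carrier A) \<iota> in
     \<lparr>carrier = \<iota> ` carrier A, czero = \<iota> \<zero>\<^bsub>A\<^esub>,
      cadd = (\<lambda>a b. \<iota> (\<kappa> a \<oplus>\<^bsub>A\<^esub> \<kappa> b)), cscale = (\<lambda>c a. \<iota> (c \<odot>\<^bsub>A\<^esub> \<kappa> a)),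
      cmult = (\<lambda>a b. \<iota> (\<kappa> a \<otimes>\<^bsub>A\<^esub> \<kappa> b)), cstar = (\<lambda>a. \<iota> (cstar A (\<kappa> a))), cnorm = (\<lambda>a. cnorm A (\<kappa> a))\<rparr>)"

text \<open>Bridges the gap between the type of families indexed by representations, where the
  universal algebra is built, and the type \<open>univ\<close> prescribed by
  \<open>universal\<close>.\<close>

locale cstar_transport = cstar_algebra A for A :: "'a calg" (structure) +
  fixes \<iota> :: "'a \<Rightarrow> 'b"
  assumes inj: "inj_on \<iota> (carrier A)"
begin

abbreviation "T \<equiv> transport_calg \<iota> A"
abbreviation "\<kappa> \<equiv> inv_into (carrier A) \<iota>"

lemma \<kappa>_\<iota> [simp]: "a \<in> carrier A \<Longrightarrow> \<kappa> (\<iota> a) = a"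
  by (rule inv_into_f_f[OF inj])

lemma transport_simps:
  "carrier T = \<iota> ` carrier A" "czero T = \<iota> \<zero>"
  "a \<in> carrier A \<Longrightarrow> b \<in> carrier A \<Longrightarrow> cadd T (\<iota> a) (\<iota> b) = \<iota> (a \<oplus> b)"
  "a \<in> carrier A \<Longrightarrow> cscale T c (\<iota> a) = \<iota> (c \<odot> a)"
  "a \<in> carrier A \<Longrightarrow> b \<in> carrier A \<Longrightarrow> cmult T (\<iota> a) (\<iota> b) = \<iota> (a \<otimes> b)"
  "a \<in> carrier A \<Longrightarrow> cstar T (\<iota> a) = \<iota> (cstar A a)"
  "a \<in> carrier A \<Longrightarrow> cnorm T (\<iota> a) = cnorm A a"
  by (simp_all add: transport_calg_def Let_def)

lemma \<iota>_eq_iff: "a \<in> carrier A \<Longrightarrow> b \<in> carrier A \<Longrightarrow> \<iota> a = \<iota> b \<longleftrightarrow> a = b"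
  using inj by (auto dest: inj_onD)

theorem transport_cstar: "cstar_algebra T"
proof -
  have "Metric_space.mcomplete (carrier T) (cdist T)"
  proof (rule mcomplete_cdistI)
    fix s :: "nat \<Rightarrow> 'b"
    assume s: "\<And>n. s n \<in> carrier T"
      and C: "\<And>e. e > 0 \<Longrightarrow> \<exists>N. \<forall>m\<ge>N. \<forall>n\<ge>N. cnorm T (s m \<ominus>\<^bsub>T\<^esub> s n) < e"
    define r where "r n = \<kappa> (s n)" for n
    have r: "r n \<in> carrier A" "s n = \<iota> (r n)" for n
      using s[of n] by (auto simp: r_def transport_simps)
    have "\<exists>N. \<forall>m\<ge>N. \<forall>n\<ge>N. cnorm A (r m \<ominus> r n) < e" if "e > 0" for e
      using C[OF that] by (simp add: r transport_simps closed)
    then obtain a where "converges r a" using converges_if_Cauchy[of r] r by blast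
    then show "\<exists>a\<in>carrier T. (\<lambda>n. cnorm T (s n \<ominus>\<^bsub>T\<^esub> a)) \<longlonglongrightarrow> 0"
      by (intro bexI[of _ "\<iota> a"]) (auto simp: r transport_simps closed converges_def)
  qed (auto simp: transport_simps norm_nonneg closed norm_minus_commute norm_eq_zero minus_eq_zero_iff
      norm_minus_triangle \<iota>_eq_iff)
  then show ?thesis
    by unfold_locales
      (auto simp: transport_simps closed add_assoc add_zero scale_add_right scale_add_left scale_scale scale_one
        mult_assoc distrib_left distrib_right scale_mult_left scale_mult_right star_star star_add star_scale
        star_mult norm_eq_zero norm_triangle norm_scale norm_mult norm_star_mult add_inverse \<iota>_eq_iff
        intro: add_comm)
qed

lemma transport_hom: "cstar_hom A T (restrict \<iota> (carrier A))"
  by (intro cstar_homI) (auto simp: transport_simps closed)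

lemma transport_hom_inv: "cstar_hom T A (restrict \<kappa> (carrier T))"
proof (rule cstar_homI)
  fix a b c
  assume "a \<in> carrier T"
  then obtain x where x: "x \<in> carrier A" "a = \<iota> x" by (auto simp: transport_simps)
  then show "restrict \<kappa> (carrier T) a \<in> carrier A"
    "restrict \<kappa> (carrier T) (cscale T c a) = c \<odot> restrict \<kappa> (carrier T) a"
    "restrict \<kappa> (carrier T) (cstar T a) = cstar A (restrict \<kappa> (carrier T) a)"
    by (simp_all add: transport_simps closed)
  assume "b \<in> carrier T"
  then obtain y where "y \<in> carrier A" "b = \<iota> y" by (auto simp: transport_simps)
  with x show "restrict \<kappa> (carrier T) (cadd T a b) = restrict \<kappa> (carrier T) a \<oplus> restrict \<kappa> (carrier T) b"
    "restrict \<kappa> (carrier T) (cmult T a b) = restrict \<kappa> (carrier T) a \<otimes> restrict \<kappa> (carrier T) b"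
    by (simp_all add: transport_simps closed)
qed simp

end

section \<open>Existence of the universal C*-algebra of a net\<close>

lemma is_netD:
  assumes "is_net K \<A>"
  shows "\<And>Y. Y \<in> K \<Longrightarrow> cstar_algebra (fib \<A> Y)"
    and "\<And>Y Y'. Y \<in> K \<Longrightarrow> Y' \<in> K \<Longrightarrow> Y \<subseteq> Y' \<Longrightarrow> cstar_hom (fib \<A> Y) (fib \<A> Y') (incl \<A> Y' Y)"
  using assms by (auto simp: is_net_def)

lemma is_net_subset: "is_net K \<A> \<Longrightarrow> K' \<subseteq> K \<Longrightarrow> is_net K' \<A>"
  unfolding is_net_def by (meson subsetD)

lemma net_morphism_iff:
  assumes "is_net K \<A>" "is_net K \<B>"
  shows "net_morphism K \<A> \<B> \<phi> \<longleftrightarrow> \<phi> \<in> extensional K \<and>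
    (\<forall>Y\<in>K. cstar_hom (fib \<A> Y) (fib \<B> Y) (\<phi> Y)) \<and>
    (\<forall>Y\<in>K. \<forall>Y'\<in>K. Y \<subseteq> Y' \<longrightarrow>
      (\<forall>t\<in>carrier (fib \<A> Y). \<phi> Y' (incl \<A> Y' Y t) = incl \<B> Y' Y (\<phi> Y t)))"
  unfolding net_morphism_def
  by (auto simp: compose_def fun_eq_iff restrict_def split: if_splits)

lemma net_morphism_const_iff:
  assumes "is_net K \<A>"
  shows "net_morphism K \<A> (const_net B) \<pi> \<longleftrightarrow> \<pi> \<in> extensional K \<and>
    (\<forall>Y\<in>K. cstar_hom (fib \<A> Y) B (\<pi> Y)) \<and>
    (\<forall>Y\<in>K. \<forall>Y'\<in>K. Y \<subseteq> Y' \<longrightarrow> (\<forall>t\<in>carrier (fib \<A> Y). \<pi> Y' (incl \<A> Y' Y t) = \<pi> Y t))"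
proof -
  have "compose (carrier (fib \<A> Y)) (\<pi> Y') (incl \<A> Y' Y) = compose (carrier (fib \<A> Y)) (id_map B) (\<pi> Y)
      \<longleftrightarrow> (\<forall>t\<in>carrier (fib \<A> Y). \<pi> Y' (incl \<A> Y' Y t) = \<pi> Y t)"
    if "cstar_hom (fib \<A> Y) B (\<pi> Y)" for Y Y'
    using cstar_homD(1)[OF that]
    by (auto simp: compose_def fun_eq_iff restrict_def id_map_def split: if_splits)
  then show ?thesis
    unfolding net_morphism_def const_net_def by auto
qed

text \<open>Fixing the type of the target algebra turns the class of all representations into a set,
  over which a product can be formed.\<close>

definition net_reps ::
    "'x set set \<Rightarrow> ('x, 'a) net \<Rightarrow> ('u calg \<times> ('x set \<Rightarrow> 'a \<Rightarrow> 'u)) set" where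
  "net_reps K \<A> = {(B, \<pi>). cstar_algebra B \<and> net_morphism K \<A> (const_net B) \<pi>}"

section \<open>The universal algebra inside the product of all representations\<close>

locale universal_construction =
  fixes K :: "'x set set" and \<A> :: "('x, 'a) net"
  assumes net: "is_net K \<A>"
begin

abbreviation reps :: "(('x, 'a) univ calg \<times> ('x set \<Rightarrow> 'a \<Rightarrow> ('x, 'a) univ)) set" where
  "reps \<equiv> net_reps K \<A>"

abbreviation "W \<equiv> product_calg reps fst"

sublocale cstar_family reps fst
  by (rule cstar_family.intro) (auto simp: net_reps_def)

sublocale W: cstar_algebra W
  by (rule cstar_product)

definition \<gamma> where "\<gamma> Y t = (\<lambda>r\<in>reps. snd r Y t)"

definition gens where "gens = {\<gamma> Y t | Y t. Y \<in> K \<and> t \<in> carrier (fib \<A> Y)}"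

lemma rep_hom:
  assumes "r \<in> reps" "Y \<in> K"
  shows "cstar_hom (fib \<A> Y) (fst r) (snd r Y)"
  using assms by (auto simp: net_reps_def net_morphism_const_iff[OF net])

lemma \<gamma>_closed:
  assumes Y: "Y \<in> K" "t \<in> carrier (fib \<A> Y)"
  shows "\<gamma> Y t \<in> carrier W"
proof (rule product_memI[where M = "cnorm (fib \<A> Y) t"])
  show "cnorm (fst r) (\<gamma> Y t r) \<le> cnorm (fib \<A> Y) t" if "r \<in> reps" for r
    using cstar_hom_contractive[OF is_netD(1)[OF net Y(1)] fam[OF that] rep_hom[OF that Y(1)] Y(2)] that
    by (simp add: \<gamma>_def)
qed (use cstar_homD(1)[OF rep_hom[OF _ Y(1)] Y(2)] in \<open>auto simp: \<gamma>_def\<close>)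

lemma gens_sub: "gens \<subseteq> carrier W"
  by (auto simp: gens_def \<gamma>_closed)

abbreviation "G \<equiv> gen_calg W gens"

sublocale G: cstar_algebra G
  by (rule W.gen_calg_cstar[OF gens_sub])

text \<open>What matters is that every *-polynomial in the generators is the value of some term; the
  values of terms with labels outside the net are immaterial.\<close>

primrec eval_term :: "('x, 'a) star_term \<Rightarrow> _" where
  "eval_term (Gen Y t) = \<gamma> Y t"
| "eval_term Zero = czero W"
| "eval_term (Plus s t) = cadd W (eval_term s) (eval_term t)"
| "eval_term (Scale c s) = cscale W c (eval_term s)"
| "eval_term (Times s t) = cmult W (eval_term s) (eval_term t)"
| "eval_term (Star s) = cstar W (eval_term s)"

lemma star_span_eval: "p \<in> star_span W gens \<Longrightarrow> \<exists>s. eval_term s = p"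
proof (induction rule: star_span.induct)
  case (gen a)
  then obtain Y t where "a = \<gamma> Y t" unfolding gens_def by blast
  then have "eval_term (Gen Y t) = a" by simp
  then show ?case by blast
qed (metis eval_term.simps)+

text \<open>Choosing an approximating sequence of terms for each element is an embedding into
  \<open>univ\<close>, because a sequence has at most one limit and so determines the element it was
  chosen for.\<close>

definition terms_of where "terms_of p = (SOME s. W.converges (\<lambda>n. eval_term (s n)) p)"

lemma converges_terms_of:
  assumes "p \<in> carrier G"
  shows "W.converges (\<lambda>n. eval_term (terms_of p n)) p"
proof -
  obtain q where q: "\<And>n. q n \<in> star_span W gens" "W.converges q p"
    using W.norm_closure_sequence assms by force
  have "\<forall>n. \<exists>s. eval_term s = q n" using star_span_eval q(1) by blast
  then obtain s where "\<And>n. eval_term (s n) = q n" by (auto dest!: choice)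
  then have "W.converges (\<lambda>n. eval_term (s n)) p" using q by presburger
  then show ?thesis unfolding terms_of_def
    by (rule someI[where P = "\<lambda>s. W.converges (\<lambda>n. eval_term (s n)) p"])
qed

sublocale U: cstar_transport G terms_of
proof
  show "inj_on terms_of (carrier G)"
    by (rule inj_onI) (metis W.converges_unique converges_terms_of)
qed

abbreviation "U \<equiv> transport_calg terms_of G"

definition eps where "eps = (\<lambda>Y\<in>K. \<lambda>t\<in>carrier (fib \<A> Y). terms_of (\<gamma> Y t))"

lemma \<gamma>_in_G: "Y \<in> K \<Longrightarrow> t \<in> carrier (fib \<A> Y) \<Longrightarrow> \<gamma> Y t \<in> carrier G"
  using W.gen_sub_gen_calg[OF gens_sub] by (auto simp: gens_def)

lemma \<gamma>_hom:
  assumes Y: "Y \<in> K"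
  shows "cstar_hom (fib \<A> Y) G (\<lambda>t\<in>carrier (fib \<A> Y). \<gamma> Y t)"
proof -
  note closed = cstar_algebra.closed[OF is_netD(1)[OF net Y]]
  note h = cstar_homD[OF rep_hom[OF _ Y]]
  show ?thesis
  proof (rule cstar_homI)
    fix a b c
    assume a: "a \<in> carrier (fib \<A> Y)"
    then show "(\<lambda>t\<in>carrier (fib \<A> Y). \<gamma> Y t) a \<in> carrier G" using \<gamma>_in_G Y by simp
    have "\<gamma> Y (cscale (fib \<A> Y) c a) = cscale W c (\<gamma> Y a)"
      by (rule product_eqI) (auto simp: \<gamma>_def product_ext product_apply h a)
    then show "(\<lambda>t\<in>carrier (fib \<A> Y). \<gamma> Y t) (cscale (fib \<A> Y) c a)
        = cscale G c ((\<lambda>t\<in>carrier (fib \<A> Y). \<gamma> Y t) a)" using a closed by simp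
    have "\<gamma> Y (cstar (fib \<A> Y) a) = cstar W (\<gamma> Y a)"
      by (rule product_eqI) (auto simp: \<gamma>_def product_ext product_apply h a)
    then show "(\<lambda>t\<in>carrier (fib \<A> Y). \<gamma> Y t) (cstar (fib \<A> Y) a)
        = cstar G ((\<lambda>t\<in>carrier (fib \<A> Y). \<gamma> Y t) a)" using a closed by simp
    assume b: "b \<in> carrier (fib \<A> Y)"
    have "\<gamma> Y (cadd (fib \<A> Y) a b) = cadd W (\<gamma> Y a) (\<gamma> Y b)"
      by (rule product_eqI) (auto simp: \<gamma>_def product_ext product_apply h a b)
    then show "(\<lambda>t\<in>carrier (fib \<A> Y). \<gamma> Y t) (cadd (fib \<A> Y) a b)
        = cadd G ((\<lambda>t\<in>carrier (fib \<A> Y). \<gamma> Y t) a) ((\<lambda>t\<in>carrier (fib \<A> Y). \<gamma> Y t) b)"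
      using a b closed by simp
    have "\<gamma> Y (cmult (fib \<A> Y) a b) = cmult W (\<gamma> Y a) (\<gamma> Y b)"
      by (rule product_eqI) (auto simp: \<gamma>_def product_ext product_apply h a b)
    then show "(\<lambda>t\<in>carrier (fib \<A> Y). \<gamma> Y t) (cmult (fib \<A> Y) a b)
        = cmult G ((\<lambda>t\<in>carrier (fib \<A> Y). \<gamma> Y t) a) ((\<lambda>t\<in>carrier (fib \<A> Y). \<gamma> Y t) b)"
      using a b closed by simp
  qed simp
qed

lemma eps_hom:
  assumes Y: "Y \<in> K"
  shows "cstar_hom (fib \<A> Y) U (eps Y)"
proof -
  have "eps Y = compose (carrier (fib \<A> Y)) (restrict terms_of (carrier G)) (\<lambda>t\<in>carrier (fib \<A> Y). \<gamma> Y t)"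
    using Y \<gamma>_in_G[OF Y] by (auto simp: eps_def compose_def fun_eq_iff simp del: gen_calg_simps)
  then show ?thesis
    using cstar_hom_compose[OF \<gamma>_hom[OF Y] U.transport_hom is_netD(1)[OF net Y]] by simp
qed

lemma eps_morphism: "net_morphism K \<A> (const_net U) eps"
  unfolding net_morphism_const_iff[OF net]
proof (intro conjI ballI impI eps_hom)
  show "eps \<in> extensional K" by (simp add: eps_def)
  fix Y Y' t
  assume Y: "Y \<in> K" "Y' \<in> K" "Y \<subseteq> Y'" and t: "t \<in> carrier (fib \<A> Y)"
  have "\<gamma> Y' (incl \<A> Y' Y t) = \<gamma> Y t"
    using Y t by (auto simp: \<gamma>_def fun_eq_iff net_reps_def net_morphism_const_iff[OF net])
  then show "eps Y' (incl \<A> Y' Y t) = eps Y t"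
    using Y t cstar_homD(1)[OF is_netD(2)[OF net Y]] by (simp add: eps_def)
qed

text \<open>Precomposition with the embedding moves the question back to the generated algebra,
  where agreement on the generators decides it; every element of \<open>U\<close> is reached because
  the embedding is onto its carrier.\<close>

lemma hom_from_U_unique:
  assumes B: "cstar_algebra B" and h: "cstar_hom U B h" and k: "cstar_hom U B k"
    and eq: "family_comp K \<A> (\<lambda>Y. h) eps = family_comp K \<A> (\<lambda>Y. k) eps"
  shows "h = k"
proof -
  let ?r = "\<lambda>f. compose (carrier G) f (restrict terms_of (carrier G))"
  have "?r h = ?r k"
  proof (rule gen_calg_hom_eqI[OF W.cstar_algebra_axioms B gens_sub])
    show "cstar_hom G B (?r h)" "cstar_hom G B (?r k)"
      using cstar_hom_compose[OF U.transport_hom _ G.cstar_algebra_axioms] h k by blast+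
    show "?r h g = ?r k g" if g: "g \<in> gens" for g
    proof -
      obtain Y t where Y: "g = \<gamma> Y t" "Y \<in> K" "t \<in> carrier (fib \<A> Y)" using g unfolding gens_def by blast
      have "h (eps Y t) = k (eps Y t)"
        using fun_cong[OF fun_cong[OF eq, of Y], of t] Y by (simp add: family_comp_def compose_def)
      then show ?thesis using Y \<gamma>_in_G[of Y t] by (simp add: eps_def compose_def)
    qed
  qed
  then have r: "?r h p = ?r k p" for p by (rule fun_cong)
  have "h (terms_of p) = k (terms_of p)" if "p \<in> carrier G" for p
    using r[of p] unfolding compose_eq[OF that] restrict_apply'[OF that] .
  then show ?thesis
    using cstar_homD(6)[OF h] cstar_homD(6)[OF k]
    by (intro extensionalityI[of h "carrier U"]) (auto simp: U.transport_simps)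
qed

text \<open>The pair \<open>(B, \<pi>)\<close> is itself an index of the product, so the
  factorization is the coordinate projection at that index.\<close>

lemma hom_from_U_exists:
  assumes r: "(B, \<pi>) \<in> reps"
  shows "\<exists>h. cstar_hom U B h \<and> family_comp K \<A> (\<lambda>Y. h) eps = \<pi>"
proof -
  have \<pi>: "net_morphism K \<A> (const_net B) \<pi>" using r by (simp add: net_reps_def)
  \<comment> \<open>\<open>id_map G\<close> is read here as the inclusion of the generated algebra
    into the product.\<close>
  have incl: "cstar_hom G W (id_map G)"
    using G.closed W.gen_calg_sub[of gens] by (intro cstar_homI) (auto simp: id_map_def)
  define h where "h = compose (carrier U) (compose (carrier G) (\<lambda>v\<in>carrier W. v (B, \<pi>)) (id_map G))
    (restrict U.\<kappa> (carrier U))"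
  have "cstar_hom U B h"
    unfolding h_def using product_proj[OF r]
    by (intro cstar_hom_compose[OF U.transport_hom_inv] cstar_hom_compose[OF incl] U.transport_cstar
        G.cstar_algebra_axioms) simp
  moreover have h: "h (eps Y t) = \<pi> Y t" if "Y \<in> K" "t \<in> carrier (fib \<A> Y)" for Y t
    using that r \<gamma>_in_G[OF that] \<gamma>_closed[OF that]
    by (simp add: h_def eps_def compose_def id_map_def U.transport_simps \<gamma>_def[of Y t] del: gen_calg_simps)
  have "family_comp K \<A> (\<lambda>Y. h) eps = \<pi>"
  proof (rule extensionalityI)
    show "\<pi> \<in> extensional K" using \<pi> by (simp add: net_morphism_def)
    fix Y assume Y: "Y \<in> K"
    have "\<pi> Y \<in> extensional (carrier (fib \<A> Y))"
      using \<pi> Y cstar_homD(6) by (auto simp: net_morphism_const_iff[OF net])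
    then show "family_comp K \<A> (\<lambda>Y. h) eps Y = \<pi> Y"
      using Y h by (intro extensionalityI[of _ "carrier (fib \<A> Y)"]) (auto simp: family_comp_def compose_def)
  qed (simp add: family_comp_def)
  ultimately show ?thesis by blast
qed

lemma is_universal_U: "is_universal K \<A> U eps"
  unfolding is_universal_def
proof (intro conjI allI impI)
  show "cstar_algebra U" by (rule U.transport_cstar)
  show "net_morphism K \<A> (const_net U) eps" by (rule eps_morphism)
  fix B :: "('x, 'a) univ calg" and \<pi>
  assume "cstar_algebra B \<and> net_morphism K \<A> (const_net B) \<pi>"
  then have B: "cstar_algebra B" and r: "(B, \<pi>) \<in> reps" by (auto simp: net_reps_def)
  obtain h where "cstar_hom U B h \<and> family_comp K \<A> (\<lambda>Y. h) eps = \<pi>"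
    using hom_from_U_exists[OF r] by blast
  then show "\<exists>!h. cstar_hom U B h \<and> family_comp K \<A> (\<lambda>Y. h) eps = \<pi>"
    using hom_from_U_unique[OF B] by blast
qed

end

theorem is_universal_universal:
  assumes "is_net K \<A>"
  shows "is_universal K \<A> (fst (universal K \<A>)) (snd (universal K \<A>))"
proof -
  interpret universal_construction K \<A> by unfold_locales (rule assms)
  have "case universal K \<A> of (V, \<epsilon>) \<Rightarrow> is_universal K \<A> V \<epsilon>"
    unfolding universal_def by (rule someI[of _ "(U, eps)"]) (simp add: is_universal_U)
  then show ?thesis by (simp add: case_prod_beta)
qed

section \<open>Functions vanishing at infinity\<close>

lemma C0D:
  assumes "f \<in> C0 X U"
  shows "continuous_map (subtopology X U) euclidean f" "\<And>x. x \<notin> U \<Longrightarrow> f x = 0"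
    "\<And>e. e > 0 \<Longrightarrow> compactin (subtopology X U) {x \<in> U. e \<le> cmod (f x)}"
  using assms by (auto simp: C0_def)

text \<open>Superlevel sets are closed in \<open>U\<close> by continuity, so it is enough to cover
  each of them by a compact set.\<close>

lemma C0I:
  assumes U: "U \<subseteq> topspace X" and f: "continuous_map (subtopology X U) euclidean f"
    and zero: "\<And>x. x \<notin> U \<Longrightarrow> f x = 0"
    and D: "\<And>e. e > 0 \<Longrightarrow> \<exists>D. compactin (subtopology X U) D \<and> {x \<in> U. e \<le> cmod (f x)} \<subseteq> D"
  shows "f \<in> C0 X U"
  unfolding C0_def
proof (intro CollectI conjI allI impI)
  fix e :: real assume "e > 0"
  then obtain D where "compactin (subtopology X U) D" "{x \<in> U. e \<le> cmod (f x)} \<subseteq> D" using D by blast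
  moreover have "closedin (subtopology X U) {x \<in> topspace (subtopology X U). f x \<in> {z. e \<le> cmod z}}"
    by (rule closedin_continuous_map_preimage[OF f]) (simp add: closed_Collect_le continuous_on_norm_id)
  then have "closedin (subtopology X U) {x \<in> U. e \<le> cmod (f x)}"
    using U by (simp add: Int_absorb1)
  ultimately show "compactin (subtopology X U) {x \<in> U. e \<le> cmod (f x)}"
    by (meson closed_compactin)
qed (use f zero in auto)

lemma C0_bounded:
  assumes "f \<in> C0 X U"
  shows "\<exists>M\<ge>0. \<forall>x. cmod (f x) \<le> M"
proof -
  let ?D = "{x \<in> U. 1 \<le> cmod (f x)}"
  have "compactin euclidean (f ` ?D)"
    by (rule image_compactin[OF C0D(3)[OF assms] C0D(1)[OF assms]]) simp
  then obtain M where M: "\<forall>z\<in>f ` ?D. cmod z \<le> M"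
    using compact_imp_bounded bounded_iff by (metis compactin_euclidean_iff)
  have "cmod (f x) \<le> max 1 M" for x
    using M C0D(2)[OF assms, of x] by (cases "x \<in> ?D") (auto simp: le_max_iff_disj)
  then show ?thesis by (intro exI[of _ "max 1 M"]) simp
qed

text \<open>Continuity of the extension by zero is the point. An open set missing 0 has its preimage
  inside \<open>U\<close>. If it contains a ball of radius \<open>e\<close> about 0, the complement
  of the preimage is a relatively closed part of the compact set where \<open>f\<close> has modulus
  at least \<open>e\<close>; it is compact, and therefore closed in the Hausdorff space
  \<open>X\<close>.\<close>

lemma C0_topspace:
  assumes X: "Hausdorff_space X" and U: "openin X U" and f: "f \<in> C0 X U"
  shows "f \<in> C0 X (topspace X)"
proof (rule C0I)
  have US: "U \<subseteq> topspace X" using U by (rule openin_subset)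
  have cpt: "compactin X {x \<in> U. e \<le> cmod (f x)}" if "e > 0" for e
    using C0D(3)[OF f that] by (simp add: compactin_subtopology)
  show "\<exists>D. compactin (subtopology X (topspace X)) D \<and> {x \<in> topspace X. e \<le> cmod (f x)} \<subseteq> D"
    if "e > 0" for e
    using cpt[OF that] C0D(2)[OF f] that by (intro exI[of _ "{x \<in> U. e \<le> cmod (f x)}"]) force
  show "f x = 0" if "x \<notin> topspace X" for x using C0D(2)[OF f] US that by blast
  have "openin X {x \<in> topspace X. f x \<in> W}" if W: "open W" for W
  proof (cases "0 \<in> W")
    case False
    have "openin (subtopology X U) {x \<in> topspace (subtopology X U). f x \<in> W}"
      using C0D(1)[OF f] W by (intro openin_continuous_map_preimage) auto
    moreover have "{x \<in> topspace (subtopology X U). f x \<in> W} = {x \<in> topspace X. f x \<in> W}"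
      using False C0D(2)[OF f] US by auto metis
    ultimately show ?thesis using U openin_trans_full by fastforce
  next
    case True
    then obtain e where e: "e > 0" "ball 0 e \<subseteq> W" using W openE by blast
    have "closedin (subtopology X U) {x \<in> topspace (subtopology X U). f x \<in> - W}"
      using C0D(1)[OF f] W by (intro closedin_continuous_map_preimage) auto
    moreover have "{x \<in> topspace (subtopology X U). f x \<in> - W} \<subseteq> {x \<in> U. e \<le> cmod (f x)}"
      using e by force
    ultimately have "compactin (subtopology X U) {x \<in> topspace (subtopology X U). f x \<in> - W}"
      using C0D(3)[OF f e(1)] closed_compactin by blast
    then have "compactin X {x \<in> topspace (subtopology X U). f x \<in> - W}"
      by (simp add: compactin_subtopology)
    then have "closedin X {x \<in> topspace (subtopology X U). f x \<in> - W}"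
      using X compactin_imp_closedin by blast
    moreover have "topspace X - {x \<in> topspace (subtopology X U). f x \<in> - W} = {x \<in> topspace X. f x \<in> W}"
      using True C0D(2)[OF f] US by auto metis
    ultimately show ?thesis by (metis openin_diff openin_topspace)
  qed
  then show "continuous_map (subtopology X (topspace X)) euclidean f"
    by (simp add: continuous_map_def)
qed simp

lemma C0_add:
  assumes U: "U \<subseteq> topspace X" and f: "f \<in> C0 X U" and g: "g \<in> C0 X U"
  shows "(\<lambda>x. f x + g x) \<in> C0 X U"
proof (rule C0I[OF U])
  show "continuous_map (subtopology X U) euclidean (\<lambda>x. f x + g x)"
    using C0D(1)[OF f] C0D(1)[OF g] by (rule continuous_map_add)
  show "f x + g x = 0" if "x \<notin> U" for x using that C0D(2)[OF f] C0D(2)[OF g] by simp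
  fix e :: real assume e: "e > 0"
  have "{x \<in> U. e \<le> cmod (f x + g x)} \<subseteq> {x \<in> U. e / 2 \<le> cmod (f x)} \<union> {x \<in> U. e / 2 \<le> cmod (g x)}"
  proof
    fix x assume "x \<in> {x \<in> U. e \<le> cmod (f x + g x)}"
    then show "x \<in> {x \<in> U. e / 2 \<le> cmod (f x)} \<union> {x \<in> U. e / 2 \<le> cmod (g x)}"
      using norm_triangle_ineq[of "f x" "g x"] by auto
  qed
  then show "\<exists>D. compactin (subtopology X U) D \<and> {x \<in> U. e \<le> cmod (f x + g x)} \<subseteq> D"
    using C0D(3)[OF f] C0D(3)[OF g] e by (meson compactin_Un half_gt_zero)
qed

lemma C0_cnj:
  assumes U: "U \<subseteq> topspace X" and f: "f \<in> C0 X U"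
  shows "(\<lambda>x. cnj (f x)) \<in> C0 X U"
proof (rule C0I[OF U])
  have "continuous_map (subtopology X U) euclidean (cnj \<circ> f)"
    by (rule continuous_map_compose[OF C0D(1)[OF f]]) (simp add: continuous_on_cnj)
  then show "continuous_map (subtopology X U) euclidean (\<lambda>x. cnj (f x))" by (simp add: o_def)
qed (use C0D[OF f] in auto)

lemma C0_mult:
  assumes U: "U \<subseteq> topspace X" and f: "continuous_map (subtopology X U) euclidean f"
    and M: "\<And>x. cmod (f x) \<le> M" and g: "g \<in> C0 X U"
  shows "(\<lambda>x. f x * g x) \<in> C0 X U"
proof (rule C0I[OF U])
  show "continuous_map (subtopology X U) euclidean (\<lambda>x. f x * g x)"
  proof -
    have "continuous_map (subtopology X U) (prod_topology euclidean euclidean) (\<lambda>x. (f x, g x))"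
      using f C0D(1)[OF g] by (rule continuous_map_pairedI)
    then have "continuous_map (subtopology X U) euclidean (\<lambda>x. (f x, g x))" by simp
    then have "continuous_map (subtopology X U) euclidean ((\<lambda>z. fst z * snd z) \<circ> (\<lambda>x. (f x, g x)))"
      by (rule continuous_map_compose) (simp add: continuous_intros)
    then show ?thesis by (simp add: o_def)
  qed
  show "f x * g x = 0" if "x \<notin> U" for x using that C0D(2)[OF g] by simp
  have "0 \<le> M" using M[of undefined] norm_ge_zero order_trans by blast
  fix e :: real assume e: "e > 0"
  \<comment> \<open>Dividing by \<open>M + 1\<close> stays legitimate when \<open>M\<close> is
    zero.\<close>
  have "{x \<in> U. e \<le> cmod (f x * g x)} \<subseteq> {x \<in> U. e / (M + 1) \<le> cmod (g x)}"
  proof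
    fix x assume x: "x \<in> {x \<in> U. e \<le> cmod (f x * g x)}"
    have "cmod (f x * g x) \<le> (M + 1) * cmod (g x)"
      using M[of x] by (auto simp: norm_mult intro!: mult_right_mono)
    then show "x \<in> {x \<in> U. e / (M + 1) \<le> cmod (g x)}"
      using x \<open>0 \<le> M\<close> by (auto simp: divide_le_eq mult.commute)
  qed
  then show "\<exists>D. compactin (subtopology X U) D \<and> {x \<in> U. e \<le> cmod (f x * g x)} \<subseteq> D"
    using C0D(3)[OF g, of "e / (M + 1)"] e \<open>0 \<le> M\<close> by auto
qed

lemma C0_mult_C0:
  assumes U: "U \<subseteq> topspace X" and f: "f \<in> C0 X (topspace X)" and g: "g \<in> C0 X U"
  shows "(\<lambda>x. f x * g x) \<in> C0 X U"
proof -
  obtain M where "\<And>x. cmod (f x) \<le> M" using C0_bounded[OF f] by blast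
  moreover have "continuous_map (subtopology X U) euclidean f"
    using C0D(1)[OF f] by (simp add: continuous_map_from_subtopology)
  ultimately show ?thesis using C0_mult[OF U _ _ g] by blast
qed

lemma C0_scale:
  assumes U: "U \<subseteq> topspace X" and f: "f \<in> C0 X U"
  shows "(\<lambda>x. c * f x) \<in> C0 X U"
  using C0_mult[OF U _ _ f, of "\<lambda>x. c" "cmod c"] by simp

text \<open>\<open>g\<close> is one minus a Urysohn function separating \<open>C\<close> from the
  complement of \<open>U\<close>. It vanishes at infinity because its superlevel sets are closed in
  \<open>X\<close> and contained in the compact closure of \<open>U\<close>.\<close>

lemma C0_cutoff:
  assumes X: "locally_compact_space X" "Hausdorff_space X"
    and U: "openin X U" "compactin X (X closure_of U)" and C: "compactin X C" "C \<subseteq> U"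
  shows "\<exists>g\<in>C0 X U. \<forall>x\<in>C. g x = 1"
proof -
  have "completely_regular_space X"
    using X locally_compact_regular_imp_completely_regular_space by blast
  moreover have "closedin X (topspace X - U)" using U by blast
  moreover have "disjnt (topspace X - U) C" using C by (auto simp: disjnt_def)
  ultimately obtain k :: "'a \<Rightarrow> real" where k: "continuous_map X (top_of_set {0..1}) k"
    "k ` C \<subseteq> {0}" "k ` (topspace X - U) \<subseteq> {1}"
    using Urysohn_completely_regular_closed_compact[of 0 1 X "topspace X - U" C] C by force
  define g where "g x = (if x \<in> topspace X then complex_of_real (1 - k x) else 0)" for x
  have US: "U \<subseteq> topspace X" using U(1) by (rule openin_subset)
  have kc: "continuous_map X euclideanreal k" using k(1) continuous_map_into_fulltopology by blast
  have "continuous_map X euclidean ((\<lambda>r. complex_of_real (1 - r)) \<circ> k)"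
    by (rule continuous_map_compose[OF kc]) (simp add: continuous_intros)
  then have g: "continuous_map X euclidean g"
    by (rule continuous_map_eq) (simp add: g_def)
  have "g \<in> C0 X U"
  proof (rule C0I[OF US])
    show "continuous_map (subtopology X U) euclidean g" using g by (rule continuous_map_from_subtopology)
    show zero: "g x = 0" if "x \<notin> U" for x using k(3) that by (force simp: g_def)
    fix e :: real assume e: "e > 0"
    have "closedin X {x \<in> topspace X. g x \<in> {z. e \<le> cmod z}}"
      by (rule closedin_continuous_map_preimage[OF g]) (simp add: closed_Collect_le continuous_on_norm_id)
    moreover have eq: "{x \<in> topspace X. g x \<in> {z. e \<le> cmod z}} = {x \<in> U. e \<le> cmod (g x)}"
      using zero e US by force
    moreover have "{x \<in> U. e \<le> cmod (g x)} \<subseteq> X closure_of U"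
      using closure_of_subset[OF US] by blast
    ultimately have "compactin X {x \<in> U. e \<le> cmod (g x)}"
      by (intro closed_compactin[OF U(2)]) (simp_all only:)
    then show "\<exists>D. compactin (subtopology X U) D \<and> {x \<in> U. e \<le> cmod (g x)} \<subseteq> D"
      by (intro exI[of _ "{x \<in> U. e \<le> cmod (g x)}"]) (auto simp: compactin_subtopology)
  qed
  moreover have "g x = 1" if "x \<in> C" for x
    using k(2) that C(2) US by (auto simp: g_def)
  ultimately show ?thesis by blast
qed

section \<open>The algebra of a net is a C0(X)-algebra\<close>

text \<open>\<open>nested\<close> provides the pair chosen in \<open>tau_choice\<close>. Relative
  compactness alone only covers the closure of a member by finitely many members of the base, not by
  a single one.\<close>

locale space_base =
  fixes X :: "'x topology" and K :: "'x set set"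
  assumes lc: "locally_compact_space X" and haus: "Hausdorff_space X" and base: "rel_compact_base X K"
    and nested: "\<forall>Y\<in>K. \<exists>U\<in>K. X closure_of Y \<subseteq> U"
begin

lemma K_open: "Y \<in> K \<Longrightarrow> openin X Y"
  using base by (simp add: rel_compact_base_def arbitrary_union_of_inc)

lemma K_sub: "Y \<in> K \<Longrightarrow> Y \<subseteq> topspace X"
  using K_open openin_subset by blast

lemma tau_choice_props:
  assumes Y: "Y \<in> K" and Ug: "tau_choice X K Y = (U, g)"
  shows "U \<in> K" "X closure_of Y \<subseteq> U" "Y \<subseteq> U" "g \<in> C0 X U" "\<And>x. x \<in> Y \<Longrightarrow> g x = 1"
proof -
  have cpt: "compactin X (X closure_of Z)" if "Z \<in> K" for Z
    using base that by (simp add: rel_compact_base_def)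
  have sub: "Y \<subseteq> X closure_of Y" using closure_of_subset[OF K_sub[OF Y]] .
  obtain V where V: "V \<in> K" "X closure_of Y \<subseteq> V" using nested Y by blast
  \<comment> \<open>The cut-off is made equal to 1 on the compact closure of \<open>Y\<close>, more
    than the choice demands, since separation is available for compact sets.\<close>
  obtain k where "k \<in> C0 X V" "\<forall>x\<in>X closure_of Y. k x = 1"
    using C0_cutoff[OF lc haus K_open[OF V(1)] cpt[OF V(1)] cpt[OF Y] V(2)] by blast
  then have "\<exists>p. case p of (U, g) \<Rightarrow> U \<in> K \<and> X closure_of Y \<subseteq> U \<and> g \<in> C0 X U \<and> (\<forall>x\<in>Y. g x = 1)"
    using V sub by (intro exI[of _ "(V, k)"]) auto
  from someI_ex[OF this]
  have "U \<in> K \<and> X closure_of Y \<subseteq> U \<and> g \<in> C0 X U \<and> (\<forall>x\<in>Y. g x = 1)"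
    using Ug unfolding tau_choice_def by simp
  then show "U \<in> K" "X closure_of Y \<subseteq> U" "Y \<subseteq> U" "g \<in> C0 X U" "\<And>x. x \<in> Y \<Longrightarrow> g x = 1"
    using sub by auto
qed

abbreviation "C0X \<equiv> C0 X (topspace X)"

lemma C0_in_C0X: "openin X U \<Longrightarrow> f \<in> C0 X U \<Longrightarrow> f \<in> C0X"
  by (rule C0_topspace[OF haus])

end

section \<open>Bounded fields and their multiplication by functions\<close>

locale net_over_base = space_base X K for X :: "'x topology" and K :: "'x set set" +
  fixes \<A> :: "('x, 'a) net"
  assumes net: "is_net K \<A>"
begin

abbreviation "pt \<equiv> point_calg K \<A>"
abbreviation "ev \<equiv> point_eps K \<A>"
abbreviation "fa \<equiv> field_act X K \<A>"
abbreviation "hat \<equiv> eps_hat X K \<A>"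

lemma net_at: "is_net {Y \<in> K. x \<in> Y} \<A>"
  using net by (rule is_net_subset) blast

lemma point_universal: "is_universal {Y \<in> K. x \<in> Y} \<A> (pt x) (ev x)"
  unfolding point_calg_def point_eps_def by (rule is_universal_universal[OF net_at])

lemma pt_cstar: "cstar_algebra (pt x)"
  using point_universal[of x] by (simp add: is_universal_def)

lemma ev_morphism: "net_morphism {Y \<in> K. x \<in> Y} \<A> (const_net (pt x)) (ev x)"
  using point_universal[of x] by (simp add: is_universal_def)

lemma ev_hom: "Y \<in> K \<Longrightarrow> x \<in> Y \<Longrightarrow> cstar_hom (fib \<A> Y) (pt x) (ev x Y)"
  using ev_morphism[of x] by (simp add: net_morphism_const_iff[OF net_at])

lemma ev_incl:
  assumes "Y \<in> K" "Y' \<in> K" "Y \<subseteq> Y'" "x \<in> Y" "t \<in> carrier (fib \<A> Y)"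
  shows "ev x Y' (incl \<A> Y' Y t) = ev x Y t"
  using ev_morphism[of x] assms unfolding net_morphism_const_iff[OF net_at] by blast

sublocale cstar_family "topspace X" pt
  by (rule cstar_family.intro) (rule pt_cstar)

sublocale P: cstar_algebra P
  by (rule cstar_product)

text \<open>The maps into the fibres are contractive, so the norm of \<open>t\<close> bounds the
  field at all points simultaneously.\<close>

lemma hat_closed:
  assumes Y: "Y \<in> K" and t: "t \<in> carrier (fib \<A> Y)"
  shows "hat Y t \<in> carrier P"
proof (rule product_memI[where M = "cnorm (fib \<A> Y) t"])
  note Yc = is_netD(1)[OF net Y]
  fix x assume "x \<in> topspace X"
  then show "hat Y t x \<in> carrier (pt x)"
    using cstar_homD(1)[OF ev_hom[OF Y]] t cstar_algebra.zero_closed[OF pt_cstar] by (simp add: eps_hat_def)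
  show "cnorm (pt x) (hat Y t x) \<le> cnorm (fib \<A> Y) t"
    using cstar_hom_contractive[OF Yc pt_cstar ev_hom[OF Y] t] cstar_algebra.norm_nonneg[OF Yc t]
      cstar_algebra.norm_zero[OF pt_cstar] \<open>x \<in> topspace X\<close> by (simp add: eps_hat_def)
qed (simp add: eps_hat_def)

lemma fa_ext: "fa f v \<in> extensional (topspace X)"
  by (simp add: field_act_def)

lemma fa_apply: "x \<in> topspace X \<Longrightarrow> fa f v x = f x \<odot>\<^bsub>pt x\<^esub> v x"
  by (simp add: field_act_def)

lemma fa_bounded:
  assumes v: "v \<in> carrier P" and M: "\<And>x. cmod (f x) \<le> M"
  shows "fa f v \<in> carrier P" and "cnorm P (fa f v) \<le> M * cnorm P v"
proof -
  have M0: "0 \<le> M" using M[of undefined] norm_ge_zero order_trans by blast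
  have le: "cnorm (pt x) (fa f v x) \<le> M * cnorm P v" if x: "x \<in> topspace X" for x
  proof -
    have vx: "v x \<in> carrier (pt x)" using v x by (rule product_memD)
    then have "cnorm (pt x) (fa f v x) = cmod (f x) * cnorm (pt x) (v x)"
      by (simp add: fa_apply x cstar_algebra.norm_scale[OF pt_cstar])
    also have "\<dots> \<le> M * cnorm P v"
      by (intro mult_mono M norm_le_product v x M0 cstar_algebra.norm_nonneg[OF pt_cstar] vx)
    finally show ?thesis .
  qed
  then show "fa f v \<in> carrier P"
    using v by (intro product_memI[where M = "M * cnorm P v"] fa_ext)
      (auto simp: fa_apply product_memD cstar_algebra.closed[OF pt_cstar])
  show "cnorm P (fa f v) \<le> M * cnorm P v"
    using le M0 product_norm_nonneg[OF v] by (intro product_norm_le) auto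
qed

lemma fa_closed: "f \<in> C0X \<Longrightarrow> v \<in> carrier P \<Longrightarrow> fa f v \<in> carrier P"
  using C0_bounded[of f] fa_bounded(1)[of v f] by blast

lemma fa_add: "v \<in> carrier P \<Longrightarrow> w \<in> carrier P \<Longrightarrow> fa f (cadd P v w) = cadd P (fa f v) (fa f w)"
  by (rule product_eqI)
    (auto simp: fa_ext product_ext fa_apply product_apply product_memD cstar_algebra.scale_add_right[OF pt_cstar])

lemma fa_scale: "v \<in> carrier P \<Longrightarrow> fa f (cscale P c v) = cscale P c (fa f v)"
  by (rule product_eqI)
    (auto simp: fa_ext product_ext fa_apply product_apply product_memD mult.commute
      cstar_algebra.scale_scale[OF pt_cstar, symmetric])

lemma fa_mult_left: "v \<in> carrier P \<Longrightarrow> w \<in> carrier P \<Longrightarrow> fa f (cmult P v w) = cmult P (fa f v) w"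
  by (rule product_eqI)
    (auto simp: fa_ext product_ext fa_apply product_apply product_memD cstar_algebra.scale_mult_left[OF pt_cstar])

lemma fa_mult_right: "v \<in> carrier P \<Longrightarrow> w \<in> carrier P \<Longrightarrow> fa f (cmult P v w) = cmult P v (fa f w)"
  by (rule product_eqI)
    (auto simp: fa_ext product_ext fa_apply product_apply product_memD cstar_algebra.scale_mult_right[OF pt_cstar])

lemma fa_star: "v \<in> carrier P \<Longrightarrow> fa f (cstar P v) = cstar P (fa (\<lambda>x. cnj (f x)) v)"
  by (rule product_eqI)
    (auto simp: fa_ext product_ext fa_apply product_apply product_memD cstar_algebra.star_scale[OF pt_cstar])

lemma fa_zero: "fa f (czero P) = czero P"
  by (rule product_eqI)
    (auto simp: fa_ext product_ext fa_apply product_apply cstar_algebra.scale_zero[OF pt_cstar])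

lemma fa_add_fun: "v \<in> carrier P \<Longrightarrow> fa (\<lambda>x. f x + g x) v = cadd P (fa f v) (fa g v)"
  by (rule product_eqI)
    (auto simp: fa_ext product_ext fa_apply product_apply product_memD cstar_algebra.scale_add_left[OF pt_cstar])

lemma fa_scale_fun: "v \<in> carrier P \<Longrightarrow> fa (\<lambda>x. c * f x) v = cscale P c (fa f v)"
  by (rule product_eqI)
    (auto simp: fa_ext product_ext fa_apply product_apply product_memD cstar_algebra.scale_scale[OF pt_cstar])

lemma fa_mult_fun: "v \<in> carrier P \<Longrightarrow> fa (\<lambda>x. f x * g x) v = fa f (fa g v)"
  by (rule product_eqI)
    (auto simp: fa_ext product_ext fa_apply product_apply product_memD cstar_algebra.scale_scale[OF pt_cstar])

lemma fa_commute: "v \<in> carrier P \<Longrightarrow> fa f (fa g v) = fa g (fa f v)"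
  by (simp add: fa_mult_fun[symmetric] mult.commute)

definition gens where
  "gens = {fa f (hat Y t) | f Y t. Y \<in> K \<and> f \<in> C0 X Y \<and> t \<in> carrier (fib \<A> Y)}"

lemma gensI: "Y \<in> K \<Longrightarrow> f \<in> C0 X Y \<Longrightarrow> t \<in> carrier (fib \<A> Y) \<Longrightarrow> fa f (hat Y t) \<in> gens"
  unfolding gens_def by blast

lemma gens_sub: "gens \<subseteq> carrier P"
  unfolding gens_def using fa_closed[OF C0_in_C0X[OF K_open] hat_closed] by blast

abbreviation "N \<equiv> gen_calg P gens"

lemma net_calg_eq: "net_calg X K \<A> = N"
  by (simp add: net_calg_def gen_calg_def field_calg_def gens_def)

sublocale N: cstar_algebra N
  by (rule P.gen_calg_cstar[OF gens_sub])

lemma N_sub: "v \<in> carrier N \<Longrightarrow> v \<in> carrier P"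
  using P.gen_calg_sub by auto

lemma gens_N: "g \<in> gens \<Longrightarrow> g \<in> carrier N"
  using P.gen_sub_gen_calg[OF gens_sub] by auto

text \<open>The function is quantified inside \<open>Q\<close>: taking adjoints replaces it by its
  conjugate, so a set built from a single function would not be stable under the involution. On a
  generator the product of the two functions lies again in \<open>C0 X Y\<close>.\<close>

lemma fa_N:
  assumes f: "f \<in> C0X" and v: "v \<in> carrier N"
  shows "fa f v \<in> carrier N"
proof -
  define Q where "Q = {v \<in> carrier N. \<forall>f\<in>C0X. fa f v \<in> carrier N}"
  have "norm_closure P (star_span P gens) \<subseteq> Q"
  proof (rule P.gen_calg_least)
    show "gens \<subseteq> Q"
    proof
      fix g assume g: "g \<in> gens"
      then obtain h Y t where h: "g = fa h (hat Y t)" "Y \<in> K" "h \<in> C0 X Y" "t \<in> carrier (fib \<A> Y)"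
        unfolding gens_def by blast
      have "fa f g \<in> carrier N" if "f \<in> C0X" for f
        using h that C0_mult_C0[OF K_sub that, of Y h] gens_N[OF gensI]
        by (simp add: fa_mult_fun[symmetric] hat_closed del: gen_calg_simps)
      then show "g \<in> Q" using g gens_N unfolding Q_def by blast
    qed
    show "norm_closure P Q \<subseteq> Q"
    proof
      fix a assume a: "a \<in> norm_closure P Q"
      then have aP: "a \<in> carrier P" using P.in_norm_closure by blast
      have "a \<in> norm_closure P (carrier N)"
        using a P.norm_closure_mono[of Q "carrier N"] unfolding Q_def by blast
      then have aN: "a \<in> carrier N" by (simp add: P.norm_closure_idem)
      have "fa f a \<in> carrier N" if f: "f \<in> C0X" for f
      proof -
        obtain M where M: "0 \<le> M" "\<And>x. cmod (f x) \<le> M" using C0_bounded[OF f] by blast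
        have "fa f a \<in> norm_closure P (carrier N)"
        proof (rule P.norm_closureI[OF a fa_closed[OF f aP] M(1), where f = "fa f"])
          fix s assume s: "s \<in> Q" "s \<in> carrier P"
          then show "fa f s \<in> carrier N \<and> fa f s \<in> carrier P" using f unfolding Q_def using fa_closed by blast
          have "fa f a \<ominus>\<^bsub>P\<^esub> fa f s = fa f (a \<ominus>\<^bsub>P\<^esub> s)"
            using s aP by (simp add: fa_add fa_scale P.closed)
          then show "cnorm P (fa f a \<ominus>\<^bsub>P\<^esub> fa f s) \<le> M * cnorm P (a \<ominus>\<^bsub>P\<^esub> s)"
            using fa_bounded(2)[OF _ M(2), of "a \<ominus>\<^bsub>P\<^esub> s"] s aP by (simp add: P.closed)
        qed
        then show ?thesis by (simp add: P.norm_closure_idem)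
      qed
      then show "a \<in> Q" using aN unfolding Q_def by blast
    qed
  next
    fix a b c
    assume a: "a \<in> Q"
    then have aN: "a \<in> carrier N" and aP: "a \<in> carrier P" using N_sub unfolding Q_def by blast+
    show "cscale P c a \<in> Q" "cstar P a \<in> Q"
      using a N.closed aN C0_cnj[of "topspace X" X] by (auto simp: Q_def fa_scale[OF aP] fa_star[OF aP])
    assume b: "b \<in> Q"
    then have bN: "b \<in> carrier N" and bP: "b \<in> carrier P" using N_sub unfolding Q_def by blast+
    show "cadd P a b \<in> Q" "cmult P a b \<in> Q"
      using a b N.closed aN bN by (auto simp: Q_def fa_add[OF aP bP] fa_mult_left[OF aP bP])
  qed (use N.zero_closed in \<open>simp add: Q_def fa_zero\<close>)
  then show ?thesis using f v by (auto simp: Q_def)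
qed

end

lemma C0_calg_simps [simp]:
  "carrier (C0_calg X) = C0 X (topspace X)"
  "cadd (C0_calg X) f g = (\<lambda>x. f x + g x)" "cscale (C0_calg X) c f = (\<lambda>x. c * f x)"
  "cmult (C0_calg X) f g = (\<lambda>x. f x * g x)" "cstar (C0_calg X) f = (\<lambda>x. cnj (f x))"
  by (simp_all add: C0_calg_def)

lemma multiplier_memD:
  assumes "(L, R) \<in> carrier (multiplier_calg A)"
  shows "\<And>a. a \<in> carrier A \<Longrightarrow> L a \<in> carrier A" "\<And>a. a \<in> carrier A \<Longrightarrow> R a \<in> carrier A"
    "L \<in> extensional (carrier A)" "R \<in> extensional (carrier A)"
    "\<And>a b. a \<in> carrier A \<Longrightarrow> b \<in> carrier A \<Longrightarrow> L (a \<otimes>\<^bsub>A\<^esub> b) = L a \<otimes>\<^bsub>A\<^esub> b"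
    "\<And>a b. a \<in> carrier A \<Longrightarrow> b \<in> carrier A \<Longrightarrow> R (a \<otimes>\<^bsub>A\<^esub> b) = a \<otimes>\<^bsub>A\<^esub> R b"
    "\<And>a b. a \<in> carrier A \<Longrightarrow> b \<in> carrier A \<Longrightarrow> R a \<otimes>\<^bsub>A\<^esub> b = a \<otimes>\<^bsub>A\<^esub> L b"
  using assms by (auto simp: multiplier_calg_def bounded_lin_def PiE_iff)

text \<open>If \<open>T\<close> commutes with left and right multiplications, then for an arbitrary double centralizer
  \<open>b (L (T a)) = (R b) (T a) = T ((R b) a) = b (T (L a))\<close>, and \<open>b\<close> may be cancelled.\<close>

lemma (in cstar_algebra) central_multiplier:
  assumes T: "(T, T) \<in> carrier (multiplier_calg A)"
  shows "(T, T) \<in> center (multiplier_calg A)"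
  unfolding center_def
proof (intro CollectI conjI ballI)
  fix m assume "m \<in> carrier (multiplier_calg A)"
  then obtain L R where m: "m = (L, R)" and LR: "(L, R) \<in> carrier (multiplier_calg A)"
    by (cases m) simp
  note T = multiplier_memD[OF T] and LR = multiplier_memD[OF LR]
  have "L (T a) = T (L a)" if a: "a \<in> carrier A" for a
  proof (rule eq_if_mult_eq)
    fix b assume b: "b \<in> carrier A"
    have "b \<otimes> L (T a) = R b \<otimes> T a" using LR(7) b a T(1) by simp
    also have "\<dots> = T (R b \<otimes> a)" using T(6) LR(2) a b by simp
    also have "\<dots> = T (b \<otimes> L a)" using LR(7) a b by simp
    also have "\<dots> = b \<otimes> T (L a)" using T(6) LR(1) a b by simp
    finally show "b \<otimes> L (T a) = b \<otimes> T (L a)" .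
  qed (use a T LR in auto)
  moreover have "R (T a) = T (R a)" if a: "a \<in> carrier A" for a
  proof (rule eq_if_eq_mult)
    fix b assume b: "b \<in> carrier A"
    have "R (T a) \<otimes> b = T a \<otimes> L b" using LR(7) b a T(1) by simp
    also have "\<dots> = T (a \<otimes> L b)" using T(5) LR(1) a b by simp
    also have "\<dots> = T (R a \<otimes> b)" using LR(7) a b by simp
    also have "\<dots> = T (R a) \<otimes> b" using T(5) LR(2) a b by simp
    finally show "R (T a) \<otimes> b = T (R a) \<otimes> b" .
  qed (use a T LR in auto)
  ultimately have "compose (carrier A) T L = compose (carrier A) L T"
    "compose (carrier A) R T = compose (carrier A) T R"
    by (auto simp: compose_def intro!: restrict_ext)
  then show "(T, T) \<otimes>\<^bsub>multiplier_calg A\<^esub> m = m \<otimes>\<^bsub>multiplier_calg A\<^esub> (T, T)"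
    by (simp add: multiplier_calg_def m)
qed (rule T)

section \<open>The structure map and nondegeneracy\<close>

context net_over_base
begin

abbreviation "\<N> \<equiv> net_c0alg X K \<A>"
abbreviation "LL f \<equiv> \<lambda>v\<in>carrier N. fa f v"

lemma alg_eq: "alg \<N> = N"
  by (simp add: net_c0alg_def net_calg_eq)

lemma struct_eq: "struct \<N> = (\<lambda>f\<in>C0X. (LL f, LL f))"
  by (simp add: net_c0alg_def net_calg_eq Let_def)

lemma act_eq: "f \<in> C0X \<Longrightarrow> v \<in> carrier N \<Longrightarrow> act \<N> f v = fa f v"
  by (simp add: act_def struct_eq)

lemma struct_multiplier:
  assumes f: "f \<in> C0X"
  shows "(LL f, LL f) \<in> carrier (multiplier_calg N)"
proof -
  obtain M where "\<And>x. cmod (f x) \<le> M" using C0_bounded[OF f] by blast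
  then have "bounded_lin N (LL f)"
    unfolding bounded_lin_def
    using fa_N[OF f] N.closed fa_bounded(2)[OF N_sub, of _ f M]
    by (auto simp: fa_add N_sub fa_scale simp del: gen_calg_simps(1) intro!: exI[of _ M])
  moreover have "LL f (cmult N a b) = cmult N (LL f a) b" "LL f (cmult N a b) = cmult N a (LL f b)"
    "cmult N (LL f a) b = cmult N a (LL f b)" if "a \<in> carrier N" "b \<in> carrier N" for a b
    using that N.mult_closed[OF that] fa_mult_left[of a b f] fa_mult_right[of a b f]
    by (simp_all add: N_sub del: gen_calg_simps(1))
  ultimately show ?thesis by (simp add: multiplier_calg_def del: gen_calg_simps(1))
qed

lemma struct_hom: "cstar_hom (C0_calg X) (multiplier_calg N) (struct \<N>)"
  unfolding struct_eq
proof (rule cstar_homI)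
  fix f g c
  assume "f \<in> carrier (C0_calg X)"
  then have f: "f \<in> C0X" by simp
  then show "(\<lambda>f\<in>C0X. (LL f, LL f)) f \<in> carrier (multiplier_calg N)" using struct_multiplier by simp
  show "(\<lambda>f\<in>C0X. (LL f, LL f)) (cscale (C0_calg X) c f)
      = cscale (multiplier_calg N) c ((\<lambda>f\<in>C0X. (LL f, LL f)) f)"
    using f C0_scale[OF order_refl f]
    by (auto simp: multiplier_calg_def fa_scale_fun N_sub intro!: restrict_ext simp del: gen_calg_simps(1))
  show "(\<lambda>f\<in>C0X. (LL f, LL f)) (cstar (C0_calg X) f)
      = cstar (multiplier_calg N) ((\<lambda>f\<in>C0X. (LL f, LL f)) f)"
    using f C0_cnj[OF order_refl f] N.star_closed
    by (auto simp: multiplier_calg_def fa_star N_sub P.star_star fa_closed C0_cnj[OF order_refl f]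
        intro!: restrict_ext simp del: gen_calg_simps(1))
  assume "g \<in> carrier (C0_calg X)"
  then have g: "g \<in> C0X" by simp
  show "(\<lambda>f\<in>C0X. (LL f, LL f)) (cadd (C0_calg X) f g)
      = cadd (multiplier_calg N) ((\<lambda>f\<in>C0X. (LL f, LL f)) f) ((\<lambda>f\<in>C0X. (LL f, LL f)) g)"
    using f g C0_add[OF order_refl f g]
    by (auto simp: multiplier_calg_def fa_add_fun N_sub intro!: restrict_ext simp del: gen_calg_simps(1))
  \<comment> \<open>Both orders are required because right centralizers are composed in the reverse
    order.\<close>
  have "fa (\<lambda>x. f x * g x) a = fa f (fa g a)" "fa (\<lambda>x. f x * g x) a = fa g (fa f a)"
    if "a \<in> carrier N" for a
    using that fa_commute[of a f g] by (simp_all add: fa_mult_fun N_sub del: gen_calg_simps(1))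
  then show "(\<lambda>f\<in>C0X. (LL f, LL f)) (cmult (C0_calg X) f g)
      = cmult (multiplier_calg N) ((\<lambda>f\<in>C0X. (LL f, LL f)) f) ((\<lambda>f\<in>C0X. (LL f, LL f)) g)"
    using f g C0_mult_C0[OF order_refl f g] fa_N
    by (auto simp: multiplier_calg_def compose_def intro!: restrict_ext simp del: gen_calg_simps(1))
qed simp

text \<open>Off \<open>Y\<close> both sides vanish with \<open>f\<close>. On \<open>Y\<close> the
  cut-off is 1, and compatibility of the canonical maps with the inclusions identifies the two field
  values.\<close>

lemma cutoff_hat:
  assumes Y: "Y \<in> K" "tau_choice X K Y = (U, g)" and f: "\<And>x. x \<notin> Y \<Longrightarrow> f x = 0"
    and t: "t \<in> carrier (fib \<A> Y)"
  shows "fa f (fa g (hat U (incl \<A> U Y t))) = fa f (hat Y t)"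
proof (rule product_eqI)
  note Ug = tau_choice_props[OF Y]
  have tU: "incl \<A> U Y t \<in> carrier (fib \<A> U)"
    using is_netD(2)[OF net Y(1) Ug(1,3)] t by (rule cstar_homD(1))
  fix x assume x: "x \<in> topspace X"
  have c: "hat U (incl \<A> U Y t) x \<in> carrier (pt x)" "hat Y t x \<in> carrier (pt x)"
    using hat_closed[OF Ug(1) tU] hat_closed[OF Y(1) t] product_memD(2) x by blast+
  show "fa f (fa g (hat U (incl \<A> U Y t))) x = fa f (hat Y t) x"
  proof (cases "x \<in> Y")
    case True
    then have "x \<in> U" using Ug(3) by blast
    then have "hat U (incl \<A> U Y t) x = hat Y t x"
      using ev_incl[OF Y(1) Ug(1,3) True t] x True by (simp add: eps_hat_def)
    then show ?thesis using x Ug(5)[OF True] c by (simp add: fa_apply cstar_algebra.scale_one[OF pt_cstar])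
  next
    case False
    then show ?thesis
      using x c f by (simp add: fa_apply cstar_algebra.zero_scale[OF pt_cstar] cstar_algebra.closed[OF pt_cstar])
  qed
qed (simp_all add: fa_ext)

text \<open>This is the substance of nondegeneracy. The field \<open>hat Y t\<close> is in general
  not in \<open>N\<close>, but by \<open>cutoff_hat\<close> it may be replaced under
  \<open>f\<close> by the generator carrying the cut-off \<open>g\<close>, which is. Adjoints, and
  products with elements of \<open>N\<close>, preserve the span of products of functions with
  elements of \<open>N\<close>.\<close>

lemma star_span_gens_lin_span:
  "a \<in> star_span P gens \<Longrightarrow> a \<in> lin_span N {fa f v | f v. f \<in> C0X \<and> v \<in> carrier N}"
proof (induction rule: star_span.induct)
  let ?S = "{fa f v | f v. f \<in> C0X \<and> v \<in> carrier N}"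
  have sub: "a \<in> lin_span N ?S \<Longrightarrow> a \<in> carrier N" for a
  proof (induction rule: lin_span.induct)
    case (gen a)
    then show ?case using fa_N by blast
  qed (use N.closed in auto)
  {
    case zero
    then show ?case using lin_span.zero[of N ?S] by simp
  next
    case (gen a)
    then obtain f Y t where a: "a = fa f (hat Y t)" "Y \<in> K" "f \<in> C0 X Y" "t \<in> carrier (fib \<A> Y)"
      unfolding gens_def by blast
    obtain U g where Ug: "tau_choice X K Y = (U, g)" by fastforce
    note Ug' = tau_choice_props[OF a(2) Ug]
    have tU: "incl \<A> U Y t \<in> carrier (fib \<A> U)"
      using is_netD(2)[OF net a(2) Ug'(1,3)] a(4) by (rule cstar_homD(1))
    have "a = fa f (fa g (hat U (incl \<A> U Y t)))"
      using cutoff_hat[OF a(2) Ug _ a(4)] C0D(2)[OF a(3)] a(1) by simp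
    moreover have "fa g (hat U (incl \<A> U Y t)) \<in> carrier N"
      using gens_N[OF gensI[OF Ug'(1,4) tU]] .
    moreover have "f \<in> C0X" using C0_in_C0X[OF K_open[OF a(2)] a(3)] .
    ultimately have "a \<in> ?S" by blast
    then show ?case by (rule lin_span.gen)
  next
    case (add a b)
    then show ?case using lin_span.add[of a N ?S b] by simp
  next
    case (scale a c)
    then show ?case using lin_span.scale[of a N ?S c] by simp
  next
    case (mult a b)
    have "cmult P a b \<in> lin_span N ?S" if "a \<in> lin_span N ?S" "b \<in> carrier N" for a b
      using that
    proof (induction rule: lin_span.induct)
      case zero
      then show ?case using lin_span.zero[of N ?S] N.zero_mult[of b] by simp
    next
      case (gen a)
      then obtain f v where a: "a = fa f v" "f \<in> C0X" "v \<in> carrier N" by blast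
      have "cmult P a b = fa f (cmult P v b)" using a gen by (simp add: fa_mult_left N_sub)
      moreover have "cmult P v b \<in> carrier N" using N.mult_closed[OF a(3) gen(2)] by simp
      ultimately have "cmult P a b \<in> ?S" using a by blast
      then show ?case by (rule lin_span.gen)
    next
      case (add a c)
      then show ?case using lin_span.add[of "cmult P a b" N ?S "cmult P c b"] sub[of a] sub[of c]
        by (simp add: P.distrib_right N_sub)
    next
      case (scale a c)
      then show ?case using lin_span.scale[of "cmult P a b" N ?S c] sub[of a]
        by (simp add: P.scale_mult_left N_sub)
    qed
    then show ?case using mult sub by blast
  next
    case (star a)
    have "cstar P a \<in> lin_span N ?S" if "a \<in> lin_span N ?S" for a
      using that
    proof (induction rule: lin_span.induct)
      case zero
      then show ?case using lin_span.zero[of N ?S] N.star_zero by simp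
    next
      case (gen a)
      then obtain f v where a: "a = fa f v" "f \<in> C0X" "v \<in> carrier N" by blast
      have "cstar P a = fa (\<lambda>x. cnj (f x)) (cstar P v)" using a by (simp add: fa_star N_sub)
      moreover have "cstar P v \<in> carrier N" using N.star_closed[OF a(3)] by simp
      ultimately have "cstar P a \<in> ?S" using C0_cnj[OF order_refl a(2)] by blast
      then show ?case by (rule lin_span.gen)
    next
      case (add a c)
      then show ?case using lin_span.add[of "cstar P a" N ?S "cstar P c"] sub[of a] sub[of c]
        by (simp add: P.star_add N_sub)
    next
      case (scale a c)
      then show ?case using lin_span.scale[of "cstar P a" N ?S "cnj c"] sub[of a]
        by (simp add: P.star_scale N_sub)
    qed
    then show ?case using star by blast
  }
qed

theorem c0_algebra_net: "c0_algebra X \<N>"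
  unfolding c0_algebra_def alg_eq
proof (intro conjI)
  show "cstar_algebra N" by (rule N.cstar_algebra_axioms)
  show "cstar_hom (C0_calg X) (multiplier_calg N) (struct \<N>)" by (rule struct_hom)
  show "struct \<N> ` carrier (C0_calg X) \<subseteq> center (multiplier_calg N)"
    using N.central_multiplier[OF struct_multiplier] by (auto simp: struct_eq simp del: gen_calg_simps(1))
  have "{act \<N> f v | f v. f \<in> carrier (C0_calg X) \<and> v \<in> carrier N}
      = {fa f v | f v. f \<in> C0X \<and> v \<in> carrier N}"
    by (intro Collect_cong iff_exI) (auto simp: act_eq simp del: gen_calg_simps(1))
  moreover have "norm_closure N (lin_span N {fa f v | f v. f \<in> C0X \<and> v \<in> carrier N}) = carrier N"
  proof
    show "carrier N \<subseteq> norm_closure N (lin_span N {fa f v | f v. f \<in> C0X \<and> v \<in> carrier N})"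
    proof
      fix a assume a: "a \<in> carrier N"
      have span: "s \<in> star_span P gens \<Longrightarrow> s \<in> carrier N" for s
        using P.sub_norm_closure[OF P.star_span_sub[OF gens_sub]] by auto
      have "\<exists>s\<in>lin_span N {fa f v | f v. f \<in> C0X \<and> v \<in> carrier N}.
          s \<in> carrier N \<and> cnorm N (a \<ominus>\<^bsub>N\<^esub> s) < e" if e: "e > 0" for e
      proof -
        obtain s where "s \<in> star_span P gens" "cnorm P (a \<ominus>\<^bsub>P\<^esub> s) < e"
          using a e by (auto simp: P.in_norm_closure)
        then show ?thesis using star_span_gens_lin_span span by (intro bexI[of _ s]) auto
      qed
      then show "a \<in> norm_closure N (lin_span N {fa f v | f v. f \<in> C0X \<and> v \<in> carrier N})"
        using a N.in_norm_closure by blast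
    qed
  qed (rule N.norm_closure_sub)
  ultimately show "norm_closure N (lin_span N {act \<N> f v | f v. f \<in> carrier (C0_calg X) \<and> v \<in> carrier N})
      = carrier N" by simp
qed

end

section \<open>Ideals and the quotients over the members of the base\<close>

context cstar_algebra
begin

lemma closed_ideal_carrier: "closed_ideal A (carrier A)"
proof -
  have "norm_closure A (carrier A) = carrier A"
    using norm_closure_sub sub_norm_closure[OF order_refl] by blast
  then show ?thesis by (simp add: closed_ideal_def closed)
qed

text \<open>The carrier is a closed ideal containing \<open>S\<close>, so the intersection runs over
  a nonempty family; its closure lies in every member by monotonicity.\<close>

lemma closed_ideal_gen:
  assumes "S \<subseteq> carrier A"
  shows "closed_ideal A (ideal_gen A S)" "S \<subseteq> ideal_gen A S"
proof -
  have sub: "ideal_gen A S \<subseteq> carrier A"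
    using closed_ideal_carrier assms by (auto simp: ideal_gen_def)
  have "norm_closure A (ideal_gen A S) \<subseteq> I" if I: "closed_ideal A I" "S \<subseteq> I" for I
    using norm_closure_mono[of "ideal_gen A S" I] I by (auto simp: ideal_gen_def closed_ideal_def)
  then have eq: "norm_closure A (ideal_gen A S) = ideal_gen A S"
    using sub_norm_closure[OF sub] unfolding ideal_gen_def by blast
  show "closed_ideal A (ideal_gen A S)"
    unfolding closed_ideal_def
  proof (intro conjI sub eq ballI allI)
    fix a b c
    assume a: "a \<in> ideal_gen A S"
    show "c \<odot> a \<in> ideal_gen A S" using a unfolding ideal_gen_def closed_ideal_def by blast
    show "a \<oplus> b \<in> ideal_gen A S" if "b \<in> ideal_gen A S"
      using a that unfolding ideal_gen_def closed_ideal_def by blast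
    show "a \<otimes> b \<in> ideal_gen A S" "b \<otimes> a \<in> ideal_gen A S" if "b \<in> carrier A"
      using a that unfolding ideal_gen_def closed_ideal_def by blast+
  qed (auto simp: ideal_gen_def closed_ideal_def)
  show "S \<subseteq> ideal_gen A S" by (auto simp: ideal_gen_def)
qed

lemma ideal_gen_least: "closed_ideal A I \<Longrightarrow> S \<subseteq> I \<Longrightarrow> ideal_gen A S \<subseteq> I"
  by (auto simp: ideal_gen_def)

lemma coset_eq_iff:
  assumes I: "closed_ideal A I" and ab: "a \<in> carrier A" "b \<in> carrier A"
  shows "coset A I a = coset A I b \<longleftrightarrow> a \<ominus> b \<in> I"
proof
  have Ic: "i \<in> I \<Longrightarrow> i \<in> carrier A" for i using I by (auto simp: closed_ideal_def)
  have z: "\<zero> \<in> I" and add: "i \<in> I \<Longrightarrow> j \<in> I \<Longrightarrow> i \<oplus> j \<in> I" and scale: "i \<in> I \<Longrightarrow> c \<odot> i \<in> I" for i j c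
    using I by (auto simp: closed_ideal_def)
  {
    assume "coset A I a = coset A I b"
    moreover have "a \<in> coset A I a" using z ab by (auto simp: coset_def add_zero_right intro!: image_eqI[of _ _ \<zero>])
    ultimately obtain i where i: "i \<in> I" "a = b \<oplus> i" using ab by (auto simp: coset_def)
    then have "a \<ominus> b = i \<oplus> (b \<ominus> b)" using ab Ic add_comm[of b i] by (simp add: add_assoc closed)
    then show "a \<ominus> b \<in> I" using i Ic ab by (simp add: minus_self add_zero_right)
  }
  have sub: "coset A I a \<subseteq> coset A I b" if ab: "a \<ominus> b \<in> I" "a \<in> carrier A" "b \<in> carrier A" for a b
  proof
    fix d assume "d \<in> coset A I a"
    then obtain i where i: "i \<in> I" "d = a \<oplus> i" using ab by (auto simp: coset_def)
    have "d = b \<oplus> ((a \<ominus> b) \<oplus> i)"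
      using i ab Ic minus_add_cancel[of a b] add_assoc[of b "a \<ominus> b" i] by (simp add: closed)
    then show "d \<in> coset A I b" using ab add i by (auto simp: coset_def)
  qed
  assume "a \<ominus> b \<in> I"
  moreover from this have "b \<ominus> a \<in> I" unfolding minus_swap[OF ab] by (rule scale)
  ultimately show "coset A I a = coset A I b" using sub ab by blast
qed

end

lemma factor_map_apply:
  assumes v: "v \<in> D" and wd: "\<And>w. w \<in> D \<Longrightarrow> q w = q v \<Longrightarrow> f w = f v"
  shows "factor_map D q f (q v) = f v"
proof -
  have "(THE z. \<exists>w\<in>D. q w = q v \<and> z = f w) = f v"
    using v wd by (intro the_equality) blast+
  then show ?thesis using v by (simp add: factor_map_def)
qed

lemma c0_algebraD:
  assumes "c0_algebra X \<B>"
  shows "cstar_algebra (alg \<B>)"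
    and "\<And>f v. f \<in> C0 X (topspace X) \<Longrightarrow> v \<in> carrier (alg \<B>) \<Longrightarrow> act \<B> f v \<in> carrier (alg \<B>)"
proof -
  show "cstar_algebra (alg \<B>)" using assms by (simp add: c0_algebra_def)
  fix f v assume f: "f \<in> C0 X (topspace X)" and v: "v \<in> carrier (alg \<B>)"
  have "struct \<B> f \<in> carrier (multiplier_calg (alg \<B>))"
    using assms f cstar_homD(1)[of "C0_calg X" _ "struct \<B>" f] by (simp add: c0_algebra_def)
  then show "act \<B> f v \<in> carrier (alg \<B>)"
    using v multiplier_memD(1)[of "fst (struct \<B> f)" "snd (struct \<B> f)"] by (simp add: act_def)
qed

section \<open>Induced maps of the quotients\<close>

context space_base
begin

lemma complement_open: "openin X (topspace X - X closure_of Y)"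
  by (simp add: openin_diff)

lemma ideal_generators_sub:
  assumes "c0_algebra X \<B>"
  shows "{act \<B> f v | f v. f \<in> C0 X (topspace X - X closure_of Y) \<and> v \<in> carrier (alg \<B>)} \<subseteq> carrier (alg \<B>)"
proof clarify
  fix f v
  assume "f \<in> C0 X (topspace X - X closure_of Y)" "v \<in> carrier (alg \<B>)"
  then show "act \<B> f v \<in> carrier (alg \<B>)"
    using c0_algebraD(2)[OF assms C0_in_C0X[OF complement_open]] by simp
qed

lemma c0_ideal_closed:
  assumes "c0_algebra X \<B>"
  shows "closed_ideal (alg \<B>) (c0_ideal X (topspace X - X closure_of Y) \<B>)"
  unfolding c0_ideal_def
  by (rule cstar_algebra.closed_ideal_gen(1)[OF c0_algebraD(1)[OF assms] ideal_generators_sub[OF assms]])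

lemma stalk_proj_eq_iff:
  assumes "c0_algebra X \<B>" "v \<in> carrier (alg \<B>)" "w \<in> carrier (alg \<B>)"
  shows "stalk_proj X Y \<B> v = stalk_proj X Y \<B> w \<longleftrightarrow>
    v \<ominus>\<^bsub>alg \<B>\<^esub> w \<in> c0_ideal X (topspace X - X closure_of Y) \<B>"
  unfolding stalk_proj_def
  by (rule cstar_algebra.coset_eq_iff[OF c0_algebraD(1)[OF assms(1)] c0_ideal_closed[OF assms(1)] assms(2,3)])

text \<open>The preimage of the target ideal is an ideal, closed because \<open>\<psi>\<close> is
  contractive, and \<open>\<psi>\<close> being \<open>C_0(X)\<close>-linear puts the generators into
  it; minimality does the rest. This makes \<open>\<psi>\<close> descend to the quotients.\<close>

lemma c0_morphism_ideal:
  assumes B: "c0_algebra X \<B>" and C: "c0_algebra X \<C>" and \<psi>: "c0_morphism X \<B> \<C> \<psi>"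
    and v: "v \<in> c0_ideal X (topspace X - X closure_of Y) \<B>"
  shows "\<psi> v \<in> c0_ideal X (topspace X - X closure_of Y) \<C>"
proof -
  interpret B: cstar_algebra "alg \<B>" using c0_algebraD(1)[OF B] .
  interpret C: cstar_algebra "alg \<C>" using c0_algebraD(1)[OF C] .
  have h: "cstar_hom (alg \<B>) (alg \<C>) \<psi>" using \<psi> by (simp add: c0_morphism_def)
  note hs = cstar_homD[OF h]
  define J where "J = c0_ideal X (topspace X - X closure_of Y) \<C>"
  have J: "closed_ideal (alg \<C>) J" unfolding J_def by (rule c0_ideal_closed[OF C])
  note JD = J[unfolded closed_ideal_def]
  define I where "I = {v \<in> carrier (alg \<B>). \<psi> v \<in> J}"
  have "closed_ideal (alg \<B>) I"
    unfolding closed_ideal_def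
  proof (intro conjI ballI allI)
    show "I \<subseteq> carrier (alg \<B>)" by (auto simp: I_def)
    show "\<zero>\<^bsub>alg \<B>\<^esub> \<in> I"
      using cstar_hom_zero[OF B.cstar_algebra_axioms C.cstar_algebra_axioms h] JD B.zero_closed
      by (simp add: I_def)
    show "norm_closure (alg \<B>) I = I"
    proof
      show "norm_closure (alg \<B>) I \<subseteq> I"
        using cstar_hom_in_norm_closure[OF B.cstar_algebra_axioms C.cstar_algebra_axioms h, of I J] JD
          B.norm_closure_sub[of I] by (auto simp: I_def)
    qed (rule B.sub_norm_closure, auto simp: I_def)
    fix a b c
    assume "a \<in> I"
    then have a: "a \<in> carrier (alg \<B>)" "\<psi> a \<in> J" by (auto simp: I_def)
    show "c \<odot>\<^bsub>alg \<B>\<^esub> a \<in> I" using a JD by (simp add: I_def hs B.closed)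
    show "a \<oplus>\<^bsub>alg \<B>\<^esub> b \<in> I" if "b \<in> I" using a JD that by (simp add: I_def hs B.closed)
    assume "b \<in> carrier (alg \<B>)"
    then show "a \<otimes>\<^bsub>alg \<B>\<^esub> b \<in> I" "b \<otimes>\<^bsub>alg \<B>\<^esub> a \<in> I"
      using a JD by (simp_all add: I_def hs B.closed)
  qed
  moreover have "{act \<B> f v | f v. f \<in> C0 X (topspace X - X closure_of Y) \<and> v \<in> carrier (alg \<B>)} \<subseteq> I"
  proof clarify
    fix f v assume f: "f \<in> C0 X (topspace X - X closure_of Y)" and v: "v \<in> carrier (alg \<B>)"
    have f': "f \<in> C0X" using C0_in_C0X[OF complement_open f] .
    have "act \<C> f (\<psi> v) \<in> J"
      using cstar_algebra.closed_ideal_gen(2)[OF C.cstar_algebra_axioms ideal_generators_sub[OF C, of Y]] f hs(1)[OF v]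
      unfolding J_def c0_ideal_def by blast
    then show "act \<B> f v \<in> I"
      using \<psi> f' v c0_algebraD(2)[OF B f' v] by (simp add: I_def c0_morphism_def)
  qed
  ultimately show ?thesis
    using B.ideal_gen_least v unfolding c0_ideal_def[of X _ \<B>] I_def J_def by blast
qed

lemma stalk_map_proj:
  assumes B: "c0_algebra X \<B>" and C: "c0_algebra X \<C>" and \<psi>: "c0_morphism X \<B> \<C> \<psi>"
    and v: "v \<in> carrier (alg \<B>)"
  shows "stalk_map X Y \<B> \<C> \<psi> (stalk_proj X Y \<B> v) = stalk_proj X Y \<C> (\<psi> v)"
  unfolding stalk_map_def
proof (rule factor_map_apply[OF v])
  have h: "cstar_hom (alg \<B>) (alg \<C>) \<psi>" using \<psi> by (simp add: c0_morphism_def)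
  fix w assume w: "w \<in> carrier (alg \<B>)" and eq: "stalk_proj X Y \<B> w = stalk_proj X Y \<B> v"
  then have "w \<ominus>\<^bsub>alg \<B>\<^esub> v \<in> c0_ideal X (topspace X - X closure_of Y) \<B>"
    using stalk_proj_eq_iff[OF B w v] by simp
  from c0_morphism_ideal[OF B C \<psi> this]
  have "\<psi> w \<ominus>\<^bsub>alg \<C>\<^esub> \<psi> v \<in> c0_ideal X (topspace X - X closure_of Y) \<C>"
    using cstar_algebra.cstar_hom_minus[OF c0_algebraD(1)[OF B] h w v] by simp
  then show "stalk_proj X Y \<C> (\<psi> w) = stalk_proj X Y \<C> (\<psi> v)"
    using stalk_proj_eq_iff[OF C] cstar_homD(1)[OF h] w v by simp
qed

end

context net_over_base
begin

text \<open>Fields vanishing at \<open>x\<close> form a closed ideal, as evaluation does not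
  increase the norm, and functions in \<open>C0\<close> of the complement of the closure of
  \<open>Y\<close> vanish at \<open>x\<close>. This is how an equality of cosets yields an equality
  of fields on \<open>Y\<close>.\<close>

lemma ideal_vanishes:
  assumes v: "v \<in> c0_ideal X (topspace X - X closure_of Y) \<N>" and Y: "Y \<in> K" and x: "x \<in> Y"
  shows "v x = \<zero>\<^bsub>pt x\<^esub>"
proof -
  have xX: "x \<in> topspace X" using K_sub Y x by blast
  interpret F: cstar_algebra "pt x" by (rule pt_cstar)
  define I where "I = {v \<in> carrier N. v x = \<zero>\<^bsub>pt x\<^esub>}"
  have c: "v x \<in> carrier (pt x)" if "v \<in> carrier N" for v using product_memD(2)[OF N_sub[OF that] xX] .
  have "closed_ideal N I"
    unfolding closed_ideal_def
  proof (intro conjI ballI allI)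
    show "norm_closure N I = I"
    proof (rule N.norm_closure_eqI)
      fix a assume a: "a \<in> carrier N" and lim: "\<And>e. e > 0 \<Longrightarrow> \<exists>s\<in>I. cnorm N (a \<ominus>\<^bsub>N\<^esub> s) < e"
      have "a x = \<zero>\<^bsub>pt x\<^esub>"
      proof (rule F.eq_if_norm_small)
        fix e :: real assume "e > 0"
        then obtain s where s: "s \<in> I" "cnorm P (a \<ominus>\<^bsub>P\<^esub> s) < e" using lim by auto
        then have sN: "s \<in> carrier N" and sx: "s x = \<zero>\<^bsub>pt x\<^esub>" unfolding I_def by blast+
        have "cnorm (pt x) ((a \<ominus>\<^bsub>P\<^esub> s) x) \<le> cnorm P (a \<ominus>\<^bsub>P\<^esub> s)"
          by (intro norm_le_product xX P.closed N_sub a sN)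
        then show "cnorm (pt x) (a x \<ominus>\<^bsub>pt x\<^esub> \<zero>\<^bsub>pt x\<^esub>) < e"
          using s(2) by (simp add: product_apply xX sx)
      qed (use c a F.zero_closed in auto)
      then show "a \<in> I" using a unfolding I_def by blast
    qed (auto simp: I_def)
    show "\<zero>\<^bsub>N\<^esub> \<in> I" using N.zero_closed xX by (simp add: I_def product_apply)
    fix a b c' assume a: "a \<in> I"
    then have aN: "a \<in> carrier N" and ax: "a x = \<zero>\<^bsub>pt x\<^esub>" unfolding I_def by blast+
    show "cscale N c' a \<in> I"
      using N.scale_closed[OF aN] by (simp add: I_def product_apply xX ax F.scale_zero)
    show "cadd N a b \<in> I" if "b \<in> I"
    proof -
      have bN: "b \<in> carrier N" and bx: "b x = \<zero>\<^bsub>pt x\<^esub>" using that unfolding I_def by blast+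
      show ?thesis
        using N.add_closed[OF aN bN] by (simp add: I_def product_apply xX ax bx F.add_zero F.closed)
    qed
    assume b: "b \<in> carrier N"
    show "cmult N a b \<in> I" "cmult N b a \<in> I"
      using N.mult_closed[OF aN b] N.mult_closed[OF b aN] c[OF b]
      by (simp_all add: I_def product_apply xX ax F.zero_mult F.mult_zero)
  qed (auto simp: I_def)
  moreover have "{act \<N> f v | f v. f \<in> C0 X (topspace X - X closure_of Y) \<and> v \<in> carrier N} \<subseteq> I"
  proof clarify
    fix f v assume f: "f \<in> C0 X (topspace X - X closure_of Y)" and v: "v \<in> carrier N"
    have f': "f \<in> C0X" using C0_in_C0X[OF complement_open f] .
    have "f x = 0" using C0D(2)[OF f] closure_of_subset[OF K_sub[OF Y]] x by blast
    then have "fa f v x = \<zero>\<^bsub>pt x\<^esub>" by (simp add: fa_apply xX F.zero_scale c[OF v])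
    then show "act \<N> f v \<in> I" using fa_N[OF f' v] act_eq[OF f' v] unfolding I_def by simp
  qed
  ultimately have "c0_ideal X (topspace X - X closure_of Y) \<N> \<subseteq> I"
    unfolding c0_ideal_def alg_eq by (rule N.ideal_gen_least)
  then show ?thesis using v unfolding I_def by blast
qed

lemma tau_apply:
  assumes "Y \<in> K" "tau_choice X K Y = (U, g)" "t \<in> carrier (fib \<A> Y)"
  shows "tau X K \<A> Y t = stalk_proj X Y \<N> (fa g (hat U (incl \<A> U Y t)))"
  using assms by (simp add: tau_def)

end

section \<open>Functoriality\<close>

locale net_pair = space_base X K + A: net_over_base X K \<A> + B: net_over_base X K \<B>
  for X :: "'x topology" and K :: "'x set set" and \<A> \<B> :: "('x, 'a) net" +
  fixes \<phi> :: "'x set \<Rightarrow> 'a \<Rightarrow> 'a"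
  assumes morphism: "net_morphism K \<A> \<B> \<phi>"
begin

abbreviation "target \<equiv> family_comp K \<A> (tau X K \<B>) \<phi>"

lemma phi_hom: "Y \<in> K \<Longrightarrow> cstar_hom (fib \<A> Y) (fib \<B> Y) (\<phi> Y)"
  using morphism by (simp add: net_morphism_def)

lemma phi_closed: "Y \<in> K \<Longrightarrow> t \<in> carrier (fib \<A> Y) \<Longrightarrow> \<phi> Y t \<in> carrier (fib \<B> Y)"
  by (rule cstar_homD(1)[OF phi_hom])

lemma phi_incl:
  "\<lbrakk>Y \<in> K; Y' \<in> K; Y \<subseteq> Y'; t \<in> carrier (fib \<A> Y)\<rbrakk> \<Longrightarrow> \<phi> Y' (incl \<A> Y' Y t) = incl \<B> Y' Y (\<phi> Y t)"
  using morphism unfolding net_morphism_iff[OF A.net B.net] by blast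

lemma incl_closed:
  "\<lbrakk>Y \<in> K; Y' \<in> K; Y \<subseteq> Y'; t \<in> carrier (fib \<A> Y)\<rbrakk> \<Longrightarrow> incl \<A> Y' Y t \<in> carrier (fib \<A> Y')"
  by (rule cstar_homD(1)[OF is_netD(2)[OF A.net]])

lemma target_apply: "Y \<in> K \<Longrightarrow> t \<in> carrier (fib \<A> Y) \<Longrightarrow> target Y t = tau X K \<B> Y (\<phi> Y t)"
  by (simp add: family_comp_def compose_def)

text \<open>Compatibility of \<open>\<phi>\<close> with the inclusions moves it past them, after
  which the restriction identity of \<open>tau\<close> applies at \<open>\<phi> Y t\<close>.\<close>

lemma heteromorphism_target:
  assumes h: "heteromorphism X K \<B> (net_c0alg X K \<B>) (tau X K \<B>)"
  shows "heteromorphism X K \<A> (net_c0alg X K \<B>) target"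
  unfolding heteromorphism_def
proof (intro conjI ballI impI)
  show "target \<in> extensional K" by (simp add: family_comp_def)
  show "cstar_hom (fib \<A> Y) (stalk_calg X Y (net_c0alg X K \<B>)) (target Y)" if Y: "Y \<in> K" for Y
  proof -
    have "cstar_hom (fib \<B> Y) (stalk_calg X Y (net_c0alg X K \<B>)) (tau X K \<B> Y)"
      using h Y unfolding heteromorphism_def by blast
    from cstar_hom_compose[OF phi_hom[OF Y] this is_netD(1)[OF A.net Y]]
    show ?thesis using Y by (simp add: family_comp_def)
  qed
  fix Y Y' t
  assume Y: "Y \<in> K" "Y' \<in> K" "Y \<subseteq> Y'" and t: "t \<in> carrier (fib \<A> Y)"
  show "stalk_restrict X Y Y' (net_c0alg X K \<B>) (target Y' (incl \<A> Y' Y t)) = target Y t"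
    unfolding target_apply[OF Y(1) t] target_apply[OF Y(2) incl_closed[OF Y t]] phi_incl[OF Y t]
    using h Y phi_closed[OF Y(1) t] unfolding heteromorphism_def by blast
qed

text \<open>The composites of \<open>\<phi>\<close> with the canonical maps at \<open>x\<close> are
  a morphism of the restricted net. The universal property may be applied to their target because
  both nets have the same fibre type, so \<open>B.pt x\<close> lives on the type on which
  universality is tested.\<close>

lemma point_map_exists:
  "\<exists>h. cstar_hom (A.pt x) (B.pt x) h \<and>
    (\<forall>Y\<in>K. x \<in> Y \<longrightarrow> (\<forall>t\<in>carrier (fib \<A> Y). h (A.ev x Y t) = B.ev x Y (\<phi> Y t)))"
proof -
  let ?K = "{Y \<in> K. x \<in> Y}"
  define \<pi> where "\<pi> = (\<lambda>Y\<in>?K. compose (carrier (fib \<A> Y)) (B.ev x Y) (\<phi> Y))"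
  have "net_morphism ?K \<A> (const_net (B.pt x)) \<pi>"
    unfolding net_morphism_const_iff[OF A.net_at]
  proof (intro conjI ballI impI)
    show "cstar_hom (fib \<A> Y) (B.pt x) (\<pi> Y)" if "Y \<in> ?K" for Y
      using cstar_hom_compose[OF phi_hom B.ev_hom is_netD(1)[OF A.net]] that by (simp add: \<pi>_def)
    fix Y Y' t
    assume Y: "Y \<in> ?K" "Y' \<in> ?K" "Y \<subseteq> Y'" and t: "t \<in> carrier (fib \<A> Y)"
    then show "\<pi> Y' (incl \<A> Y' Y t) = \<pi> Y t"
      by (simp add: \<pi>_def compose_def incl_closed phi_incl B.ev_incl phi_closed)
  qed (simp add: \<pi>_def)
  then have "\<exists>!h. cstar_hom (A.pt x) (B.pt x) h \<and> family_comp ?K \<A> (\<lambda>Y. h) (A.ev x) = \<pi>"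
    using A.point_universal[of x] B.pt_cstar unfolding is_universal_def by blast
  then obtain h where h: "cstar_hom (A.pt x) (B.pt x) h" "family_comp ?K \<A> (\<lambda>Y. h) (A.ev x) = \<pi>"
    by blast
  have "h (A.ev x Y t) = B.ev x Y (\<phi> Y t)" if "Y \<in> K" "x \<in> Y" "t \<in> carrier (fib \<A> Y)" for Y t
    using fun_cong[OF fun_cong[OF h(2), of Y], of t] that by (simp add: family_comp_def \<pi>_def compose_def)
  then show ?thesis using h(1) by blast
qed

definition point_map where
  "point_map x = (SOME h. cstar_hom (A.pt x) (B.pt x) h \<and>
    (\<forall>Y\<in>K. x \<in> Y \<longrightarrow> (\<forall>t\<in>carrier (fib \<A> Y). h (A.ev x Y t) = B.ev x Y (\<phi> Y t))))"

lemma point_map: "cstar_hom (A.pt x) (B.pt x) (point_map x)"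
  and point_map_ev:
    "\<lbrakk>Y \<in> K; x \<in> Y; t \<in> carrier (fib \<A> Y)\<rbrakk> \<Longrightarrow> point_map x (A.ev x Y t) = B.ev x Y (\<phi> Y t)"
  using someI_ex[OF point_map_exists[of x]] unfolding point_map_def[symmetric] by blast+

text \<open>Defined on all bounded fields, where the operations are pointwise and no closure
  intervenes; only afterwards is it restricted to the generated algebra.\<close>

definition lift where
  "lift = (\<lambda>v\<in>carrier A.P. \<lambda>x\<in>topspace X. point_map x (v x))"

lemma lift_apply: "v \<in> carrier A.P \<Longrightarrow> x \<in> topspace X \<Longrightarrow> lift v x = point_map x (v x)"
  by (simp add: lift_def)

lemma lift_ext: "v \<in> carrier A.P \<Longrightarrow> lift v \<in> extensional (topspace X)"
  by (simp add: lift_def)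

lemma lift_hom: "cstar_hom A.P B.P lift"
proof (rule cstar_homI)
  note pm = cstar_homD[OF point_map]
  fix a b c
  assume a: "a \<in> carrier A.P"
  have ax: "x \<in> topspace X \<Longrightarrow> a x \<in> carrier (A.pt x)" for x using A.product_memD(2)[OF a] .
  show "lift a \<in> carrier B.P"
  proof (rule B.product_memI[where M = "cnorm A.P a"])
    show "cnorm (B.pt x) (lift a x) \<le> cnorm A.P a" if x: "x \<in> topspace X" for x
      using cstar_hom_contractive[OF A.pt_cstar B.pt_cstar point_map ax[OF x]] A.norm_le_product[OF a x]
      by (simp add: lift_apply a x)
  qed (use a ax pm in \<open>auto simp: lift_apply lift_ext\<close>)
  show "lift (cscale A.P c a) = cscale B.P c (lift a)"
  proof (rule B.product_eqI)
    fix x assume x: "x \<in> topspace X"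
    show "lift (cscale A.P c a) x = (cscale B.P c (lift a)) x"
      by (simp only: lift_apply[OF A.P.scale_closed[OF a] x] lift_apply[OF a x]
          A.product_apply[OF x] B.product_apply[OF x] pm(3)[OF ax[OF x]])
  qed (rule lift_ext[OF A.P.scale_closed[OF a]], rule B.product_ext)
  show "lift (cstar A.P a) = cstar B.P (lift a)"
  proof (rule B.product_eqI)
    fix x assume x: "x \<in> topspace X"
    show "lift (cstar A.P a) x = (cstar B.P (lift a)) x"
      by (simp only: lift_apply[OF A.P.star_closed[OF a] x] lift_apply[OF a x]
          A.product_apply[OF x] B.product_apply[OF x] pm(5)[OF ax[OF x]])
  qed (rule lift_ext[OF A.P.star_closed[OF a]], rule B.product_ext)
  assume b: "b \<in> carrier A.P"
  have bx: "x \<in> topspace X \<Longrightarrow> b x \<in> carrier (A.pt x)" for x using A.product_memD(2)[OF b] .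
  show "lift (cadd A.P a b) = cadd B.P (lift a) (lift b)"
  proof (rule B.product_eqI)
    fix x assume x: "x \<in> topspace X"
    show "lift (cadd A.P a b) x = (cadd B.P (lift a) (lift b)) x"
      by (simp only: lift_apply[OF A.P.add_closed[OF a b] x] lift_apply[OF a x] lift_apply[OF b x]
          A.product_apply[OF x] B.product_apply[OF x] pm(2)[OF ax[OF x] bx[OF x]])
  qed (rule lift_ext[OF A.P.add_closed[OF a b]], rule B.product_ext)
  show "lift (cmult A.P a b) = cmult B.P (lift a) (lift b)"
  proof (rule B.product_eqI)
    fix x assume x: "x \<in> topspace X"
    show "lift (cmult A.P a b) x = (cmult B.P (lift a) (lift b)) x"
      by (simp only: lift_apply[OF A.P.mult_closed[OF a b] x] lift_apply[OF a x] lift_apply[OF b x]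
          A.product_apply[OF x] B.product_apply[OF x] pm(4)[OF ax[OF x] bx[OF x]])
  qed (rule lift_ext[OF A.P.mult_closed[OF a b]], rule B.product_ext)
qed (simp add: lift_def)

lemma lift_fa:
  assumes f: "f \<in> C0X" and v: "v \<in> carrier A.P"
  shows "lift (A.fa f v) = B.fa f (lift v)"
proof (rule B.product_eqI)
  fix x assume x: "x \<in> topspace X"
  show "lift (A.fa f v) x = B.fa f (lift v) x"
    by (simp only: lift_apply[OF A.fa_closed[OF f v] x] lift_apply[OF v x] A.fa_apply[OF x] B.fa_apply[OF x]
        cstar_homD(3)[OF point_map A.product_memD(2)[OF v x]])
qed (rule lift_ext[OF A.fa_closed[OF f v]], rule B.fa_ext)

lemma lift_hat:
  assumes Y: "Y \<in> K" and t: "t \<in> carrier (fib \<A> Y)"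
  shows "lift (A.hat Y t) = B.hat Y (\<phi> Y t)"
proof (rule B.product_eqI)
  fix x assume "x \<in> topspace X"
  then show "lift (A.hat Y t) x = B.hat Y (\<phi> Y t) x"
    unfolding lift_apply[OF A.hat_closed[OF Y t] \<open>x \<in> topspace X\<close>]
    by (simp add: eps_hat_def point_map_ev[OF Y _ t] cstar_hom_zero[OF A.pt_cstar B.pt_cstar point_map])
qed (rule lift_ext[OF A.hat_closed[OF Y t]], simp add: eps_hat_def)

lemma lift_gen:
  assumes Y: "Y \<in> K" and f: "f \<in> C0 X Y" and t: "t \<in> carrier (fib \<A> Y)"
  shows "lift (A.fa f (A.hat Y t)) = B.fa f (B.hat Y (\<phi> Y t))"
  using lift_fa[OF C0_in_C0X[OF K_open[OF Y] f] A.hat_closed[OF Y t]] lift_hat[OF Y t] by simp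

definition agrees where
  "agrees \<psi> \<longleftrightarrow> c0_morphism X A.\<N> B.\<N> \<psi> \<and>
    (\<forall>Y\<in>K. \<forall>f\<in>C0 X Y. \<forall>t\<in>carrier (fib \<A> Y). \<psi> (A.fa f (A.hat Y t)) = B.fa f (B.hat Y (\<phi> Y t)))"

lemma agrees_lift: "agrees (restrict lift (carrier A.N))"
  unfolding agrees_def c0_morphism_def A.alg_eq B.alg_eq
proof (intro conjI ballI)
  show h: "cstar_hom A.N B.N (restrict lift (carrier A.N))"
  proof (rule gen_calg_hom_restrict[OF A.P.cstar_algebra_axioms B.P.cstar_algebra_axioms lift_hom A.gens_sub])
    fix s assume "s \<in> A.gens"
    then obtain f Y t where s: "s = A.fa f (A.hat Y t)" "Y \<in> K" "f \<in> C0 X Y" "t \<in> carrier (fib \<A> Y)"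
      unfolding A.gens_def by blast
    then show "lift s \<in> B.gens" using lift_gen B.gensI phi_closed by simp
  qed
  show "restrict lift (carrier A.N) (A.fa f (A.hat Y t)) = B.fa f (B.hat Y (\<phi> Y t))"
    if "Y \<in> K" "f \<in> C0 X Y" "t \<in> carrier (fib \<A> Y)" for Y f t
    using lift_gen[OF that] A.gens_N[OF A.gensI[OF that]] by simp
  fix f v assume "f \<in> carrier (C0_calg X)" and v: "v \<in> carrier A.N"
  then have f: "f \<in> C0X" by simp
  have "restrict lift (carrier A.N) v \<in> carrier B.N" using cstar_homD(1)[OF h v] .
  then show "restrict lift (carrier A.N) (act A.\<N> f v) = act B.\<N> f (restrict lift (carrier A.N) v)"
    using A.fa_N[OF f v] v
    by (simp add: A.act_eq[OF f v] B.act_eq[OF f] lift_fa[OF f A.N_sub[OF v]] del: gen_calg_simps(1))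
qed

lemma agrees_unique:
  assumes "agrees \<psi>" "agrees \<psi>'"
  shows "\<psi> = \<psi>'"
proof (rule gen_calg_hom_eqI[OF A.P.cstar_algebra_axioms B.N.cstar_algebra_axioms A.gens_sub])
  show "cstar_hom A.N B.N \<psi>" "cstar_hom A.N B.N \<psi>'"
    using assms by (simp_all add: agrees_def c0_morphism_def A.alg_eq B.alg_eq)
  show "\<psi> s = \<psi>' s" if "s \<in> A.gens" for s
    using that assms unfolding A.gens_def agrees_def by auto
qed

text \<open>Because \<open>tau_choice\<close> does not depend on the net, the same pair
  \<open>(U, g)\<close> represents both classes; \<open>\<psi>\<close> carries one representative
  exactly to the other, before any quotient is taken.\<close>

lemma induces_if_agrees:
  assumes "agrees \<psi>"
  shows "induces X K \<A> B.\<N> target \<psi>"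
  unfolding induces_def
proof (intro conjI ballI)
  show c0: "c0_morphism X A.\<N> B.\<N> \<psi>" using assms by (simp add: agrees_def)
  fix Y t assume Y: "Y \<in> K" and t: "t \<in> carrier (fib \<A> Y)"
  obtain U g where Ug: "tau_choice X K Y = (U, g)" by fastforce
  note Ug' = tau_choice_props[OF Y Ug]
  let ?j = "incl \<A> U Y t"
  have j: "?j \<in> carrier (fib \<A> U)" using incl_closed[OF Y Ug'(1,3) t] .
  have "A.fa g (A.hat U ?j) \<in> carrier (alg A.\<N>)"
    unfolding A.alg_eq by (rule A.gens_N[OF A.gensI[OF Ug'(1,4) j]])
  then have "stalk_map X Y A.\<N> B.\<N> \<psi> (tau X K \<A> Y t) = stalk_proj X Y B.\<N> (\<psi> (A.fa g (A.hat U ?j)))"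
    unfolding A.tau_apply[OF Y Ug t] by (rule stalk_map_proj[OF A.c0_algebra_net B.c0_algebra_net c0])
  also have "\<psi> (A.fa g (A.hat U ?j)) = B.fa g (B.hat U (incl \<B> U Y (\<phi> Y t)))"
    using assms Ug' j phi_incl[OF Y Ug'(1,3) t] by (simp add: agrees_def)
  finally show "target Y t = stalk_map X Y A.\<N> B.\<N> \<psi> (tau X K \<A> Y t)"
    by (simp add: target_apply[OF Y t] B.tau_apply[OF Y Ug phi_closed[OF Y t]])
qed

text \<open>The induced identity of cosets says that \<open>\<psi> (g \<epsilon>\<^sub>U (j t))\<close> and \<open>g \<epsilon>\<^sub>U (j (\<phi> t))\<close> agree on \<open>Y\<close>;
  multiplying by \<open>f \<in> C\<^sub>0(Y)\<close> removes the cut-off \<open>g\<close> and everything outside \<open>Y\<close>.\<close>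

lemma agrees_if_induces:
  assumes "induces X K \<A> B.\<N> target \<psi>"
  shows "agrees \<psi>"
  unfolding agrees_def
proof (intro conjI ballI)
  show c0: "c0_morphism X A.\<N> B.\<N> \<psi>" using assms by (simp add: induces_def)
  fix Y f t assume Y: "Y \<in> K" and f: "f \<in> C0 X Y" and t: "t \<in> carrier (fib \<A> Y)"
  obtain U g where Ug: "tau_choice X K Y = (U, g)" by fastforce
  note Ug' = tau_choice_props[OF Y Ug]
  note \<phi>t = phi_closed[OF Y t]
  have fX: "f \<in> C0X" using C0_in_C0X[OF K_open[OF Y] f] .
  have f0: "x \<notin> Y \<Longrightarrow> f x = 0" for x using C0D(2)[OF f] .
  let ?a = "A.fa g (A.hat U (incl \<A> U Y t))"
  let ?b = "B.fa g (B.hat U (incl \<B> U Y (\<phi> Y t)))"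
  have "incl \<A> U Y t \<in> carrier (fib \<A> U)" using incl_closed[OF Y Ug'(1,3) t] .
  then have a: "?a \<in> carrier A.N" using A.gens_N[OF A.gensI[OF Ug'(1,4)]] by blast
  have "incl \<B> U Y (\<phi> Y t) \<in> carrier (fib \<B> U)"
    using is_netD(2)[OF B.net Y Ug'(1,3)] \<phi>t by (rule cstar_homD(1))
  then have b: "?b \<in> carrier B.N" using B.gens_N[OF B.gensI[OF Ug'(1,4)]] by blast
  have \<psi>a: "\<psi> ?a \<in> carrier B.N"
    using c0 a cstar_homD(1)[of A.N B.N \<psi>] by (simp add: c0_morphism_def A.alg_eq B.alg_eq)
  have "stalk_proj X Y B.\<N> (\<psi> ?a) = stalk_map X Y A.\<N> B.\<N> \<psi> (tau X K \<A> Y t)"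
    unfolding A.tau_apply[OF Y Ug t]
    by (rule stalk_map_proj[symmetric, OF A.c0_algebra_net B.c0_algebra_net c0]) (simp only: A.alg_eq a)
  also have "\<dots> = target Y t" using assms Y t by (simp add: induces_def)
  also have "\<dots> = stalk_proj X Y B.\<N> ?b"
    by (simp add: target_apply[OF Y t] B.tau_apply[OF Y Ug \<phi>t])
  finally have "\<psi> ?a \<ominus>\<^bsub>B.N\<^esub> ?b \<in> c0_ideal X (topspace X - X closure_of Y) B.\<N>"
    using stalk_proj_eq_iff[OF B.c0_algebra_net, of "\<psi> ?a" ?b Y] \<psi>a b by (simp add: B.alg_eq)
  \<comment> \<open>Equal cosets differ by a member of the ideal, and such members vanish on
    \<open>Y\<close>.\<close>
  then have vanish: "(\<psi> ?a \<ominus>\<^bsub>B.N\<^esub> ?b) x = \<zero>\<^bsub>B.pt x\<^esub>" if "x \<in> Y" for x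
    using B.ideal_vanishes Y that by blast
  have "B.fa f (\<psi> ?a) = B.fa f ?b"
  proof (rule B.product_eqI)
    fix x assume x: "x \<in> topspace X"
    have c: "\<psi> ?a x \<in> carrier (B.pt x)" "?b x \<in> carrier (B.pt x)"
      using B.product_memD(2)[OF B.N_sub x] \<psi>a b by blast+
    show "B.fa f (\<psi> ?a) x = B.fa f ?b x"
    proof (cases "x \<in> Y")
      case True
      then have "\<psi> ?a x = ?b x"
        using vanish[OF True] cstar_algebra.minus_eq_zero_iff[OF B.pt_cstar c]
        by (simp add: B.product_apply x)
      then show ?thesis by (simp add: B.fa_apply x)
    next
      case False
      then show ?thesis using f0[OF False] by (simp only: B.fa_apply[OF x, where f = f] cstar_algebra.zero_scale[OF B.pt_cstar c(1)]
          cstar_algebra.zero_scale[OF B.pt_cstar c(2)])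
    qed
  qed (simp_all add: B.fa_ext)
  moreover have "\<psi> (act A.\<N> f ?a) = act B.\<N> f (\<psi> ?a)"
    using c0 a fX unfolding c0_morphism_def A.alg_eq C0_calg_simps by blast
  then have "\<psi> (A.fa f ?a) = B.fa f (\<psi> ?a)"
    by (simp only: A.act_eq[OF fX a] B.act_eq[OF fX \<psi>a])
  ultimately show "\<psi> (A.fa f (A.hat Y t)) = B.fa f (B.hat Y (\<phi> Y t))"
    using A.cutoff_hat[OF Y Ug f0 t] B.cutoff_hat[OF Y Ug f0 \<phi>t] by simp
qed

lemma induces_iff: "induces X K \<A> B.\<N> target \<psi> \<longleftrightarrow> agrees \<psi>"
  using induces_if_agrees agrees_if_induces by blast

lemma induces_unique: "\<exists>!\<psi>. induces X K \<A> B.\<N> target \<psi>"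
  unfolding induces_iff using agrees_lift agrees_unique by blast

text \<open>Evaluates the definite description in \<open>induced\<close>: exhibiting one morphism
  with the right values on generators identifies \<open>phi_tau\<close>.\<close>

lemma phi_tau_eqI: "agrees \<psi> \<Longrightarrow> phi_tau X K \<A> \<B> \<phi> = \<psi>"
  unfolding phi_tau_def induced_def induces_iff using agrees_unique by blast

lemma agrees_phi_tau: "agrees (phi_tau X K \<A> \<B> \<phi>)"
  using phi_tau_eqI[OF agrees_lift] agrees_lift by simp

lemma phi_tau_morphism: "c0_morphism X A.\<N> B.\<N> (phi_tau X K \<A> \<B> \<phi>)"
  using agrees_phi_tau by (simp add: agrees_def)

end

section \<open>The two categories\<close>

lemma compose_assoc':
  assumes "f \<in> A \<rightarrow> B"
  shows "compose A h (compose A g f) = compose A (compose B h g) f"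
  using assms by (auto simp: compose_def intro!: restrict_ext)

lemma net_id_morphism:
  assumes "is_net K \<A>"
  shows "net_morphism K \<A> \<A> (net_id K \<A>)"
  unfolding net_morphism_iff[OF assms assms]
  using is_netD(1)[OF assms] cstar_homD(1)[OF is_netD(2)[OF assms]]
  by (auto simp: net_id_def cstar_algebra.cstar_hom_id) (auto simp: id_map_def)

lemma net_morphism_comp:
  assumes A: "is_net K \<A>" and B: "is_net K \<B>" and C: "is_net K \<C>"
    and \<phi>: "net_morphism K \<A> \<B> \<phi>" and \<psi>: "net_morphism K \<B> \<C> \<psi>"
  shows "net_morphism K \<A> \<C> (family_comp K \<A> \<psi> \<phi>)"
  unfolding net_morphism_iff[OF A C]
proof (intro conjI ballI impI)
  note \<phi> = \<phi>[unfolded net_morphism_iff[OF A B]] and \<psi> = \<psi>[unfolded net_morphism_iff[OF B C]]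
  show "family_comp K \<A> \<psi> \<phi> \<in> extensional K" by (simp add: family_comp_def)
  show "cstar_hom (fib \<A> Y) (fib \<C> Y) (family_comp K \<A> \<psi> \<phi> Y)" if "Y \<in> K" for Y
    using \<phi> \<psi> that cstar_hom_compose[of "fib \<A> Y" "fib \<B> Y" "\<phi> Y" "fib \<C> Y" "\<psi> Y"]
      is_netD(1)[OF A that] by (simp add: family_comp_def)
  fix Y Y' t assume Y: "Y \<in> K" "Y' \<in> K" "Y \<subseteq> Y'" and t: "t \<in> carrier (fib \<A> Y)"
  have "\<phi> Y t \<in> carrier (fib \<B> Y)" using \<phi> Y t by (auto dest: cstar_homD(1))
  moreover have "incl \<A> Y' Y t \<in> carrier (fib \<A> Y')" using cstar_homD(1)[OF is_netD(2)[OF A Y] t] .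
  ultimately show "family_comp K \<A> \<psi> \<phi> Y' (incl \<A> Y' Y t) = incl \<C> Y' Y (family_comp K \<A> \<psi> \<phi> Y t)"
    using \<phi> \<psi> Y t by (simp add: family_comp_def compose_def)
qed

lemma net_category: "is_category (net_cat K :: (('x, 'a) net, 'x set \<Rightarrow> 'a \<Rightarrow> 'a) cat)"
  unfolding is_category_def net_cat_def cat.simps
proof (intro conjI ballI)
  fix \<A> \<B> \<C> \<D> :: "('x, 'a) net" and \<phi> \<psi> \<xi>
  assume "\<A> \<in> {\<A>. is_net K \<A>}"
  then have A: "is_net K \<A>" by simp
  then show "net_id K \<A> \<in> {\<phi>. net_morphism K \<A> \<A> \<phi>}" by (simp add: net_id_morphism)
  assume "\<B> \<in> {\<A>. is_net K \<A>}"
  then have B: "is_net K \<B>" by simp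
  {
    assume "\<phi> \<in> {\<phi>. net_morphism K \<A> \<B> \<phi>}"
    then have \<phi>: "net_morphism K \<A> \<B> \<phi>" by simp
    then have ext: "\<phi> \<in> extensional K" and
      maps: "\<And>Y. Y \<in> K \<Longrightarrow> \<phi> Y \<in> carrier (fib \<A> Y) \<rightarrow>\<^sub>E carrier (fib \<B> Y)"
      by (auto simp: net_morphism_def cstar_hom_def)
    show "family_comp K \<A> \<phi> (net_id K \<A>) = \<phi>" "family_comp K \<A> (net_id K \<B>) \<phi> = \<phi>"
      by (rule extensionalityI[OF _ ext]; simp add: family_comp_def net_id_def compose_id_map[OF maps])+
  }
  assume \<phi>: "\<phi> \<in> {\<phi>. net_morphism K \<A> \<B> \<phi>}" and "\<C> \<in> {\<A>. is_net K \<A>}" and \<psi>: "\<psi> \<in> {\<phi>. net_morphism K \<B> \<C> \<phi>}"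
  then show "family_comp K \<A> \<psi> \<phi> \<in> {\<phi>. net_morphism K \<A> \<C> \<phi>}"
    using net_morphism_comp[OF A B] by simp
  have maps: "\<phi> Y \<in> carrier (fib \<A> Y) \<rightarrow> carrier (fib \<B> Y)" if "Y \<in> K" for Y
    using \<phi> that by (auto simp: net_morphism_def cstar_hom_def)
  show "family_comp K \<A> \<xi> (family_comp K \<A> \<psi> \<phi>) = family_comp K \<A> (family_comp K \<B> \<xi> \<psi>) \<phi>"
    by (simp add: family_comp_def compose_assoc'[OF maps] cong: restrict_cong)
qed

lemma c0_category: "is_category (c0_cat X :: (('x, 'b) c0alg, 'b \<Rightarrow> 'b) cat)"
  unfolding is_category_def c0_cat_def cat.simps
proof (intro conjI ballI)
  fix \<B> \<C> \<D> \<E> :: "('x, 'b) c0alg" and \<eta> \<zeta> \<xi>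
  assume "\<B> \<in> {\<B>. c0_algebra X \<B>}"
  then have B: "c0_algebra X \<B>" by simp
  then show "id_map (alg \<B>) \<in> {\<eta>. c0_morphism X \<B> \<B> \<eta>}"
    using c0_algebraD[OF B] by (simp add: c0_morphism_def cstar_algebra.cstar_hom_id) (simp add: id_map_def)
  {
    assume "\<eta> \<in> {\<eta>. c0_morphism X \<B> \<C> \<eta>}"
    then have "\<eta> \<in> carrier (alg \<B>) \<rightarrow>\<^sub>E carrier (alg \<C>)" by (auto simp: c0_morphism_def cstar_hom_def)
    then show "compose (carrier (alg \<B>)) \<eta> (id_map (alg \<B>)) = \<eta>"
      "compose (carrier (alg \<B>)) (id_map (alg \<C>)) \<eta> = \<eta>"
      by (auto simp: compose_id_map)
  }
  assume \<eta>: "\<eta> \<in> {\<eta>. c0_morphism X \<B> \<C> \<eta>}" and \<zeta>: "\<zeta> \<in> {\<eta>. c0_morphism X \<C> \<D> \<eta>}"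
  then have maps: "v \<in> carrier (alg \<B>) \<Longrightarrow> \<eta> v \<in> carrier (alg \<C>)" for v
    by (auto simp: c0_morphism_def dest: cstar_homD(1))
  then show "compose (carrier (alg \<B>)) \<zeta> \<eta> \<in> {\<eta>. c0_morphism X \<B> \<D> \<eta>}"
    using \<eta> \<zeta> cstar_hom_compose[of "alg \<B>" "alg \<C>" \<eta> "alg \<D>" \<zeta>] c0_algebraD[OF B]
    by (simp add: c0_morphism_def compose_eq)
  show "compose (carrier (alg \<B>)) \<xi> (compose (carrier (alg \<B>)) \<zeta> \<eta>)
      = compose (carrier (alg \<B>)) (compose (carrier (alg \<C>)) \<xi> \<zeta>) \<eta>"
    using maps by (intro compose_assoc') auto
qed

section \<open>Identities, composites and the functor\<close>

context space_base
begin

lemma net_pairI: "is_net K \<A> \<Longrightarrow> is_net K \<B> \<Longrightarrow> net_morphism K \<A> \<B> \<phi> \<Longrightarrow> net_pair X K \<A> \<B> \<phi>"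
  by (simp add: net_pair_def net_pair_axioms_def net_over_base_def net_over_base_axioms_def space_base_axioms)

lemma net_over_baseI: "is_net K \<A> \<Longrightarrow> net_over_base X K \<A>"
  by (simp add: net_over_base_def net_over_base_axioms_def space_base_axioms)

lemma phi_tau_id:
  assumes A: "is_net K \<A>"
  shows "phi_tau X K \<A> \<A> (net_id K \<A>) = id_map (alg (net_c0alg X K \<A>))"
proof -
  interpret net_pair X K \<A> \<A> "net_id K \<A>" using net_pairI[OF A A net_id_morphism[OF A]] .
  have "agrees (id_map (alg A.\<N>))"
    unfolding agrees_def
  proof (intro conjI ballI)
    show "c0_morphism X A.\<N> A.\<N> (id_map (alg A.\<N>))"
      using c0_category[of X] A.c0_algebra_net by (auto simp: is_category_def c0_cat_def)
    fix Y f t assume "Y \<in> K" "f \<in> C0 X Y" "t \<in> carrier (fib \<A> Y)"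
    then show "id_map (alg A.\<N>) (A.fa f (A.hat Y t)) = A.fa f (A.hat Y (net_id K \<A> Y t))"
      using A.gens_N[OF A.gensI] by (simp add: id_map_def net_id_def A.alg_eq del: gen_calg_simps(1))
  qed
  then show ?thesis by (rule phi_tau_eqI)
qed

text \<open>The image of a generator is again a generator with the same \<open>Y\<close> and
  \<open>f\<close>, so the two descriptions on generators chain together.\<close>

lemma phi_tau_comp:
  fixes \<A> \<B> \<C> :: "('x, 'a) net"
  assumes A: "is_net K \<A>" and B: "is_net K \<B>" and C: "is_net K \<C>"
    and \<phi>: "net_morphism K \<A> \<B> \<phi>" and \<psi>: "net_morphism K \<B> \<C> \<psi>"
  shows "phi_tau X K \<A> \<C> (family_comp K \<A> \<psi> \<phi>)
    = compose (carrier (alg (net_c0alg X K \<A>))) (phi_tau X K \<B> \<C> \<psi>) (phi_tau X K \<A> \<B> \<phi>)"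
proof -
  interpret AB: net_pair X K \<A> \<B> \<phi> using net_pairI[OF A B \<phi>] .
  interpret BC: net_pair X K \<B> \<C> \<psi> using net_pairI[OF B C \<psi>] .
  interpret AC: net_pair X K \<A> \<C> "family_comp K \<A> \<psi> \<phi>"
    using net_pairI[OF A C net_morphism_comp[OF A B C \<phi> \<psi>]] .
  let ?f = "phi_tau X K \<A> \<B> \<phi>" and ?g = "phi_tau X K \<B> \<C> \<psi>"
  have "AC.agrees (compose (carrier (alg AB.A.\<N>)) ?g ?f)"
    unfolding AC.agrees_def
  proof (intro conjI ballI)
    show "c0_morphism X AB.A.\<N> BC.B.\<N> (compose (carrier (alg AB.A.\<N>)) ?g ?f)"
      \<comment> \<open>That the composite is a morphism is read off from the composition law of the
        category \<open>c0_cat X\<close>.\<close>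
      using c0_category[of X] AB.phi_tau_morphism BC.phi_tau_morphism
        AB.A.c0_algebra_net AB.B.c0_algebra_net BC.B.c0_algebra_net
      unfolding is_category_def c0_cat_def cat.simps mem_Collect_eq by blast
    fix Y f t assume Y: "Y \<in> K" "f \<in> C0 X Y" and t: "t \<in> carrier (fib \<A> Y)"
    have "AB.A.fa f (AB.A.hat Y t) \<in> carrier (alg AB.A.\<N>)"
      unfolding AB.A.alg_eq by (rule AB.A.gens_N[OF AB.A.gensI[OF Y t]])
    then show "compose (carrier (alg AB.A.\<N>)) ?g ?f (AB.A.fa f (AB.A.hat Y t))
        = BC.B.fa f (BC.B.hat Y (family_comp K \<A> \<psi> \<phi> Y t))"
      using AB.agrees_phi_tau BC.agrees_phi_tau Y t AB.phi_closed[OF Y(1) t]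
      by (simp add: AB.agrees_def BC.agrees_def compose_def family_comp_def)
  qed
  then show ?thesis by (rule AC.phi_tau_eqI)
qed

lemma is_functor_phi_tau: "is_functor (net_cat K :: (('x, 'a) net, 'x set \<Rightarrow> 'a \<Rightarrow> 'a) cat) (c0_cat X)
  (net_c0alg X K) (phi_tau X K)"
  unfolding is_functor_def
proof (intro conjI ballI)
  show "is_category (net_cat K :: (('x, 'a) net, 'x set \<Rightarrow> 'a \<Rightarrow> 'a) cat)" by (rule net_category)
  show "is_category (c0_cat X :: (('x, 'x \<Rightarrow> ('x, 'a) univ) c0alg, _) cat)" by (rule c0_category)
next
  fix \<A> :: "('x, 'a) net" assume "\<A> \<in> Obj (net_cat K)"
  then have A: "is_net K \<A>" by (simp add: net_cat_def)
  show "net_c0alg X K \<A> \<in> Obj (c0_cat X)"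
    using net_over_base.c0_algebra_net[OF net_over_baseI[OF A]] by (simp add: c0_cat_def)
  show "phi_tau X K \<A> \<A> (Ident (net_cat K) \<A>) = Ident (c0_cat X) (net_c0alg X K \<A>)"
    using phi_tau_id[OF A] by (simp add: c0_cat_def net_cat_def)
  fix \<B> :: "('x, 'a) net" and \<phi> assume "\<B> \<in> Obj (net_cat K)" "\<phi> \<in> Hom (net_cat K) \<A> \<B>"
  then have B: "is_net K \<B>" and \<phi>: "net_morphism K \<A> \<B> \<phi>" by (simp_all add: net_cat_def)
  show "phi_tau X K \<A> \<B> \<phi> \<in> Hom (c0_cat X) (net_c0alg X K \<A>) (net_c0alg X K \<B>)"
    using net_pair.phi_tau_morphism[OF net_pairI[OF A B \<phi>]] by (simp add: c0_cat_def)
  fix \<C> :: "('x, 'a) net" and \<psi> assume "\<C> \<in> Obj (net_cat K)" "\<psi> \<in> Hom (net_cat K) \<B> \<C>"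
  then have C: "is_net K \<C>" and \<psi>: "net_morphism K \<B> \<C> \<psi>" by (simp_all add: net_cat_def)
  show "phi_tau X K \<A> \<C> (Comp (net_cat K) \<A> \<B> \<C> \<psi> \<phi>)
      = Comp (c0_cat X) (net_c0alg X K \<A>) (net_c0alg X K \<B>) (net_c0alg X K \<C>)
          (phi_tau X K \<B> \<C> \<psi>) (phi_tau X K \<A> \<B> \<phi>)"
    using phi_tau_comp[OF A B C \<phi> \<psi>] by (simp add: c0_cat_def net_cat_def)
qed

end

text \<open>Unique existence of the induced map stands beside the functor statement because
  \<open>phi_tau\<close> is a definite description and owes its meaning to it.\<close>

theorem proposition4p7:
  fixes X :: "'x topology" and K :: "'x set set"
  assumes "locally_compact_space X" and "path_connected_space X" and "Hausdorff_space X"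
    and "rel_compact_base X K"
    and tau_defined: "\<forall>Y\<in>K. \<exists>U\<in>K. X closure_of Y \<subseteq> U"
  shows "(\<forall>(\<A>\<^sub>1 :: ('x, 'a) net) (\<A>\<^sub>2 :: ('x, 'a) net) \<phi>.
            is_net K \<A>\<^sub>1 \<and> is_net K \<A>\<^sub>2 \<and> net_morphism K \<A>\<^sub>1 \<A>\<^sub>2 \<phi> \<longrightarrow>
              (heteromorphism X K \<A>\<^sub>2 (net_c0alg X K \<A>\<^sub>2) (tau X K \<A>\<^sub>2) \<longrightarrow>
                 heteromorphism X K \<A>\<^sub>1 (net_c0alg X K \<A>\<^sub>2) (family_comp K \<A>\<^sub>1 (tau X K \<A>\<^sub>2) \<phi>)) \<and>
              (\<exists>!\<psi>. induces X K \<A>\<^sub>1 (net_c0alg X K \<A>\<^sub>2) (family_comp K \<A>\<^sub>1 (tau X K \<A>\<^sub>2) \<phi>) \<psi>) \<and>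
              induces X K \<A>\<^sub>1 (net_c0alg X K \<A>\<^sub>2) (family_comp K \<A>\<^sub>1 (tau X K \<A>\<^sub>2) \<phi>)
                (phi_tau X K \<A>\<^sub>1 \<A>\<^sub>2 \<phi>) \<and>
              c0_morphism X (net_c0alg X K \<A>\<^sub>1) (net_c0alg X K \<A>\<^sub>2) (phi_tau X K \<A>\<^sub>1 \<A>\<^sub>2 \<phi>)) \<and>
         is_functor (net_cat K :: (('x, 'a) net, 'x set \<Rightarrow> 'a \<Rightarrow> 'a) cat) (c0_cat X)
           (net_c0alg X K) (phi_tau X K)"
proof -
  interpret space_base X K using assms by unfold_locales auto
  show ?thesis
  proof (intro conjI allI impI)
    fix \<A> \<B> :: "('x, 'a) net" and \<phi>
    assume "is_net K \<A> \<and> is_net K \<B> \<and> net_morphism K \<A> \<B> \<phi>"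
    then interpret net_pair X K \<A> \<B> \<phi> using net_pairI by blast
    show "heteromorphism X K \<A> (net_c0alg X K \<B>) (family_comp K \<A> (tau X K \<B>) \<phi>)"
      if "heteromorphism X K \<B> (net_c0alg X K \<B>) (tau X K \<B>)"
      using that by (rule heteromorphism_target)
    show "\<exists>!\<psi>. induces X K \<A> (net_c0alg X K \<B>) (family_comp K \<A> (tau X K \<B>) \<phi>) \<psi>"
      by (rule induces_unique)
    show "induces X K \<A> (net_c0alg X K \<B>) (family_comp K \<A> (tau X K \<B>) \<phi>) (phi_tau X K \<A> \<B> \<phi>)"
      using agrees_phi_tau by (simp add: induces_iff)
    show "c0_morphism X (net_c0alg X K \<A>) (net_c0alg X K \<B>) (phi_tau X K \<A> \<B> \<phi>)"
      by (rule phi_tau_morphism)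
  qed (rule is_functor_phi_tau)
qed

end
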